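(* Let $a\in(0,1]$, let $\theta\in C^1((0,\infty))$ satisfy $\sup_{r>0}|r\theta'(r)|<\infty$, and suppose there is $R>0$ with $\theta'(r)=0$ for all $r\ge R$. Then for all $\varepsilon>0$ and $\delta>0$ there is a constant $C_{\delta,\varepsilon}$ such that for every $u_0\in L^2_w(\Omega)$ the solution $u(t)=e^{t\Delta_D^\Omega}u_0$ of $\partial_tu-\Delta_D^\Omega u=0$, $u(0)=u_0$, satisfies $$\|u(t)\|_{L^\infty(\Omega)}\le C_{\delta,\varepsilon}\,(1+t-\varepsilon)^{-\frac12-\frac1{4a}+\delta}\,\|u_0\|_{L^2_w(\Omega)}\qquad\text{for all } t\ge\varepsilon.$$
   Context: Curved wedge $\Omega:=\{(r\cos[\varphi+\theta(r)],r\sin[\varphi+\theta(r)]):r>0,\ \varphi\in(0,2\pi a)\}$; $-\Delta_D^\Omega$ is the Dirichlet Laplacian in $L^2(\Omega)$ (form $\|\nabla u\|^2$ on $H_0^1(\Omega)$); $L^2_w(\Omega):=L^2(\Omega,e^{|x|^2/4}dx)$. *)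

theory Defs
  imports "HOL-Analysis.Analysis"
begin

definition curved_wedge :: "real \<Rightarrow> (real \<Rightarrow> real) \<Rightarrow> (real \<times> real) set" where
  "curved_wedge a \<theta> =
     {(r * cos (\<phi> + \<theta> r), r * sin (\<phi> + \<theta> r)) | r \<phi>. 0 < r \<and> 0 < \<phi> \<and> \<phi> < 2 * pi * a}"

definition sq_int :: "(real \<times> real) set \<Rightarrow> (real \<times> real \<Rightarrow> real) \<Rightarrow> bool" where
  "sq_int S f \<longleftrightarrow> f \<in> borel_measurable (lebesgue_on S) \<and>
      integrable (lebesgue_on S) (\<lambda>x. (f x)\<^sup>2)"

definition sq_int_vec :: "(real \<times> real) set \<Rightarrow> (real \<times> real \<Rightarrow> real \<times> real) \<Rightarrow> bool" where
  "sq_int_vec S G \<longleftrightarrow> G \<in> borel_measurable (lebesgue_on S) \<and>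
      integrable (lebesgue_on S) (\<lambda>x. (norm (G x))\<^sup>2)"

definition test_fun :: "(real \<times> real) set \<Rightarrow> (real \<times> real \<Rightarrow> real) \<Rightarrow> (real \<times> real \<Rightarrow> real \<times> real) \<Rightarrow> bool" where
  "test_fun S \<phi> g \<longleftrightarrow>
     (\<forall>x. (\<phi> has_derivative (\<lambda>h. g x \<bullet> h)) (at x)) \<and> continuous_on UNIV g \<and>
     compact (closure {x. \<phi> x \<noteq> 0}) \<and> closure {x. \<phi> x \<noteq> 0} \<subseteq> S"

definition H01 :: "(real \<times> real) set \<Rightarrow> (real \<times> real \<Rightarrow> real) \<Rightarrow> (real \<times> real \<Rightarrow> real \<times> real) \<Rightarrow> bool" where
  "H01 S v G \<longleftrightarrow> sq_int S v \<and> sq_int_vec S G \<and>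
     (\<exists>\<phi> g. (\<forall>n. test_fun S (\<phi> n) (g n)) \<and>
        (\<lambda>n. \<integral>x. (\<phi> n x - v x)\<^sup>2 \<partial>lebesgue_on S) \<longlonglongrightarrow> 0 \<and>
        (\<lambda>n. \<integral>x. (norm (g n x - G x))\<^sup>2 \<partial>lebesgue_on S) \<longlonglongrightarrow> 0)"

text \<open>u (with spatial gradient G) is the solution of the heat equation
  \<open>\<partial>_t u - \<Delta>_D u = 0\<close>, \<open>u(0) = u0\<close> in L^2(S) with Dirichlet boundary conditions,
  i.e. \<open>u(t) = e^{t \<Delta>_D} u0\<close>: a weak solution, continuous in L^2 on [0,\<infinity>),
  with values in H_0^1 for t > 0 and gradient locally square integrable in time on (0,\<infinity>).\<close>
definition dirichlet_heat_solution ::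
  "(real \<times> real) set \<Rightarrow> (real \<times> real \<Rightarrow> real) \<Rightarrow> (real \<Rightarrow> real \<times> real \<Rightarrow> real)
     \<Rightarrow> (real \<Rightarrow> real \<times> real \<Rightarrow> real \<times> real) \<Rightarrow> bool" where
  "dirichlet_heat_solution S u0 u G \<longleftrightarrow>
     (\<forall>t\<ge>0. sq_int S (u t)) \<and>
     (\<forall>x\<in>S. u 0 x = u0 x) \<and>
     (\<forall>t\<ge>0. ((\<lambda>s. \<integral>x. (u s x - u t x)\<^sup>2 \<partial>lebesgue_on S) \<longlongrightarrow> 0) (at t within {0..})) \<and>
     (\<forall>t>0. H01 S (u t) (G t)) \<and>
     (\<forall>a b. 0 < a \<longrightarrow>
        (\<integral>\<^sup>+ t\<in>{a..b}. ennreal (\<integral>x. (norm (G t x))\<^sup>2 \<partial>lebesgue_on S) \<partial>lborel) < \<infinity>) \<and>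
     (\<forall>\<phi> g t. test_fun S \<phi> g \<longrightarrow> 0 < t \<longrightarrow>
        ((\<lambda>s. \<integral>x. u s x * \<phi> x \<partial>lebesgue_on S) has_real_derivative
           (- (\<integral>x. G t x \<bullet> g x \<partial>lebesgue_on S))) (at t))"

definition in_L2w :: "(real \<times> real) set \<Rightarrow> (real \<times> real \<Rightarrow> real) \<Rightarrow> bool" where
  "in_L2w S f \<longleftrightarrow> f \<in> borel_measurable (lebesgue_on S) \<and>
      integrable (lebesgue_on S) (\<lambda>x. (f x)\<^sup>2 * exp ((norm x)\<^sup>2 / 4))"

definition L2w_norm :: "(real \<times> real) set \<Rightarrow> (real \<times> real \<Rightarrow> real) \<Rightarrow> real" where
  "L2w_norm S f = sqrt (\<integral>x. (f x)\<^sup>2 * exp ((norm x)\<^sup>2 / 4) \<partial>lebesgue_on S)"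

end

theory Submission
  imports Defs
begin

text \<open>For a time-dependent weight \<open>w\<close> one has
  \<open>d/dt \<integral> w u\<^sup>2 = \<integral> (\<partial>\<^sub>t w) u\<^sup>2 - 2 \<integral> w \<bar>\<nabla>u\<bar>\<^sup>2 - 2 \<integral> u \<nabla>u \<bullet> \<nabla>w\<close>.
  The bound follows from two choices of \<open>w\<close> for which the right-hand side is nonpositive.

  Decay in \<open>L\<^sup>2\<close>: put \<open>\<nu> = 1 / (2 a)\<close>, \<open>E = (1 + t) powr (- 1 - \<nu>) * exp (- \<bar>x\<bar>\<^sup>2 / (4 (1 + t)))\<close> and
  \<open>w = 1 / (E + \<mu>)\<close>. Since \<open>E\<close> is the radial heat kernel in dimension \<open>2 + 2 \<nu>\<close>, and since every circle meets the wedge in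
  an arc of angle \<open>2 \<pi> a\<close> on which the first Dirichlet eigenvalue is \<open>\<nu>\<^sup>2\<close> whatever the curve \<open>\<theta>\<close> is, the
  Hardy inequality that is needed holds exactly. Letting \<open>\<mu> \<rightarrow> 0\<close> gives the rate \<open>(1 + t) powr (- 1 - \<nu>)\<close>
  for the squared norm. Smoothing: with \<open>w\<close> the backward heat kernel of the plane, \<open>u\<^sup>2\<close> is a subsolution, which bounds
  all ball averages of \<open>u\<^sup>2\<close>.

  Weak solutions are locally Lipschitz in time, so that energies can be differentiated: self-adjointness of the
  Laplacian makes \<open>\<langle>u s, u t\<rangle>\<close> a function \<open>f (s + t)\<close> of the sum; then
  \<open>\<parallel>u (t + h) - u t\<parallel>\<^sup>2\<close> is a second difference of \<open>f\<close>, and it is of order \<open>h\<^sup>2\<close> because the second and fourth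
  differences of \<open>f\<close> are nonnegative.\<close>

subsection \<open>Square-integrable functions and test functions\<close>

text \<open>Both weights come from one principle. In the straight wedge, in polar coordinates, h =
  r^\<nu> sin(\<nu> \<phi>) is harmonic and h E solves the heat equation, so v = h (E + \<mu>) is
  again a solution. The relative entropy, the integral of (u/v)^2 v h, then decreases, and v h / v^2
  = 1 / (E + \<mu>). Smoothing is the case v = 1 with the backward heat kernel in place of h. In the
  curved wedge the gradient of log v is replaced by a vector field that need not be a gradient. The
  constant \<mu> is there because 1 / E grows like a Gaussian: adding it makes w and its derivatives
  bounded, so that w u stays in \<open>H01\<close>. At t = 0, 1 / E is exactly the weight exp(|x|^2
  / 4) of the initial data. A weak solution is differentiable in time only when paired with a fixed
  test function, whereas the energy pairs u(t) with w u(t), which itself moves. The Lipschitz bound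
  in time makes the quadratic remainder of the energy negligible and lets \<open>H01\<close>
  functions replace test functions in the weak equation.\<close>

definition l2 :: "'a measure \<Rightarrow> ('a \<Rightarrow> 'b::euclidean_space) \<Rightarrow> bool" where
  "l2 M f \<longleftrightarrow> f \<in> borel_measurable M \<and> integrable M (\<lambda>x. (norm (f x))\<^sup>2)"

text \<open>One pairing serves functions and gradient fields alike. Functions are not identified
  almost everywhere, so \<open>ip M f f\<close> is the square of a seminorm only.\<close>

definition ip :: "'a measure \<Rightarrow> ('a \<Rightarrow> 'b::euclidean_space) \<Rightarrow> ('a \<Rightarrow> 'b) \<Rightarrow> real" where
  "ip M f g = (\<integral>x. f x \<bullet> g x \<partial>M)"

lemma l2_measurable: "l2 M f \<Longrightarrow> f \<in> borel_measurable M"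
  by (simp add: l2_def)

lemma l2_integrable_inner:
  assumes "l2 M f" "l2 M g"
  shows "integrable M (\<lambda>x. f x \<bullet> g x)"
proof (rule Bochner_Integration.integrable_bound)
  show "integrable M (\<lambda>x. (norm (f x))\<^sup>2 + (norm (g x))\<^sup>2)"
    using assms by (auto simp: l2_def)
  show "(\<lambda>x. f x \<bullet> g x) \<in> borel_measurable M"
    using assms by (auto simp: l2_def)
  show "AE x in M. norm (f x \<bullet> g x) \<le> norm ((norm (f x))\<^sup>2 + (norm (g x))\<^sup>2)"
  proof (rule AE_I2)
    fix x
    have "\<bar>f x \<bullet> g x\<bar> \<le> norm (f x) * norm (g x)"
      by (rule Cauchy_Schwarz_ineq2)
    also have "\<dots> \<le> (norm (f x))\<^sup>2 + (norm (g x))\<^sup>2"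
      using sum_squares_bound[of "norm (f x)" "norm (g x)"]
        mult_nonneg_nonneg[of "norm (f x)" "norm (g x)"] norm_ge_zero[of "f x"] norm_ge_zero[of "g x"]
      by linarith
    finally show "norm (f x \<bullet> g x) \<le> norm ((norm (f x))\<^sup>2 + (norm (g x))\<^sup>2)" by simp
  qed
qed

lemma ip_commute: "ip M f g = ip M g f"
  by (simp add: ip_def inner_commute)

abbreviation sqnorm :: "'a measure \<Rightarrow> ('a \<Rightarrow> 'b::euclidean_space) \<Rightarrow> real" where
  "sqnorm M f \<equiv> ip M f f"

lemma ip_self: "sqnorm M f = (\<integral>x. (norm (f x))\<^sup>2 \<partial>M)"
  by (simp add: ip_def power2_norm_eq_inner)

lemma ip_self_nonneg: "0 \<le> sqnorm M f"
  by (simp add: ip_self)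

lemma l2_add:
  assumes "l2 M f" "l2 M g" shows "l2 M (\<lambda>x. f x + g x)"
proof -
  have "integrable M (\<lambda>x. (norm (f x))\<^sup>2 + 2 * (f x \<bullet> g x) + (norm (g x))\<^sup>2)"
    using assms l2_integrable_inner[OF assms] by (auto simp: l2_def)
  moreover have "(\<lambda>x. (norm (f x))\<^sup>2 + 2 * (f x \<bullet> g x) + (norm (g x))\<^sup>2) = (\<lambda>x. (norm (f x + g x))\<^sup>2)"
    by (simp add: power2_norm_eq_inner inner_add inner_commute algebra_simps)
  ultimately show ?thesis using assms by (auto simp: l2_def)
qed

lemma l2_scaleR:
  assumes "l2 M f" shows "l2 M (\<lambda>x. c *\<^sub>R f x)"
  using assms by (auto simp: l2_def power_mult_distrib)

lemma l2_diff:
  assumes "l2 M f" "l2 M g" shows "l2 M (\<lambda>x. f x - g x)"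
  using l2_add[OF assms(1) l2_scaleR[OF assms(2), of "-1"]] by simp

lemma l2_scaleR_bounded:
  assumes f: "l2 M f" and w: "w \<in> borel_measurable M" and C: "\<And>x. \<bar>w x\<bar> \<le> C"
  shows "l2 M (\<lambda>x. w x *\<^sub>R f x)"
  unfolding l2_def
proof
  show "(\<lambda>x. w x *\<^sub>R f x) \<in> borel_measurable M" using f w by (auto simp: l2_def)
  show "integrable M (\<lambda>x. (norm (w x *\<^sub>R f x))\<^sup>2)"
  proof (rule Bochner_Integration.integrable_bound)
    show "integrable M (\<lambda>x. C\<^sup>2 * (norm (f x))\<^sup>2)" using f by (auto simp: l2_def)
    show "(\<lambda>x. (norm (w x *\<^sub>R f x))\<^sup>2) \<in> borel_measurable M" using f w by (auto simp: l2_def)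
    show "AE x in M. norm ((norm (w x *\<^sub>R f x))\<^sup>2) \<le> norm (C\<^sup>2 * (norm (f x))\<^sup>2)"
    proof (rule AE_I2)
      fix x
      have "\<bar>w x\<bar>\<^sup>2 \<le> C\<^sup>2" by (rule power_mono[OF C]) simp
      then show "norm ((norm (w x *\<^sub>R f x))\<^sup>2) \<le> norm (C\<^sup>2 * (norm (f x))\<^sup>2)"
        by (simp add: power_mult_distrib mult_right_mono)
    qed
  qed
qed

lemma l2_scaleR_bounded':
  fixes f :: "'a \<Rightarrow> real" and V :: "'a \<Rightarrow> 'b::euclidean_space"
  assumes f: "l2 M f" and V: "V \<in> borel_measurable M" and C: "\<And>x. norm (V x) \<le> C"
  shows "l2 M (\<lambda>x. f x *\<^sub>R V x)"
  unfolding l2_def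
proof
  show "(\<lambda>x. f x *\<^sub>R V x) \<in> borel_measurable M" using f V by (auto simp: l2_def)
  have "l2 M (\<lambda>x. norm (V x) *\<^sub>R f x)"
    by (rule l2_scaleR_bounded[OF f, of _ C]) (use V C in auto)
  then show "integrable M (\<lambda>x. (norm (f x *\<^sub>R V x))\<^sup>2)"
    by (simp add: l2_def power_mult_distrib mult.commute)
qed

lemma ip_add_left:
  "l2 M f \<Longrightarrow> l2 M g \<Longrightarrow> l2 M h \<Longrightarrow> ip M (\<lambda>x. f x + g x) h = ip M f h + ip M g h"
  by (simp add: ip_def inner_add_left l2_integrable_inner)

lemma ip_diff_left:
  "l2 M f \<Longrightarrow> l2 M g \<Longrightarrow> l2 M h \<Longrightarrow> ip M (\<lambda>x. f x - g x) h = ip M f h - ip M g h"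
  by (simp add: ip_def inner_diff_left l2_integrable_inner)

lemma ip_add_right:
  "l2 M f \<Longrightarrow> l2 M g \<Longrightarrow> l2 M h \<Longrightarrow> ip M h (\<lambda>x. f x + g x) = ip M h f + ip M h g"
  by (simp add: ip_def inner_add_right l2_integrable_inner)

lemma ip_diff_right:
  "l2 M f \<Longrightarrow> l2 M g \<Longrightarrow> l2 M h \<Longrightarrow> ip M h (\<lambda>x. f x - g x) = ip M h f - ip M h g"
  by (simp add: ip_def inner_diff_right l2_integrable_inner)

lemma ip_scaleR_left: "ip M (\<lambda>x. c *\<^sub>R f x) h = c * ip M f h"
  by (simp add: ip_def)

lemma ip_scaleR_right: "ip M h (\<lambda>x. c *\<^sub>R f x) = c * ip M h f"
  by (simp add: ip_def)

lemma ip_diff_self: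
  assumes "l2 M f" "l2 M g"
  shows "sqnorm M (\<lambda>x. f x - g x) = sqnorm M f - 2 * ip M f g + sqnorm M g"
  using assms by (simp add: ip_diff_left ip_diff_right l2_diff ip_commute[of M g f])

lemma ip_add_self:
  assumes "l2 M f" "l2 M g"
  shows "sqnorm M (\<lambda>x. f x + g x) = sqnorm M f + 2 * ip M f g + sqnorm M g"
  using assms by (simp add: ip_add_left ip_add_right l2_add ip_commute[of M g f])

lemma Cauchy_Schwarz_ip:
  assumes f: "l2 M f" and g: "l2 M g"
  shows "\<bar>ip M f g\<bar> \<le> sqrt (sqnorm M f) * sqrt (sqnorm M g)"
proof -
  have quad: "0 \<le> sqnorm M f - 2 * c * ip M f g + c\<^sup>2 * sqnorm M g" for c
    using ip_self_nonneg[of M "\<lambda>x. f x - c *\<^sub>R g x"]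
    unfolding ip_diff_self[OF f l2_scaleR[OF g, of c]]
    by (simp add: ip_scaleR_left ip_scaleR_right power2_eq_square mult.assoc)
  have "(ip M f g)\<^sup>2 \<le> sqnorm M f * sqnorm M g"
  proof (cases "sqnorm M g = 0")
    case True
    have "ip M f g = 0"
    proof (rule ccontr)
      assume "ip M f g \<noteq> 0"
      \<comment> \<open>This multiple of g turns \<open>quad\<close> into 0 \<le> -1.\<close>
      then show False
        using quad[of "(sqnorm M f + 1) / (2 * ip M f g)"] True by simp
    qed
    then show ?thesis using True by simp
  next
    case False
    then have pos: "0 < sqnorm M g" using ip_self_nonneg[of M g] by simp
    show ?thesis
      using quad[of "ip M f g / sqnorm M g"] pos by (simp add: field_simps power2_eq_square)
  qed
  then have "sqrt ((ip M f g)\<^sup>2) \<le> sqrt (sqnorm M f * sqnorm M g)" by (rule real_sqrt_le_mono)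
  then show ?thesis by (simp add: real_sqrt_mult)
qed

text \<open>The filter is arbitrary and square integrability is asked only eventually: the lemma
  serves sequences of test functions as well as time increments tending to 0, where u(t + h) is
  controlled only for small h.\<close>

lemma ip_tendsto:
  assumes fn: "\<forall>\<^sub>F n in F. l2 M (fn n)" and f: "l2 M f"
    and gn: "\<forall>\<^sub>F n in F. l2 M (gn n)" and g: "l2 M g"
    and cf: "((\<lambda>n. sqnorm M (\<lambda>x. fn n x - f x)) \<longlongrightarrow> 0) F"
    and cg: "((\<lambda>n. sqnorm M (\<lambda>x. gn n x - g x)) \<longlongrightarrow> 0) F"
  shows "((\<lambda>n. ip M (fn n) (gn n)) \<longlongrightarrow> ip M f g) F"
proof -
  define a where "a n = sqrt (sqnorm M (\<lambda>x. fn n x - f x))" for n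
  define b where "b n = sqrt (sqnorm M (\<lambda>x. gn n x - g x))" for n
  have a: "(a \<longlongrightarrow> 0) F" and b: "(b \<longlongrightarrow> 0) F"
    using tendsto_real_sqrt[OF cf] tendsto_real_sqrt[OF cg] by (simp_all add: a_def[abs_def] b_def[abs_def])
  have "((\<lambda>n. a n * b n + a n * sqrt (sqnorm M g) + sqrt (sqnorm M f) * b n) \<longlongrightarrow> 0 * 0 + 0 * sqrt (sqnorm M g) + sqrt
    (sqnorm M f) * 0) F"
    by (intro tendsto_intros a b)
  then have lim: "((\<lambda>n. a n * b n + a n * sqrt (sqnorm M g) + sqrt (sqnorm M f) * b n) \<longlongrightarrow> 0) F" by simp
  have "((\<lambda>n. ip M (fn n) (gn n) - ip M f g) \<longlongrightarrow> 0) F"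
  proof (rule Lim_null_comparison[OF _ lim])
    show "\<forall>\<^sub>F n in F. norm (ip M (fn n) (gn n) - ip M f g) \<le> a n * b n + a n * sqrt (sqnorm M g) + sqrt (sqnorm M f) * b n"
      using fn gn
    proof eventually_elim
      case (elim n)
      note df = l2_diff[OF elim(1) f] and dg = l2_diff[OF elim(2) g]
      have "ip M (fn n) (gn n) - ip M f g =
         ip M (\<lambda>x. fn n x - f x) (\<lambda>x. gn n x - g x) + ip M (\<lambda>x. fn n x - f x) g + ip M f (\<lambda>x. gn n x - g x)"
        using elim f g df dg by (simp add: ip_diff_left ip_diff_right)
      then show ?case
        using Cauchy_Schwarz_ip[OF df dg] Cauchy_Schwarz_ip[OF df g] Cauchy_Schwarz_ip[OF f dg]
        unfolding a_def b_def real_norm_def by linarith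
    qed
  qed
  then show ?thesis by (simp add: Lim_null[symmetric])
qed

lemma ip_tendsto_left:
  assumes fn: "\<forall>\<^sub>F n in F. l2 M (fn n)" and f: "l2 M f" and g: "l2 M g"
    and cf: "((\<lambda>n. sqnorm M (\<lambda>x. fn n x - f x)) \<longlongrightarrow> 0) F"
  shows "((\<lambda>n. ip M (fn n) g) \<longlongrightarrow> ip M f g) F"
  by (rule ip_tendsto[OF fn f _ g cf]) (simp_all add: g ip_def)

section \<open>Square integrability of solutions and test functions\<close>

lemma sq_int_l2: "sq_int S f \<longleftrightarrow> l2 (lebesgue_on S) f"
  by (simp add: sq_int_def l2_def)

lemma sq_int_vec_l2: "sq_int_vec S f \<longleftrightarrow> l2 (lebesgue_on S) f"
  by (simp add: sq_int_vec_def l2_def)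

lemma test_fun_grad_zero:
  assumes "test_fun S \<phi> g" "x \<notin> closure {x. \<phi> x \<noteq> 0}"
  shows "g x = 0"
proof -
  let ?U = "- closure {x. \<phi> x \<noteq> 0}"
  have z: "\<phi> y = 0" if "y \<in> ?U" for y using that closure_subset[of "{x. \<phi> x \<noteq> 0}"] by auto
  have "(\<phi> has_derivative (\<lambda>h. 0)) (at x)"
  proof (rule has_derivative_transform_within_open)
    show "((\<lambda>_. 0) has_derivative (\<lambda>h. 0)) (at x)" by simp
    show "open ?U" by (simp add: open_Compl)
    show "x \<in> ?U" using assms(2) by simp
    show "\<And>y. y \<in> ?U \<Longrightarrow> 0 = \<phi> y" by (rule z[symmetric])
  qed
  moreover have "(\<phi> has_derivative (\<lambda>h. g x \<bullet> h)) (at x)" using assms(1) unfolding test_fun_def by blast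
  ultimately have "(\<lambda>h. g x \<bullet> h) = (\<lambda>h. 0)" using has_derivative_unique by blast
  then have "g x \<bullet> g x = 0" by (rule fun_cong)
  then show ?thesis by simp
qed

lemma compact_support_l2:
  fixes f :: "real \<times> real \<Rightarrow> 'b::euclidean_space"
  assumes c: "continuous_on UNIV f" and K: "compact K" and z: "\<And>x. x \<notin> K \<Longrightarrow> f x = 0"
    and S: "S \<in> sets lebesgue"
  shows "l2 (lebesgue_on S) f"
  unfolding l2_def
proof
  have fm: "f \<in> borel_measurable lebesgue"
    using borel_measurable_continuous_onI[OF c] by (auto intro: measurable_completion)
  then show "f \<in> borel_measurable (lebesgue_on S)" by (rule measurable_restrict_space1)
  have "integrable lborel (\<lambda>x. indicator K x *\<^sub>R (norm (f x))\<^sup>2)"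
    by (rule borel_integrable_compact[OF K]) (intro continuous_intros continuous_on_subset[OF c], simp)
  moreover have "(\<lambda>x. indicator K x *\<^sub>R (norm (f x))\<^sup>2) = (\<lambda>x. (norm (f x))\<^sup>2)"
    using z by (auto simp: indicator_def fun_eq_iff)
  ultimately have "integrable lborel (\<lambda>x. (norm (f x))\<^sup>2)" by simp
  then have "integrable lebesgue (\<lambda>x. (norm (f x))\<^sup>2)"
    using integrable_completion borel_measurable_integrable by blast
  from integrable_mult_indicator[OF S this]
  show "integrable (lebesgue_on S) (\<lambda>x. (norm (f x))\<^sup>2)"
    using S by (subst integrable_restrict_space) simp_all
qed

lemma test_fun_continuous: "test_fun S \<phi> g \<Longrightarrow> continuous_on UNIV \<phi>"
  unfolding test_fun_def by (meson continuous_at_imp_continuous_on has_derivative_continuous)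

lemma test_fun_l2:
  assumes "test_fun S \<phi> g" "S \<in> sets lebesgue"
  shows "l2 (lebesgue_on S) \<phi>" "l2 (lebesgue_on S) g"
proof -
  define K where "K = closure {x. \<phi> x \<noteq> 0}"
  have K: "compact K" and g: "continuous_on UNIV g" using assms(1) by (auto simp: test_fun_def K_def)
  have "\<phi> x = 0" if "x \<notin> K" for x using that closure_subset[of "{x. \<phi> x \<noteq> 0}"] by (auto simp: K_def)
  then show "l2 (lebesgue_on S) \<phi>"
    by (rule compact_support_l2[OF test_fun_continuous[OF assms(1)] K _ assms(2)])
  show "l2 (lebesgue_on S) g"
    by (rule compact_support_l2[OF g K _ assms(2)]) (auto simp: K_def intro: test_fun_grad_zero[OF assms(1)])
qed

subsection \<open>Countably many gradients suffice\<close>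

text \<open>Functions are sorted by countably many finite records: a radius m, a mesh 1/(n+1), an
  oscillation bound 1/(j+1), and values from a countable dense set at the points of a finite net.
  Functions with the same record are uniformly close, so one representative per nonempty class
  suffices. Representatives are chosen inside T, so that D consists of gradients of test functions
  when T does.\<close>

lemma separable_compactly_supported:
  fixes T :: "('a::euclidean_space \<Rightarrow> 'b::euclidean_space) set"
  assumes S: "S \<in> sets lebesgue"
    and cont: "\<And>g. g \<in> T \<Longrightarrow> continuous_on UNIV g"
    and supp: "\<And>g. g \<in> T \<Longrightarrow> \<exists>r. \<forall>x. r < norm x \<longrightarrow> g x = 0"
  obtains D where "countable D" "D \<subseteq> T"
    "\<And>g e. g \<in> T \<Longrightarrow> 0 < e \<Longrightarrow> \<exists>g'\<in>D. sqnorm (lebesgue_on S) (\<lambda>x. g' x - g x) < e"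
proof -
  obtain Q :: "'b set" where Q: "countable Q" "\<And>X. open X \<Longrightarrow> X \<noteq> {} \<Longrightarrow> \<exists>d\<in>Q. d \<in> X"
    by (rule countable_dense_setE) blast
  have "\<exists>l::'a list. set l \<subseteq> cball 0 (real m) \<and> cball 0 (real m) \<subseteq> (\<Union>p\<in>set l. ball p (1 / real (Suc n)))" for m n :: nat
  proof -
    have "compact (cball (0::'a) (real m))" by simp
    then have "seq_compact (cball (0::'a) (real m))" by (simp add: compact_eq_seq_compact_metric)
    then obtain k where "finite k" "k \<subseteq> cball (0::'a) (real m)"
        "cball 0 (real m) \<subseteq> (\<Union>x\<in>k. ball x (1 / real (Suc n)))"
      using seq_compact_imp_totally_bounded[of "cball (0::'a) (real m)"] by (metis of_nat_0_less_iff zero_less_Suc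
        zero_less_divide_1_iff)
    then show ?thesis using finite_list[of k] by blast
  qed
  note ex = this
  define P :: "nat \<Rightarrow> nat \<Rightarrow> 'a list" where
    "P m n = (SOME l. set l \<subseteq> cball 0 (real m) \<and> cball 0 (real m) \<subseteq> (\<Union>p\<in>set l. ball p (1 / real (Suc n))))" for m n
  have P: "set (P m n) \<subseteq> cball 0 (real m)"
      "cball 0 (real m) \<subseteq> (\<Union>p\<in>set (P m n). ball p (1 / real (Suc n)))" for m n
    unfolding P_def by (rule someI_ex[OF ex[of m n], THEN conjunct1], rule someI_ex[OF ex[of m n], THEN conjunct2])
  define cls where "cls = (\<lambda>(m::nat, n::nat, j::nat, l::'b list). {g\<in>T. (\<forall>x. real m < norm x \<longrightarrow> g x = 0) \<and>
     (\<forall>x\<in>cball 0 (real m). \<forall>y\<in>cball 0 (real m). dist x y < 1 / real (Suc n) \<longrightarrow> dist (g x) (g y) < 1 / real (Suc j)) \<and>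
     length l = length (P m n) \<and> (\<forall>i<length l. dist (g (P m n ! i)) (l ! i) < 1 / real (Suc j))})"
  define I where "I = (UNIV :: nat set) \<times> (UNIV :: nat set) \<times> (UNIV :: nat set) \<times> lists Q"
  define D where "D = (\<lambda>ix. SOME g. g \<in> cls ix) ` {ix\<in>I. cls ix \<noteq> {}}"
  have "countable I" unfolding I_def using Q(1) by (intro countable_SIGMA) auto
  then have cD: "countable D" unfolding D_def by (intro countable_image countable_subset[OF _ \<open>countable I\<close>]) auto
  have pick: "(SOME g. g \<in> cls ix) \<in> cls ix" if "cls ix \<noteq> {}" for ix
    using that by (simp add: some_in_eq)
  have clsT: "cls ix \<subseteq> T" for ix by (cases ix) (auto simp: cls_def)
  have DT: "D \<subseteq> T" unfolding D_def using pick clsT by blast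
  have close: "dist (g x) (g' x) \<le> 4 / real (Suc j) * indicator (cball 0 (real m)) x"
    if g: "g \<in> cls (m,n,j,l)" and g': "g' \<in> cls (m,n,j,l)" for g g' m n j l x
  proof (cases "x \<in> cball 0 (real m)")
    case False
    then show ?thesis using g g' by (auto simp: cls_def)
  next
    case True
    then obtain p where p: "p \<in> set (P m n)" "dist p x < 1 / real (Suc n)" using P(2)[of m n] by fastforce
    then obtain i where i: "i < length (P m n)" "P m n ! i = p" by (meson in_set_conv_nth)
    have pm: "p \<in> cball 0 (real m)" using P(1) p by blast
    have "dist (g p) (g x) < 1 / real (Suc j)" "dist (g' p) (g' x) < 1 / real (Suc j)"
      using g g' p(2) pm True unfolding cls_def by blast+
    moreover have "dist (g p) (l ! i) < 1 / real (Suc j)" "dist (g' p) (l ! i) < 1 / real (Suc j)"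
      using g g' i unfolding cls_def by auto
    \<comment> \<open>Four legs: for each of the two functions, from x to the net point p and from
      the value at p to the recorded value.\<close>
    moreover have "dist (g x) (g' x) \<le> dist (g p) (g x) + dist (g p) (l ! i) + dist (g' p) (l ! i) + dist (g' p) (g' x)"
      by metric
    ultimately have "dist (g x) (g' x) \<le> 4 * (1 / real (Suc j))" by linarith
    then show ?thesis using True by simp
  qed
  have approx: "\<exists>g'\<in>D. sqnorm (lebesgue_on S) (\<lambda>x. g' x - g x) < e" if g: "g \<in> T" and e: "0 < e" for g e
  proof -
    obtain r where r: "\<And>x. r < norm x \<Longrightarrow> g x = 0" using supp[OF g] by blast
    obtain m :: nat where m: "r \<le> real m" using real_arch_simple by blast
    have ind: "integrable (lebesgue_on S) (indicator (cball 0 (real m)) :: 'a \<Rightarrow> real)"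
    proof -
      have "integrable lebesgue (\<lambda>x::'a. indicator S x *\<^sub>R (indicator (cball 0 (real m)) x :: real))"
        by (rule integrable_mult_indicator[OF S]) (use emeasure_lborel_cball_finite[of "0::'a" "real m"] in \<open>auto
          intro!: integrable_real_indicator\<close>)
      then show ?thesis using S by (subst integrable_restrict_space) auto
    qed
    define K where "K = (\<integral>x. indicator (cball (0::'a) (real m)) x \<partial>lebesgue_on S :: real)"
    have K: "0 \<le> K" unfolding K_def by (intro integral_nonneg_AE) auto
    \<comment> \<open>16 is the square of the constant 4 in \<open>close\<close>, and K is the
      measure of the part of the ball inside S. One of the two factors 1/(j+1) is discarded
      below.\<close>
    obtain j :: nat where j: "16 * (K + 1) / e < real (Suc j)"
      using reals_Archimedean2[of "16 * (K + 1) / e"] by (meson less_trans lessI of_nat_less_iff)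
    have "uniformly_continuous_on (cball 0 (real m)) g"
      by (intro compact_uniformly_continuous continuous_on_subset[OF cont[OF g]]) auto
    then obtain d where d: "0 < d" "\<And>x y. x \<in> cball 0 (real m) \<Longrightarrow> y \<in> cball 0 (real m) \<Longrightarrow> dist y x < d \<Longrightarrow> dist (g y) (g x)
      < 1 / real (Suc j)"
      unfolding uniformly_continuous_on_def by (metis of_nat_0_less_iff zero_less_Suc zero_less_divide_1_iff)
    obtain n where n: "1 / real (Suc n) < d" using nat_approx_posE[OF d(1)] by blast
    have "\<exists>q\<in>Q. dist (g (P m n ! i)) q < 1 / real (Suc j)" for i
    proof -
      have "ball (g (P m n ! i)) (1 / real (Suc j)) \<noteq> {}" by simp
      from Q(2)[OF open_ball this] show ?thesis by (simp add: ball_def)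
    qed
    then obtain q where q: "\<And>i. q i \<in> Q" "\<And>i. dist (g (P m n ! i)) (q i) < 1 / real (Suc j)"
      using bchoice[of UNIV "\<lambda>i q. q \<in> Q \<and> dist (g (P m n ! i)) q < 1 / real (Suc j)"] by blast
    define l where "l = map q [0..<length (P m n)]"
    have gc: "g \<in> cls (m,n,j,l)"
      unfolding cls_def using g r m d(2) n q by (auto simp: l_def dist_commute)
    have "(m,n,j,l) \<in> I" unfolding I_def l_def using q(1) by auto
    define g' where "g' = (SOME h. h \<in> cls (m,n,j,l))"
    have g'c: "g' \<in> cls (m,n,j,l)" unfolding g'_def by (rule pick) (use gc in auto)
    have g'D: "g' \<in> D" unfolding D_def g'_def using \<open>(m,n,j,l) \<in> I\<close> gc by blast
    have "sqnorm (lebesgue_on S) (\<lambda>x. g' x - g x) \<le> (\<integral>x. (4 / real (Suc j))\<^sup>2 * indicator (cball (0::'a) (real m)) x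
      \<partial>lebesgue_on S)"
      unfolding ip_self
    proof (rule integral_mono')
      show "integrable (lebesgue_on S) (\<lambda>x. (4 / real (Suc j))\<^sup>2 * indicator (cball (0::'a) (real m)) x :: real)"
        using ind by simp
      fix x
      have "(dist (g' x) (g x))\<^sup>2 \<le> (4 / real (Suc j) * indicator (cball 0 (real m)) x)\<^sup>2"
        using close[OF g'c gc, of x] by (intro power_mono) auto
      then show "(norm (g' x - g x))\<^sup>2 \<le> (4 / real (Suc j))\<^sup>2 * indicator (cball 0 (real m)) x"
        by (auto simp: dist_norm indicator_def split: if_splits)
    qed simp
    also have "\<dots> = 16 * K / (real (Suc j))\<^sup>2" by (simp add: K_def power2_eq_square)
    also have "\<dots> \<le> 16 * (K + 1) / real (Suc j)"
    proof -
      have "16 * K / (real (Suc j))\<^sup>2 \<le> 16 * K / real (Suc j)"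
        using K by (intro divide_left_mono) (auto simp: power2_eq_square)
      also have "\<dots> \<le> 16 * (K + 1) / real (Suc j)" by (intro divide_right_mono) auto
      finally show ?thesis .
    qed
    also have "\<dots> < e" using j e by (simp add: field_simps)
    finally show ?thesis using g'D by blast
  qed
  show ?thesis by (rule that[OF cD DT approx])
qed

subsection \<open>Second differences\<close>

text \<open>The increments are monotone, so the secant through m and m + 1 supports the sequence on
  the right and, extended backwards, on the left.\<close>

lemma convex_seq_tangent:
  fixes c :: "nat \<Rightarrow> real"
  assumes "\<And>k. 0 \<le> c (k + 2) - 2 * c (k + 1) + c k"
  shows "c m + real i * (c (m + 1) - c m) \<le> c (m + i)"
    and "i \<le> m \<Longrightarrow> c m - real i * (c (m + 1) - c m) \<le> c (m - i)"
proof -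
  define d where "d k = c (Suc k) - c k" for k
  have "d k \<le> d (Suc k)" for k using assms[of k] by (simp add: d_def)
  then have mono: "k \<le> l \<Longrightarrow> d k \<le> d l" for k l by (rule lift_Suc_mono_le)
  show "c m + real i * (c (m + 1) - c m) \<le> c (m + i)"
  proof (induction i)
    case (Suc i)
    have "d m \<le> d (m + i)" by (rule mono) simp
    then show ?case using Suc by (simp add: d_def algebra_simps)
  qed simp
  show "i \<le> m \<Longrightarrow> c m - real i * (c (m + 1) - c m) \<le> c (m - i)"
  proof (induction i)
    case (Suc i)
    have "d (m - Suc i) \<le> d m" by (rule mono) simp
    moreover have "Suc (m - Suc i) = m - i" using Suc.prems by simp
    ultimately show ?case using Suc by (simp add: d_def algebra_simps)
  qed simp
qed

text \<open>The second difference b is itself convex by \<open>d4\<close>, so its value at the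
  centre 2n is at most its symmetric average over n..3n. That sum telescopes to four first
  differences, and each of these is at most 2B/n in the needed direction, since a secant line of
  slope d followed for n steps must stay between -B and B. Dividing 8B/n by the 2(n + 1) summands
  gives the bound.\<close>

lemma convex_seq_second_difference_bound:
  fixes a :: "nat \<Rightarrow> real"
  assumes d2: "\<And>k. 0 \<le> a (k + 2) - 2 * a (k + 1) + a k"
    and d4: "\<And>k. 0 \<le> a (k + 4) - 4 * a (k + 3) + 6 * a (k + 2) - 4 * a (k + 1) + a k"
    and B: "\<And>k. k \<le> 4 * n + 1 \<Longrightarrow> \<bar>a k\<bar> \<le> B" and n: "0 < n"
  shows "a (2 * n + 2) - 2 * a (2 * n + 1) + a (2 * n) \<le> 4 * B / (real n)\<^sup>2"
proof -
  define d where "d k = a (k + 1) - a k" for k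
  define b where "b k = a (k + 2) - 2 * a (k + 1) + a k" for k
  have bd: "b k = d (k + 1) - d k" for k by (simp add: b_def d_def)
  have bconv: "0 \<le> b (k + 2) - 2 * b (k + 1) + b k" for k
  proof -
    have "b (k + 2) - 2 * b (k + 1) + b k = a (k + 4) - 4 * a (k + 3) + 6 * a (k + 2) - 4 * a (k + 1) + a k"
      by (simp add: b_def numeral_eq_Suc)
    then show ?thesis using d4[of k] by simp
  qed
  have sum1: "(\<Sum>i\<le>j. b (m + i)) = d (m + j + 1) - d m" for j m
    by (induction j) (simp_all add: bd)
  have sum2: "j \<le> m \<Longrightarrow> (\<Sum>i\<le>j. b (m - i)) = d (m + 1) - d (m - j)" for j m
  proof (induction j)
    case (Suc j)
    have "Suc (m - Suc j) = m - j" using Suc.prems by simp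
    then show ?case using Suc by (simp add: bd)
  qed (simp add: bd)
  have "2 * b (2 * n) \<le> b (2 * n + i) + b (2 * n - i)" if "i \<le> n" for i
    using convex_seq_tangent(1)[of b "2*n" i, OF bconv] convex_seq_tangent(2)[of b i "2*n", OF bconv] that by simp
  then have "(\<Sum>i\<le>n. 2 * b (2 * n)) \<le> (\<Sum>i\<le>n. b (2 * n + i) + b (2 * n - i))"
    by (intro sum_mono) simp
  also have "\<dots> = d (3 * n + 1) - d (2 * n) + (d (2 * n + 1) - d n)"
    using sum1[of "2 * n" n] sum2[of n "2 * n"] by (simp add: sum.distrib)
  also have "d (3 * n + 1) - d (2 * n) + (d (2 * n + 1) - d n) \<le> 8 * B / n"
  proof -
    have up: "real n * d k \<le> 2 * B" if "k \<le> 3 * n + 1" for k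
      using convex_seq_tangent(1)[of a k n, OF d2] B[of "k + n"] B[of k] that by (simp add: d_def)
    have lo: "- (2 * B) \<le> real n * d k" if "n \<le> k" "k \<le> 3 * n + 1" for k
    proof -
      have "k - n \<le> 4 * n + 1" using that by simp
      then show ?thesis
        using convex_seq_tangent(2)[of a n k, OF d2 that(1)] B[of "k - n"] B[of k] that by (simp add: d_def)
    qed
    have "real n * (d (3 * n + 1) - d (2 * n) + (d (2 * n + 1) - d n)) \<le> 8 * B"
      using up[of "3*n+1"] up[of "2*n+1"] lo[of "2*n"] lo[of n] n by (simp add: algebra_simps)
    then show ?thesis using n by (simp add: field_simps)
  qed
  finally have "2 * (real n + 1) * b (2 * n) \<le> 8 * B / n" by (simp add: algebra_simps)
  then have *: "(real n * (real n + 1)) * b (2 * n) \<le> 4 * B" using n by (simp add: field_simps)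
  have "0 \<le> b (2 * n)" using d2 by (simp add: b_def)
  then have "(real n)\<^sup>2 * b (2 * n) \<le> (real n * (real n + 1)) * b (2 * n)"
    by (intro mult_right_mono) (auto simp: power2_eq_square algebra_simps)
  then have "(real n)\<^sup>2 * b (2 * n) \<le> 4 * B" using * by linarith
  then show ?thesis using n by (simp add: b_def field_simps)
qed

lemma second_difference_bound:
  fixes f :: "real \<Rightarrow> real"
  assumes d2: "\<And>x h. 0 < x \<Longrightarrow> 0 < h \<Longrightarrow> 0 \<le> f (x + 2 * h) - 2 * f (x + h) + f x"
    and d4: "\<And>x h. 0 < x \<Longrightarrow> 0 < h \<Longrightarrow>
       0 \<le> f (x + 4 * h) - 4 * f (x + 3 * h) + 6 * f (x + 2 * h) - 4 * f (x + h) + f x"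
    and \<alpha>: "0 < \<alpha>" and B: "\<And>x. \<alpha> / 2 \<le> x \<Longrightarrow> x \<le> 3 * \<beta> \<Longrightarrow> \<bar>f x\<bar> \<le> B"
    and x: "\<alpha> \<le> x" "x \<le> \<beta>" and h: "0 < h" "h \<le> \<alpha> / 16"
  shows "f (x + 2 * h) - 2 * f (x + h) + f x \<le> 256 * B / \<alpha>\<^sup>2 * h\<^sup>2"
proof -
  \<comment> \<open>The grid of step h is centred so that x has index 2n, with n h at most
    \<alpha>/4: it stays inside [\<alpha>/2, 3\<beta>]. Since h \<le> \<alpha>/16, the floor costs
    at most a factor 2, so n \<ge> \<alpha>/(8h), and 256 = 4 * 8^2.\<close>
  define n where "n = nat \<lfloor>\<alpha> / (4 * h)\<rfloor>"
  have q: "4 \<le> \<alpha> / (4 * h)" using h by (simp add: field_simps)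
  then have n_le: "real n \<le> \<alpha> / (4 * h)" and n_ge: "\<alpha> / (8 * h) \<le> real n"
    unfolding n_def by (simp, linarith)
  have n: "0 < n" using q n_ge by (intro gr0I) (auto simp: field_simps)
  define x0 where "x0 = x - 2 * real n * h"
  define a where "a k = f (x0 + real k * h)" for k
  have nh: "real n * h \<le> \<alpha> / 4" using n_le h by (simp add: field_simps)
  have x0: "\<alpha> / 2 \<le> x0" using x nh by (simp add: x0_def)
  have pos: "0 < x0 + real k * h" for k using x0 \<alpha> h by (intro add_pos_nonneg) auto
  have "a (2 * n + 2) - 2 * a (2 * n + 1) + a (2 * n) \<le> 4 * B / (real n)\<^sup>2"
  proof (rule convex_seq_second_difference_bound[OF _ _ _ n])
    fix k
    show "0 \<le> a (k + 2) - 2 * a (k + 1) + a k"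
      using d2[OF pos[of k] h(1)] by (simp add: a_def algebra_simps)
    show "0 \<le> a (k + 4) - 4 * a (k + 3) + 6 * a (k + 2) - 4 * a (k + 1) + a k"
      using d4[OF pos[of k] h(1)] by (simp add: a_def algebra_simps)
    assume k: "k \<le> 4 * n + 1"
    have "real k \<le> real (4 * n + 1)" using k by (simp only: of_nat_le_iff)
    then have "real k * h \<le> real (4 * n + 1) * h" using h by (intro mult_right_mono) auto
    then have "x0 + real k * h \<le> x + 2 * (real n * h) + h" by (simp add: x0_def algebra_simps)
    also have "\<dots> \<le> 3 * \<beta>" using x nh h \<alpha> by linarith
    finally show "\<bar>a k\<bar> \<le> B" unfolding a_def using x0 h by (intro B) (auto intro: add_increasing2)
  qed
  moreover have "a (2 * n + 2) = f (x + 2 * h)" "a (2 * n + 1) = f (x + h)" "a (2 * n) = f x"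
    by (simp_all add: a_def x0_def algebra_simps)
  moreover have "4 * B / (real n)\<^sup>2 \<le> 256 * B / \<alpha>\<^sup>2 * h\<^sup>2"
  proof -
    have "0 \<le> B" using B[of x] x \<alpha> abs_ge_zero[of "f x"] by linarith
    have "(\<alpha> / (8 * h))\<^sup>2 \<le> (real n)\<^sup>2" using n_ge \<alpha> h by (intro power_mono) auto
    then have "4 * B / (real n)\<^sup>2 \<le> 4 * B / (\<alpha> / (8 * h))\<^sup>2"
      using \<open>0 \<le> B\<close> \<alpha> h n by (intro divide_left_mono) auto
    also have "\<dots> = 256 * B / \<alpha>\<^sup>2 * h\<^sup>2" using \<alpha> h by (simp add: field_simps power2_eq_square)
    finally show ?thesis .
  qed
  ultimately show ?thesis by linarith
qed

subsection \<open>Functions of a sum\<close>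

text \<open>Formally both partial derivatives of g equal -k because k is symmetric, so g depends on
  s + t only. The derivatives are available only in integrated form, so -k is integrated over a
  triangle with legs from (s, t) in the two coordinate directions. Fubini in the two orders gives
  the same boundary terms on the hypotenuse; what remains equates the integrals of g over the two
  legs, and differentiating in the leg length d gives the claim.\<close>

lemma two_parameter_function_of_sum:
  fixes g k :: "real \<Rightarrow> real \<Rightarrow> real" and n :: "real \<Rightarrow> real"
  assumes gc1: "\<And>s. 0 < s \<Longrightarrow> continuous_on {0<..} (g s)"
    and gc2: "\<And>c. continuous_on {0<..<c} (\<lambda>x. g x (c - x))"
    and gsym: "\<And>s t. g s t = g t s" and ksym: "\<And>s t. k s t = k t s"
    and km: "(\<lambda>(s, t). k s t) \<in> borel_measurable (lborel \<Otimes>\<^sub>M lborel)"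
    and kb: "\<And>s t. 0 < s \<Longrightarrow> 0 < t \<Longrightarrow> \<bar>k s t\<bar> \<le> n s * n t"
    and n0: "\<And>s. 0 \<le> n s"
    and ni: "\<And>a b. 0 < a \<Longrightarrow> set_integrable lborel {a..b} n"
    and ftc: "\<And>s1 s2 t. 0 < s1 \<Longrightarrow> s1 \<le> s2 \<Longrightarrow> 0 < t \<Longrightarrow> g s2 t - g s1 t = - (LBINT s:{s1..s2}. k s t)"
    and s: "0 < s" and t: "0 < t" and c: "0 \<le> c"
  shows "g (s + c) t = g s (t + c)"
\<comment> \<open>The derivative in d is taken two-sided at c, so c = 0 is treated apart.\<close>
proof (cases "c = 0")
  case False
  then have cpos: "0 < c" using c by simp
  have gc1': "continuous_on {0<..} (\<lambda>x. g x r)" if "0 < r" for r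
    using gc1[OF that] gsym[of _ r] by (simp cong: continuous_on_cong)
  have key: "integral {t..t + d} (g s) = integral {s..s + d} (\<lambda>x. g x t)" if d: "0 \<le> d" for d
  proof -
    define T where "T = {(x, y). s \<le> x \<and> t \<le> y \<and> x + y \<le> s + t + d}"
    define F where "F = (\<lambda>(x, y). indicator T (x, y) * k x y)"
    have Tm: "T \<in> sets (lborel \<Otimes>\<^sub>M lborel)"
    proof -
      have "closed T" unfolding T_def case_prod_beta' by (intro closed_Collect_conj closed_Collect_le continuous_intros)
      then show ?thesis unfolding lborel_prod by simp
    qed
    have Fm: "F \<in> borel_measurable (lborel \<Otimes>\<^sub>M lborel)"
    proof -
      have "(\<lambda>p. indicator T p * (case p of (s, t) \<Rightarrow> k s t)) \<in> borel_measurable (lborel \<Otimes>\<^sub>M lborel)"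
        using km Tm by measurable
      then show ?thesis by (simp add: F_def case_prod_beta')
    qed
    \<comment> \<open>The product n1 n2 dominates F, which lives in the square spanned by the legs;
      this is what justifies Fubini.\<close>
    define n1 where "n1 x = indicator {s..s + d} x * n x" for x
    define n2 where "n2 x = indicator {t..t + d} x * n x" for x
    have n1: "integrable lborel n1" and n2: "integrable lborel n2"
      using ni[OF s, of "s + d"] ni[OF t, of "t + d"] by (simp_all add: n1_def[abs_def] n2_def[abs_def] set_integrable_def)
    have Fb: "\<bar>F (x, y)\<bar> \<le> n1 x * n2 y" for x y
    proof (cases "(x, y) \<in> T")
      case True
      then have "s \<le> x" "x \<le> s + d" "t \<le> y" "y \<le> t + d" by (auto simp: T_def)
      then show ?thesis using kb[of x y] s t True by (simp add: F_def n1_def n2_def)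
    qed (use n0 in \<open>simp add: F_def n1_def n2_def\<close>)
    have nint: "integrable (lborel \<Otimes>\<^sub>M lborel) (\<lambda>(x, y). n1 x * n2 y)"
    proof (rule lborel_pair.Fubini_integrable)
      show "(\<lambda>(x, y). n1 x * n2 y) \<in> borel_measurable (lborel \<Otimes>\<^sub>M lborel)"
        using n1 n2 by (auto intro!: borel_measurable_times simp: case_prod_beta')
      show "integrable lborel (\<lambda>x. \<integral>y. norm (case (x, y) of (x, y) \<Rightarrow> n1 x * n2 y) \<partial>lborel)"
        using n1 by (simp add: abs_mult integrable_abs)
      show "AE x in lborel. integrable lborel (\<lambda>y. case (x, y) of (x, y) \<Rightarrow> n1 x * n2 y)"
        using n2 by simp
    qed
    have Fi: "integrable (lborel \<Otimes>\<^sub>M lborel) F"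
    proof (rule Bochner_Integration.integrable_bound[OF nint Fm])
      show "AE p in lborel \<Otimes>\<^sub>M lborel. norm (F p) \<le> norm (case p of (x, y) \<Rightarrow> n1 x * n2 y)"
      proof (rule AE_I2)
        fix p :: "real \<times> real"
        show "norm (F p) \<le> norm (case p of (x, y) \<Rightarrow> n1 x * n2 y)"
          using Fb[of "fst p" "snd p"] abs_ge_self[of "n1 (fst p) * n2 (snd p)"] by (simp add: case_prod_beta')
      qed
    qed
    define C where "C = s + t + d"
    have iy: "(\<integral>x. F (x, y) \<partial>lborel) = indicator {t..t + d} y * (g s y - g (C - y) y)" for y
    proof (cases "y \<in> {t..t + d}")
      case True
      have "(\<integral>x. F (x, y) \<partial>lborel) = (LBINT x:{s..C - y}. k x y)"
        unfolding set_lebesgue_integral_def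
        by (intro Bochner_Integration.integral_cong) (use True in \<open>auto simp: F_def T_def C_def indicator_def\<close>)
      also have "\<dots> = - (g (C - y) y - g s y)" using ftc[of s "C - y" y] True s t by (simp add: C_def)
      finally show ?thesis using True by simp
    next
      case False
      then have "F (x, y) = 0" for x using d by (auto simp: F_def T_def indicator_def)
      then show ?thesis using False by simp
    qed
    have ix: "(\<integral>y. F (x, y) \<partial>lborel) = indicator {s..s + d} x * (g x t - g x (C - x))" for x
    proof (cases "x \<in> {s..s + d}")
      case True
      have "(\<integral>y. F (x, y) \<partial>lborel) = (LBINT y:{t..C - x}. k y x)"
        unfolding set_lebesgue_integral_def
        by (intro Bochner_Integration.integral_cong) (use True in \<open>auto simp: F_def T_def C_def indicator_def ksym[of x]\<close>)
      also have "\<dots> = - (g (C - x) x - g t x)" using ftc[of t "C - x" x] True s t by (simp add: C_def)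
      finally show ?thesis using True by (simp add: gsym[of x])
    next
      case False
      then have "F (x, y) = 0" for y using d by (auto simp: F_def T_def indicator_def)
      then show ?thesis using False by simp
    qed
    have "(\<integral>y. (\<integral>x. F (x, y) \<partial>lborel) \<partial>lborel) = (\<integral>x. (\<integral>y. F (x, y) \<partial>lborel) \<partial>lborel)"
      using lborel_pair.Fubini_integral[of "\<lambda>x y. F (x, y)"] Fi by simp
    then have eq: "(LBINT y:{t..t + d}. g s y - g (C - y) y) = (LBINT x:{s..s + d}. g x t - g x (C - x))"
      unfolding iy ix by (simp add: set_lebesgue_integral_def)
    have c1: "continuous_on {t..t + d} (g s)" by (rule continuous_on_subset[OF gc1[OF s]]) (use t in auto)
    have c2: "continuous_on {s..s + d} (\<lambda>x. g x t)" by (rule continuous_on_subset[OF gc1'[OF t]]) (use s in auto)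
    have c3: "continuous_on {s..s + d} (\<lambda>x. g x (C - x))"
      by (rule continuous_on_subset[OF gc2[of C]]) (use s t in \<open>auto simp: C_def\<close>)
    have c4: "continuous_on {t..t + d} (\<lambda>y. g (C - y) y)"
      unfolding gsym[of "C - _"] by (rule continuous_on_subset[OF gc2[of C]]) (use s t in \<open>auto simp: C_def\<close>)
    note si = borel_integrable_compact[OF compact_Icc, folded set_integrable_def]
    \<comment> \<open>The reflection y = C - x identifies the two parametrisations of the
      hypotenuse.\<close>
    have "(LBINT y:{t..t + d}. g (C - y) y) = (LBINT x:{s..s + d}. g x (C - x))"
    proof -
      have "(LBINT y:{t..t + d}. g (C - y) y) = (\<integral>x. indicator {t..t + d} (C + (-1) * x) *\<^sub>R g (C - (C + (-1) * x)) (C +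
        (-1) * x) \<partial>lborel)"
        unfolding set_lebesgue_integral_def by (subst lborel_integral_real_affine[where c = "-1" and t = C]) auto
      also have "\<dots> = (LBINT x:{s..s + d}. g x (C - x))"
        unfolding set_lebesgue_integral_def
        by (intro Bochner_Integration.integral_cong) (auto simp: indicator_def C_def)
      finally show ?thesis .
    qed
    then have "(LBINT y:{t..t + d}. g s y) = (LBINT x:{s..s + d}. g x t)"
      using eq set_integral_diff(2)[OF si[OF c1] si[OF c4]] set_integral_diff(2)[OF si[OF c2] si[OF c3]] by simp
    then show ?thesis
      by (simp add: set_borel_integral_eq_integral(2)[OF si[OF c1]] set_borel_integral_eq_integral(2)[OF si[OF c2]])
  qed
  have deriv: "((\<lambda>d. integral {r..r + d} f) has_real_derivative f (r + c)) (at c)"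
    if f: "continuous_on {0<..} f" and r: "0 < r" for f :: "real \<Rightarrow> real" and r
  proof -
    have "((\<lambda>x. integral {r..x} f) has_real_derivative f (r + c)) (at (r + c) within {r..r + 2 * c})"
      by (rule integral_has_real_derivative) (use cpos r in \<open>auto intro!: continuous_on_subset[OF f]\<close>)
    then have "((\<lambda>x. integral {r..x} f) has_real_derivative f (r + c)) (at (r + c))"
      using at_within_Icc_at[of r "r + c" "r + 2 * c"] cpos by simp
    then have "((\<lambda>x. integral {r..x} f) has_real_derivative f (r + c)) (at (c + r))" by (simp add: add.commute)
    then show ?thesis using DERIV_shift[of "\<lambda>x. integral {r..x} f" "f (r + c)" c r] by (simp add: add.commute)
  qed
  have "((\<lambda>d. integral {s..s + d} (\<lambda>x. g x t)) has_real_derivative g s (t + c)) (at c)"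
  proof (rule has_field_derivative_transform_within_open[OF deriv[OF gc1[OF s] t]])
    show "open {0::real<..}" by simp
    show "c \<in> {0<..}" using cpos by simp
    show "\<And>x. x \<in> {0<..} \<Longrightarrow> integral {t..t + x} (g s) = integral {s..s + x} (\<lambda>x. g x t)" using key by simp
  qed
  then show ?thesis using deriv[OF gc1'[OF t] s] by (rule DERIV_unique[symmetric])
qed simp

subsection \<open>Regularity in time of weak solutions\<close>

lemma H01_l2: "H01 S v G \<Longrightarrow> l2 (lebesgue_on S) v" "H01 S v G \<Longrightarrow> l2 (lebesgue_on S) G"
  by (simp_all add: H01_def sq_int_l2 sq_int_vec_l2)

lemma H01_iff_approx:
  "H01 S v G \<longleftrightarrow> l2 (lebesgue_on S) v \<and> l2 (lebesgue_on S) G \<and>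
     (\<exists>\<phi> g. (\<forall>n. test_fun S (\<phi> n) (g n)) \<and>
       (\<lambda>n. sqnorm (lebesgue_on S) (\<lambda>x. \<phi> n x - v x)) \<longlonglongrightarrow> 0 \<and>
       (\<lambda>n. sqnorm (lebesgue_on S) (\<lambda>x. g n x - G x)) \<longlonglongrightarrow> 0)"
  by (simp add: H01_def sq_int_l2 sq_int_vec_l2 ip_self)

lemma test_fun_add:
  assumes "test_fun S \<phi> g" "test_fun S \<psi> h"
  shows "test_fun S (\<lambda>x. \<phi> x + \<psi> x) (\<lambda>x. g x + h x)"
proof -
  let ?A = "closure {x. \<phi> x \<noteq> 0}" and ?B = "closure {x. \<psi> x \<noteq> 0}" and ?C = "closure {x. \<phi> x + \<psi> x \<noteq> 0}"
  have "{x. \<phi> x + \<psi> x \<noteq> 0} \<subseteq> ?A \<union> ?B"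
    using closure_subset[of "{x. \<phi> x \<noteq> 0}"] closure_subset[of "{x. \<psi> x \<noteq> 0}"] by fastforce
  then have sub: "?C \<subseteq> ?A \<union> ?B" by (rule closure_minimal) auto
  have "compact ?A" "compact ?B" "?A \<subseteq> S" "?B \<subseteq> S" using assms by (auto simp only: test_fun_def)
  then have "compact ?C" "?C \<subseteq> S"
    using sub compact_Int_closed[OF compact_Un[of ?A ?B], of ?C] by (auto simp: Int_absorb1)
  moreover have "\<forall>x. ((\<lambda>x. \<phi> x + \<psi> x) has_derivative (\<lambda>k. (g x + h x) \<bullet> k)) (at x)"
    using assms unfolding test_fun_def inner_add_left by (blast intro: has_derivative_add)
  moreover have "continuous_on UNIV (\<lambda>x. g x + h x)"
    using assms unfolding test_fun_def by (intro continuous_intros) auto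
  ultimately show ?thesis unfolding test_fun_def by blast
qed

lemma test_fun_zero: "test_fun S (\<lambda>x. 0) (\<lambda>x. 0)"
  by (simp add: test_fun_def)

lemma test_fun_gradients_separable:
  assumes S: "S \<in> sets lebesgue"
  obtains D where "countable D" "\<And>g. g \<in> D \<Longrightarrow> \<exists>\<phi>. test_fun S \<phi> g"
    "\<And>\<phi> g e. test_fun S \<phi> g \<Longrightarrow> 0 < e \<Longrightarrow> \<exists>g'\<in>D. sqnorm (lebesgue_on S) (\<lambda>x. g' x - g x) < e"
proof -
  have "\<exists>r. \<forall>x. r < norm x \<longrightarrow> g x = 0" if t: "test_fun S \<phi> g" for \<phi> g
  proof -
    have "bounded (closure {x. \<phi> x \<noteq> 0})"
      using t unfolding test_fun_def by (blast intro: compact_imp_bounded)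
    then obtain r where "\<And>x. x \<in> closure {x. \<phi> x \<noteq> 0} \<Longrightarrow> norm x \<le> r"
      unfolding bounded_iff by blast
    then show ?thesis using test_fun_grad_zero[OF t] by (meson not_less)
  qed
  then have supp: "\<And>g. g \<in> {g. \<exists>\<phi>. test_fun S \<phi> g} \<Longrightarrow> \<exists>r. \<forall>x. r < norm x \<longrightarrow> g x = 0" by blast
  have cont: "\<And>g. g \<in> {g. \<exists>\<phi>. test_fun S \<phi> g} \<Longrightarrow> continuous_on UNIV g" by (auto simp only: test_fun_def)
  obtain D where "countable D" "D \<subseteq> {g. \<exists>\<phi>. test_fun S \<phi> g}"
    "\<And>g e. g \<in> {g. \<exists>\<phi>. test_fun S \<phi> g} \<Longrightarrow> 0 < e \<Longrightarrow> \<exists>g'\<in>D. sqnorm (lebesgue_on S) (\<lambda>x. g' x - g x) < e"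
    by (rule separable_compactly_supported[OF S cont supp], assumption, assumption, rule that)
  then show ?thesis by (intro that[of D]) blast+
qed

lemma ip_norm_triangle_sq:
  assumes "l2 M f" "l2 M g" "l2 M h"
  shows "sqnorm M (\<lambda>x. f x - h x) \<le>
    2 * sqnorm M (\<lambda>x. f x - g x) + 2 * sqnorm M (\<lambda>x. g x - h x)"
proof -
  have "sqnorm M (\<lambda>x. (f x - g x) - (g x - h x)) \<ge> 0" by (rule ip_self_nonneg)
  moreover have "sqnorm M (\<lambda>x. f x - h x) = sqnorm M (\<lambda>x. (f x - g x) + (g x - h x))"
    by simp
  ultimately show ?thesis
    using ip_add_self[OF l2_diff[OF assms(1,2)] l2_diff[OF assms(2,3)]]
      ip_diff_self[OF l2_diff[OF assms(1,2)] l2_diff[OF assms(2,3)]] by linarith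
qed

text \<open>The gap between \<open>sqnorm M w\<close> and 2 <w, g> - \<open>sqnorm M g\<close> is
  the squared distance from g to w, so the squared norm is the supremum of these expressions over a
  dense D. For countable D this writes a superlevel set of the norm as a countable union of sets
  given by pairings with fixed g, without normalising g.\<close>

lemma ip_self_greater_iff:
  assumes T: "\<And>g. g \<in> D \<Longrightarrow> l2 M g" and w: "l2 M w"
    and dense: "\<And>e. 0 < e \<Longrightarrow> \<exists>g\<in>D. sqnorm M (\<lambda>x. g x - w x) < e"
  shows "c < sqnorm M w \<longleftrightarrow> (\<exists>g\<in>D. c < 2 * ip M w g - sqnorm M g)"
proof
  assume c: "c < sqnorm M w"
  obtain g where g: "g \<in> D" "sqnorm M (\<lambda>x. g x - w x) < sqnorm M w - c"
    using dense[of "sqnorm M w - c"] c by auto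
  then show "\<exists>g\<in>D. c < 2 * ip M w g - sqnorm M g"
    using ip_diff_self[OF T[OF g(1)] w] ip_commute[of M w g] by (intro bexI[of _ g]) auto
next
  assume "\<exists>g\<in>D. c < 2 * ip M w g - sqnorm M g"
  then obtain g where g: "g \<in> D" "c < 2 * ip M w g - sqnorm M g" by blast
  then show "c < sqnorm M w"
    using ip_diff_self[OF T[OF g(1)] w] ip_commute[of M w g] ip_self_nonneg[of M "\<lambda>x. g x - w x"] by linarith
qed

text \<open>Integrability in time is known for the squared norm of the gradient; this trades the
  norms coming from Cauchy-Schwarz for squared norms.\<close>

lemma sqrt_le_one_plus: "0 \<le> x \<Longrightarrow> sqrt x \<le> 1 + x"
  by (rule real_le_lsqrt) (simp_all add: power2_eq_square algebra_simps)

context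
  fixes S :: "(real \<times> real) set" and u0 u G
  assumes S: "S \<in> sets lebesgue" and sol: "dirichlet_heat_solution S u0 u G"
begin

lemma solution_l2: "0 \<le> t \<Longrightarrow> l2 (lebesgue_on S) (u t)"
  using sol by (simp add: dirichlet_heat_solution_def sq_int_l2)

lemma solution_H01: "0 < t \<Longrightarrow> H01 S (u t) (G t)"
  using sol by (simp add: dirichlet_heat_solution_def)

lemma gradient_l2: "0 < t \<Longrightarrow> l2 (lebesgue_on S) (G t)"
  using H01_l2(2)[OF solution_H01] .

lemma solution_continuous:
  "0 \<le> t \<Longrightarrow> ((\<lambda>s. sqnorm (lebesgue_on S) (\<lambda>x. u s x - u t x)) \<longlongrightarrow> 0) (at t within {0..})"
  using sol by (simp add: dirichlet_heat_solution_def ip_self)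

lemma solution_weak_derivative:
  assumes "test_fun S \<phi> g" "0 < t"
  shows "((\<lambda>s. ip (lebesgue_on S) (u s) \<phi>) has_real_derivative - ip (lebesgue_on S) (G t) g) (at t)"
  using sol assms unfolding dirichlet_heat_solution_def ip_def inner_real_def by blast

section \<open>Continuity of the solution and measurability of its gradient in time\<close>

lemma ip_solution_continuous:
  fixes X :: "'z::t2_space set"
  assumes a: "continuous_on X a" "\<And>z. z \<in> X \<Longrightarrow> 0 \<le> a z" and b: "continuous_on X b" "\<And>z. z \<in> X \<Longrightarrow> 0 \<le> b z"
  shows "continuous_on X (\<lambda>z. ip (lebesgue_on S) (u (a z)) (u (b z)))"
  unfolding continuous_on_def
proof
  fix z assume z: "z \<in> X"
  have lim: "((\<lambda>y. sqnorm (lebesgue_on S) (\<lambda>x. u (c y) x - u (c z) x)) \<longlongrightarrow> 0) (at z within X)"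
    if c: "continuous_on X c" "\<And>z. z \<in> X \<Longrightarrow> 0 \<le> c z" for c :: "'z \<Rightarrow> real"
  proof -
    let ?h = "\<lambda>s. sqnorm (lebesgue_on S) (\<lambda>x. u s x - u (c z) x)"
    have "?h (c z) = 0" by (simp add: ip_def)
    then have "continuous (at (c z) within {0..}) ?h"
      unfolding continuous_within using solution_continuous[of "c z"] c(2)[OF z] by simp
    then have "continuous (at (c z) within c ` X) ?h"
      by (rule continuous_within_subset) (use c in auto)
    moreover have "continuous (at z within X) c" using c(1) z by (simp add: continuous_on_eq_continuous_within)
    ultimately have "continuous (at z within X) (?h \<circ> c)" by (intro continuous_within_compose)
    then show ?thesis using \<open>?h (c z) = 0\<close> by (simp add: continuous_within o_def)
  qed
  show "((\<lambda>z. ip (lebesgue_on S) (u (a z)) (u (b z))) \<longlongrightarrow> ip (lebesgue_on S) (u (a z)) (u (b z))) (at z within X)"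
    by (rule ip_tendsto[OF _ _ _ _ lim[OF a] lim[OF b]])
      (use z a b in \<open>auto simp: eventually_at_filter intro!: always_eventually solution_l2\<close>)
qed

lemma ip_solution_continuous_left:
  assumes f: "l2 (lebesgue_on S) f"
  shows "continuous_on {0..} (\<lambda>s. ip (lebesgue_on S) (u s) f)"
  unfolding continuous_on_def
proof
  fix t :: real assume t: "t \<in> {0..}"
  show "((\<lambda>s. ip (lebesgue_on S) (u s) f) \<longlongrightarrow> ip (lebesgue_on S) (u t) f) (at t within {0..})"
    by (rule ip_tendsto_left[OF _ _ f solution_continuous])
      (use t in \<open>auto simp: eventually_at_filter intro!: always_eventually solution_l2\<close>)
qed

text \<open>G is constrained for positive times only. The extension by zero is square integrable at
  every time, so measurability can be stated on the whole line.\<close>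

definition "ext_gradient t = (if 0 < t then G t else (\<lambda>x. 0))"

lemma ext_gradient_l2: "l2 (lebesgue_on S) (ext_gradient t)"
  by (simp add: ext_gradient_def gradient_l2) (simp add: l2_def)

lemma ext_gradient_approx:
  assumes "0 < e"
  shows "\<exists>\<phi> g. test_fun S \<phi> g \<and> sqnorm (lebesgue_on S) (\<lambda>x. g x - ext_gradient t x) < e"
proof (cases "0 < t")
  case True
  then obtain \<phi> g where *: "\<And>n. test_fun S (\<phi> n) (g n)"
      "(\<lambda>n. sqnorm (lebesgue_on S) (\<lambda>x. g n x - G t x)) \<longlonglongrightarrow> 0"
    using solution_H01[OF True] unfolding H01_iff_approx by blast
  have "\<forall>\<^sub>F n in sequentially. sqnorm (lebesgue_on S) (\<lambda>x. g n x - G t x) < e"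
    using order_tendstoD(2)[OF *(2) assms] .
  then obtain n where "sqnorm (lebesgue_on S) (\<lambda>x. g n x - G t x) < e"
    by (auto simp: eventually_sequentially)
  then show ?thesis using * True unfolding ext_gradient_def by auto
next
  case False
  then show ?thesis using test_fun_zero assms by (auto simp: ext_gradient_def ip_def intro!: exI)
qed

text \<open>Up to sign the pairing is a time derivative, hence for s > 0 a pointwise limit of
  difference quotients of a continuous function.\<close>

lemma weak_gradient_measurable:
  assumes t: "test_fun S \<phi> g"
  shows "(\<lambda>s. ip (lebesgue_on S) (ext_gradient s) g) \<in> borel_measurable borel"
proof -
  \<comment> \<open>With \<open>max 0 s\<close> the function is continued constantly to negative
    times and is continuous on the line.\<close>
  define U where "U s = ip (lebesgue_on S) (u (max 0 s)) \<phi>" for s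
  have cU: "continuous_on UNIV U"
    unfolding U_def
    by (rule continuous_on_compose2[OF ip_solution_continuous_left[OF test_fun_l2(1)[OF t S]]]) (auto intro!:
      continuous_intros)
  have "(\<lambda>s. if 0 < s then - (real (Suc n) * (U (s + 1 / real (Suc n)) - U s)) else 0) \<in> borel_measurable borel" for n
  proof -
    have "(\<lambda>s. U (s + 1 / real (Suc n))) \<in> borel_measurable borel" "U \<in> borel_measurable borel"
      by (auto intro!: borel_measurable_continuous_onI continuous_on_compose2[OF cU] continuous_intros cU)
    then show ?thesis by measurable
  qed
  then show ?thesis
  proof (rule borel_measurable_LIMSEQ_real[rotated])
    fix s :: real
    show "(\<lambda>n. if 0 < s then - (real (Suc n) * (U (s + 1 / real (Suc n)) - U s)) else 0) \<longlonglongrightarrow> ip (lebesgue_on S)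
      (ext_gradient s) g"
    proof (cases "0 < s")
      case True
      have "((\<lambda>h. (ip (lebesgue_on S) (u (s + h)) \<phi> - ip (lebesgue_on S) (u s) \<phi>) / h) \<longlongrightarrow> - ip (lebesgue_on S) (G s) g)
        (at 0)"
        using solution_weak_derivative[OF t True] by (simp add: DERIV_def)
      moreover have "filterlim (\<lambda>n. 1 / real (Suc n)) (at 0) sequentially"
        unfolding filterlim_at using LIMSEQ_inverse_real_of_nat by (auto simp: inverse_eq_divide)
      ultimately have "(\<lambda>n. (ip (lebesgue_on S) (u (s + 1 / real (Suc n))) \<phi> - ip (lebesgue_on S) (u s) \<phi>) / (1 / real
        (Suc n)))
           \<longlonglongrightarrow> - ip (lebesgue_on S) (G s) g"
        by (rule filterlim_compose)
      from tendsto_minus[OF this] show ?thesis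
        using True by (simp add: U_def ext_gradient_def mult.commute max_def)
    qed (simp add: ext_gradient_def ip_def)
  qed
qed

text \<open>Measurability of t \<mapsto> G t is recovered from the weak equation: norms are suprema
  of countably many measurable pairings. For joint measurability of the kernel, polarisation reduces
  to the norm of G s + G t, to which the same argument applies because sums of test functions are
  test functions.\<close>

lemma gradient_kernel_measurable:
  "(\<lambda>(s, t). ip (lebesgue_on S) (ext_gradient s) (ext_gradient t)) \<in> borel_measurable (borel \<Otimes>\<^sub>M borel)"
  "(\<lambda>s. sqnorm (lebesgue_on S) (ext_gradient s)) \<in> borel_measurable borel"
proof -
  let ?M = "lebesgue_on S"
  obtain D where D: "countable D" "\<And>g. g \<in> D \<Longrightarrow> \<exists>\<phi>. test_fun S \<phi> g"
    "\<And>\<phi> g e. test_fun S \<phi> g \<Longrightarrow> 0 < e \<Longrightarrow> \<exists>g'\<in>D. sqnorm ?M (\<lambda>x. g' x - g x) < e"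
    by (rule test_fun_gradients_separable[OF S], rule that)
  have Dl2: "g \<in> D \<Longrightarrow> l2 ?M g" for g using D(2) test_fun_l2(2)[OF _ S] by blast
  have A: "g \<in> D \<Longrightarrow> (\<lambda>s. ip ?M (ext_gradient s) g) \<in> borel_measurable borel" for g
    using D(2) weak_gradient_measurable by blast
  have dense: "\<exists>g\<in>D. sqnorm ?M (\<lambda>x. g x - w x) < e"
    if e: "0 < e" and w: "l2 ?M w" and ap: "\<And>e. 0 < e \<Longrightarrow> \<exists>\<phi> h. test_fun S \<phi> h \<and> sqnorm ?M (\<lambda>x. h x - w x) < e" for e w
  proof -
    obtain \<phi> h where h: "test_fun S \<phi> h" "sqnorm ?M (\<lambda>x. h x - w x) < e / 4"
      using ap[of "e / 4"] e by auto
    obtain g where g: "g \<in> D" "sqnorm ?M (\<lambda>x. g x - h x) < e / 4"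
      using D(3)[OF h(1), of "e / 4"] e by auto
    show ?thesis using ip_norm_triangle_sq[OF Dl2[OF g(1)] test_fun_l2(2)[OF h(1) S] w] g h(2) by (intro bexI[of _ g]) auto
  qed
  show N: "(\<lambda>s. sqnorm ?M (ext_gradient s)) \<in> borel_measurable borel"
  proof (rule borel_measurableI_greater)
    fix c
    have "{s \<in> space borel. c < sqnorm ?M (ext_gradient s)} = (\<Union>g\<in>D. {s \<in> space borel. c < 2 * ip ?M (ext_gradient s) g
      - sqnorm ?M g})"
      using ip_self_greater_iff[OF Dl2 ext_gradient_l2 dense[OF _ ext_gradient_l2 ext_gradient_approx]] by auto
    also have "\<dots> \<in> sets borel"
    proof (rule sets.countable_UN''[OF D(1)])
      fix g assume "g \<in> D"
      note [measurable] = A[OF this]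
      show "{s \<in> space borel. c < 2 * ip ?M (ext_gradient s) g - sqnorm ?M g} \<in> sets borel" by measurable
    qed
    finally show "{s \<in> space borel. c < sqnorm ?M (ext_gradient s)} \<in> sets borel" .
  qed
  note [measurable] = N
  define w where "w = (\<lambda>(s, t) x. ext_gradient s x + ext_gradient t x)"
  have w_l2: "l2 ?M (w p)" for p by (cases p) (simp add: w_def l2_add ext_gradient_l2)
  have w_ip: "ip ?M (w p) g = ip ?M (ext_gradient (fst p)) g + ip ?M (ext_gradient (snd p)) g" if "l2 ?M g" for p g
    using ip_add_left[OF ext_gradient_l2 ext_gradient_l2 that] by (cases p) (simp add: w_def)
  have w_approx: "\<exists>\<phi> h. test_fun S \<phi> h \<and> sqnorm ?M (\<lambda>x. h x - w p x) < e" if e: "0 < e" for e p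
  proof -
    obtain \<phi> h where h: "test_fun S \<phi> h" "sqnorm ?M (\<lambda>x. h x - ext_gradient (fst p) x) < e / 4"
      using ext_gradient_approx[of "e / 4"] e by fastforce
    obtain \<psi> k where k: "test_fun S \<psi> k" "sqnorm ?M (\<lambda>x. k x - ext_gradient (snd p) x) < e / 4"
      using ext_gradient_approx[of "e / 4"] e by fastforce
    note l = test_fun_l2(2)[OF h(1) S] test_fun_l2(2)[OF k(1) S]
    let ?a = "\<lambda>x. h x - ext_gradient (fst p) x" and ?b = "\<lambda>x. ext_gradient (snd p) x - k x"
    have "sqnorm ?M (\<lambda>x. ?a x - ?b x) \<le> 2 * sqnorm ?M (\<lambda>x. ?a x - 0) + 2 * sqnorm ?M (\<lambda>x. 0 - ?b x)"
      by (rule ip_norm_triangle_sq) (auto intro!: l2_diff l ext_gradient_l2 simp: l2_def[of ?M "\<lambda>x. 0"])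
    moreover have "(\<lambda>x. ?a x - ?b x) = (\<lambda>x. (h x + k x) - w p x)" by (cases p) (simp add: w_def fun_eq_iff)
    moreover have "(\<lambda>x. 0 - ?b x) = (\<lambda>x. k x - ext_gradient (snd p) x)" by simp
    ultimately have "sqnorm ?M (\<lambda>x. (h x + k x) - w p x) < e" using h(2) k(2) by simp
    then show ?thesis using test_fun_add[OF h(1) k(1)] by blast
  qed
  have W: "(\<lambda>p. sqnorm ?M (w p)) \<in> borel_measurable (borel \<Otimes>\<^sub>M borel)"
  proof (rule borel_measurableI_greater)
    fix c
    let ?B = "borel \<Otimes>\<^sub>M borel :: (real \<times> real) measure"
    have "{p \<in> space ?B. c < sqnorm ?M (w p)} = (\<Union>g\<in>D. {p \<in> space ?B. c < 2 * (ip ?M (ext_gradient (fst p)) g + ip ?M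
      (ext_gradient (snd p)) g) - sqnorm ?M g})"
      using ip_self_greater_iff[OF Dl2 w_l2 dense[OF _ w_l2 w_approx]] w_ip[OF Dl2] by auto
    also have "\<dots> \<in> sets ?B"
    proof (rule sets.countable_UN''[OF D(1)])
      fix g assume "g \<in> D"
      note [measurable] = A[OF this]
      show "{p \<in> space ?B. c < 2 * (ip ?M (ext_gradient (fst p)) g + ip ?M (ext_gradient (snd p)) g) - sqnorm ?M g} \<in>
        sets ?B" by measurable
    qed
    finally show "{p \<in> space ?B. c < sqnorm ?M (w p)} \<in> sets ?B" .
  qed
  have "(\<lambda>(s, t). ip ?M (ext_gradient s) (ext_gradient t)) = (\<lambda>p. (sqnorm ?M (w p) - sqnorm ?M (ext_gradient (fst p)) -
    sqnorm ?M (ext_gradient (snd p))) / 2)"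
    using ip_add_self[OF ext_gradient_l2 ext_gradient_l2] by (auto simp: w_def fun_eq_iff)
  also have "\<dots> \<in> borel_measurable (borel \<Otimes>\<^sub>M borel)" using W by measurable
  finally show "(\<lambda>(s, t). ip ?M (ext_gradient s) (ext_gradient t)) \<in> borel_measurable (borel \<Otimes>\<^sub>M borel)" .
qed


lemma gradient_kernel_bound:
  "\<bar>ip (lebesgue_on S) (ext_gradient s) (ext_gradient t)\<bar> \<le> (1 + sqnorm (lebesgue_on S) (ext_gradient s)) * (1 + sqnorm
    (lebesgue_on S) (ext_gradient t))"
  using Cauchy_Schwarz_ip[OF ext_gradient_l2[of s] ext_gradient_l2[of t]]
    mult_mono[OF sqrt_le_one_plus sqrt_le_one_plus, of "sqnorm (lebesgue_on S) (ext_gradient s)" "sqnorm (lebesgue_on S)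
      (ext_gradient t)"]
    ip_self_nonneg[of "lebesgue_on S" "ext_gradient s"] ip_self_nonneg[of "lebesgue_on S" "ext_gradient t"]
  by simp

lemma gradient_energy_integrable:
  assumes "0 < a"
  shows "set_integrable lborel {a..b} (\<lambda>s. 1 + sqnorm (lebesgue_on S) (ext_gradient s))"
proof -
  let ?N = "\<lambda>s. sqnorm (lebesgue_on S) (ext_gradient s)"
  have "set_integrable lborel {a..b} ?N"
    unfolding set_integrable_def
  proof (rule integrableI_nonneg)
    show "(\<lambda>x. indicat_real {a..b} x *\<^sub>R ?N x) \<in> borel_measurable lborel"
      using gradient_kernel_measurable(2) by simp
    show "AE x in lborel. 0 \<le> indicat_real {a..b} x *\<^sub>R ?N x" by (simp add: ip_self_nonneg)
    have "(\<integral>\<^sup>+ x. ennreal (indicat_real {a..b} x *\<^sub>R ?N x) \<partial>lborel)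
       = (\<integral>\<^sup>+ t\<in>{a..b}. ennreal (\<integral>x. (norm (G t x))\<^sup>2 \<partial>lebesgue_on S) \<partial>lborel)"
      by (intro nn_integral_cong) (use assms in \<open>auto simp: indicator_def ext_gradient_def ip_self\<close>)
    also have "\<dots> < \<infinity>" using sol assms unfolding dirichlet_heat_solution_def by blast
    finally show "(\<integral>\<^sup>+ x. ennreal (indicat_real {a..b} x *\<^sub>R ?N x) \<partial>lborel) < \<infinity>" .
  qed
  moreover have "set_integrable lborel {a..b} (\<lambda>s. 1::real)"
    unfolding set_integrable_def by (rule borel_integrable_compact) auto
  ultimately show ?thesis by (rule set_integral_add(1)[rotated])
qed

section \<open>Increments in time and dependence on the sum of times\<close>

lemma weak_gradient_bound:
  assumes "l2 (lebesgue_on S) g"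
  shows "\<bar>ip (lebesgue_on S) (ext_gradient s) g\<bar> \<le> (1 + sqnorm (lebesgue_on S) (ext_gradient s)) * sqrt (sqnorm
    (lebesgue_on S) g)"
proof -
  have "\<bar>ip (lebesgue_on S) (ext_gradient s) g\<bar> \<le> sqrt (sqnorm (lebesgue_on S) (ext_gradient s)) * sqrt (sqnorm
    (lebesgue_on S) g)"
    by (rule Cauchy_Schwarz_ip[OF ext_gradient_l2 assms])
  also have "\<dots> \<le> (1 + sqnorm (lebesgue_on S) (ext_gradient s)) * sqrt (sqnorm (lebesgue_on S) g)"
    by (intro mult_right_mono sqrt_le_one_plus ip_self_nonneg real_sqrt_ge_zero)
  finally show ?thesis .
qed

text \<open>The time derivative exists everywhere but is not known to be continuous. The gauge
  integral recovers the increment, and the energy bound shows that this integral is also a Lebesgue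
  integral.\<close>

lemma weak_increment_test:
  assumes t: "test_fun S \<phi> g" and s: "0 < s1" "s1 \<le> s2"
  shows "ip (lebesgue_on S) (u s2) \<phi> - ip (lebesgue_on S) (u s1) \<phi> = - (LBINT s:{s1..s2}. ip (lebesgue_on S)
    (ext_gradient s) g)"
proof -
  let ?A = "\<lambda>s. ip (lebesgue_on S) (ext_gradient s) g"
  note gl2 = test_fun_l2(2)[OF t S]
  have si: "set_integrable lborel {s1..s2} ?A"
    unfolding set_integrable_def
  proof (rule Bochner_Integration.integrable_bound)
    show "integrable lborel (\<lambda>x. sqrt (sqnorm (lebesgue_on S) g) * (indicat_real {s1..s2} x *\<^sub>R (1 + sqnorm (lebesgue_on
      S) (ext_gradient x))))"
      using gradient_energy_integrable[OF s(1), of s2] unfolding set_integrable_def by (rule integrable_mult_right)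
    show "(\<lambda>x. indicat_real {s1..s2} x *\<^sub>R ?A x) \<in> borel_measurable lborel"
      using weak_gradient_measurable[OF t] by simp
    show "AE x in lborel. norm (indicat_real {s1..s2} x *\<^sub>R ?A x) \<le>
        norm (sqrt (sqnorm (lebesgue_on S) g) * (indicat_real {s1..s2} x *\<^sub>R (1 + sqnorm (lebesgue_on S) (ext_gradient x))))"
    proof (rule AE_I2)
      fix x
      show "norm (indicat_real {s1..s2} x *\<^sub>R ?A x) \<le>
        norm (sqrt (sqnorm (lebesgue_on S) g) * (indicat_real {s1..s2} x *\<^sub>R (1 + sqnorm (lebesgue_on S) (ext_gradient x))))"
        using weak_gradient_bound[OF gl2, of x] ip_self_nonneg[of "lebesgue_on S" "ext_gradient x"] ip_self_nonneg[of
          "lebesgue_on S" g]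
        by (simp add: indicator_def abs_mult mult.commute)
    qed
  qed
  have "((\<lambda>s. - ?A s) has_integral (ip (lebesgue_on S) (u s2) \<phi> - ip (lebesgue_on S) (u s1) \<phi>)) {s1..s2}"
  proof (rule fundamental_theorem_of_calculus[OF s(2)])
    fix x assume "x \<in> {s1..s2}"
    then have "0 < x" using s by simp
    from solution_weak_derivative[OF t this]
    show "((\<lambda>s. ip (lebesgue_on S) (u s) \<phi>) has_vector_derivative - ?A x) (at x within {s1..s2})"
      using \<open>0 < x\<close> by (auto simp: ext_gradient_def has_real_derivative_iff_has_vector_derivative intro:
        has_vector_derivative_at_within)
  qed
  then have "integral {s1..s2} (\<lambda>s. - ?A s) = ip (lebesgue_on S) (u s2) \<phi> - ip (lebesgue_on S) (u s1) \<phi>"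
    by (rule integral_unique)
  then show ?thesis using set_borel_integral_eq_integral(2)[OF si] by simp
qed

text \<open>Test functions approximating u t in \<open>H01\<close> replace it: their gradients have
  bounded norms K, so the time integrals converge by dominated convergence against the gradient
  energy.\<close>

lemma weak_increment:
  assumes t: "0 < t" and s: "0 < s1" "s1 \<le> s2"
  shows "ip (lebesgue_on S) (u s2) (u t) - ip (lebesgue_on S) (u s1) (u t) = - (LBINT s:{s1..s2}. ip (lebesgue_on S)
    (ext_gradient s) (ext_gradient t))"
proof -
  let ?M = "lebesgue_on S"
  obtain \<phi> g where T: "\<And>n. test_fun S (\<phi> n) (g n)"
    and c\<phi>: "(\<lambda>n. sqnorm ?M (\<lambda>x. \<phi> n x - u t x)) \<longlonglongrightarrow> 0"
    and cg: "(\<lambda>n. sqnorm ?M (\<lambda>x. g n x - ext_gradient t x)) \<longlonglongrightarrow> 0"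
    using solution_H01[OF t] t unfolding H01_iff_approx ext_gradient_def by auto
  note l = test_fun_l2[OF T S]
  have l\<phi>: "\<forall>\<^sub>F n in sequentially. l2 ?M (\<phi> n)" and lg: "\<forall>\<^sub>F n in sequentially. l2 ?M (g n)"
    using l by auto
  have c\<phi>': "(\<lambda>n. ip ?M f (\<phi> n)) \<longlonglongrightarrow> ip ?M f (u t)" if "l2 ?M f" for f
    using ip_tendsto_left[OF l\<phi> solution_l2 that c\<phi>] t by (simp add: ip_commute[of _ f])
  have cg': "(\<lambda>n. ip ?M f (g n)) \<longlonglongrightarrow> ip ?M f (ext_gradient t)" if "l2 ?M f" for f
    using ip_tendsto_left[OF lg ext_gradient_l2 that cg] by (simp add: ip_commute[of _ f])
  have "(\<lambda>n. sqrt (sqnorm ?M (g n))) \<longlonglongrightarrow> sqrt (sqnorm ?M (ext_gradient t))"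
    by (intro tendsto_real_sqrt ip_tendsto[OF lg ext_gradient_l2 lg ext_gradient_l2 cg cg])
  then have "Bseq (\<lambda>n. sqrt (sqnorm ?M (g n)))" by (rule convergent_imp_Bseq[OF convergentI])
  then obtain K where K: "\<And>n. norm (sqrt (sqnorm ?M (g n))) \<le> K" by (rule BseqE) blast
  have "(\<lambda>n. LBINT s:{s1..s2}. ip ?M (ext_gradient s) (g n)) \<longlonglongrightarrow> (LBINT s:{s1..s2}. ip ?M (ext_gradient s) (ext_gradient t))"
    unfolding set_lebesgue_integral_def
  proof (rule integral_dominated_convergence)
    show "integrable lborel (\<lambda>x. K * (indicat_real {s1..s2} x *\<^sub>R (1 + sqnorm ?M (ext_gradient x))))"
      using gradient_energy_integrable[OF s(1), of s2] unfolding set_integrable_def by (rule integrable_mult_right)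
    show "(\<lambda>x. indicat_real {s1..s2} x *\<^sub>R ip ?M (ext_gradient x) (g n)) \<in> borel_measurable lborel" for n
      using weak_gradient_measurable[OF T[of n]] by simp
    show "(\<lambda>x. indicat_real {s1..s2} x *\<^sub>R ip ?M (ext_gradient x) (ext_gradient t)) \<in> borel_measurable lborel"
    proof -
      have "(\<lambda>x. ip ?M (ext_gradient x) (ext_gradient t)) \<in> borel_measurable borel"
        using measurable_compose[OF measurable_Pair2'[of t borel borel] gradient_kernel_measurable(1)]
        by simp
      then show ?thesis by simp
    qed
    show "AE x in lborel. (\<lambda>n. indicat_real {s1..s2} x *\<^sub>R ip ?M (ext_gradient x) (g n)) \<longlonglongrightarrow> indicat_real {s1..s2} x *\<^sub>R
      ip ?M (ext_gradient x) (ext_gradient t)"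
      by (intro AE_I2 tendsto_scaleR tendsto_const cg' ext_gradient_l2)
    show "AE x in lborel. norm (indicat_real {s1..s2} x *\<^sub>R ip ?M (ext_gradient x) (g n)) \<le> K * (indicat_real {s1..s2} x
      *\<^sub>R (1 + sqnorm ?M (ext_gradient x)))" for n
    proof (rule AE_I2)
      fix x
      have "\<bar>ip ?M (ext_gradient x) (g n)\<bar> \<le> (1 + sqnorm ?M (ext_gradient x)) * sqrt (sqnorm ?M (g n))"
        by (rule weak_gradient_bound[OF l(2)])
      also have "\<dots> \<le> (1 + sqnorm ?M (ext_gradient x)) * K"
        using K[of n] ip_self_nonneg[of ?M "ext_gradient x"] by (intro mult_left_mono) auto
      finally show "norm (indicat_real {s1..s2} x *\<^sub>R ip ?M (ext_gradient x) (g n)) \<le> K * (indicat_real {s1..s2} x *\<^sub>R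
        (1 + sqnorm ?M (ext_gradient x)))"
        by (simp add: indicator_def mult.commute)
    qed
  qed
  then have "(\<lambda>n. - (LBINT s:{s1..s2}. ip ?M (ext_gradient s) (g n))) \<longlonglongrightarrow> - (LBINT s:{s1..s2}. ip ?M (ext_gradient s)
    (ext_gradient t))"
    by (rule tendsto_minus)
  moreover have "(\<lambda>n. - (LBINT s:{s1..s2}. ip ?M (ext_gradient s) (g n))) \<longlonglongrightarrow> ip ?M (u s2) (u t) - ip ?M (u s1) (u t)"
    unfolding weak_increment_test[OF T s, symmetric] using s by (intro tendsto_diff c\<phi>' solution_l2) auto
  ultimately show ?thesis by (metis LIMSEQ_unique)
qed

text \<open>Self-adjointness enters as the symmetry of the kernel <G s, G t>, for which
  \<open>two_parameter_function_of_sum\<close> was made.\<close>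

lemma ip_solution_function_of_sum:
  assumes "0 < s" "0 < t"
  shows "ip (lebesgue_on S) (u s) (u t) = sqnorm (lebesgue_on S) (u ((s + t) / 2))"
proof -
  define g where "g s t = ip (lebesgue_on S) (u s) (u t)" for s t
  define k where "k s t = ip (lebesgue_on S) (ext_gradient s) (ext_gradient t)" for s t
  have main: "g (s + c) t = g s (t + c)" if "0 < s" "0 < t" "0 \<le> c" for s t c
  proof (rule two_parameter_function_of_sum[of g k "\<lambda>s. 1 + k s s", OF _ _ _ _ _ _ _ _ _ that])
    show "continuous_on {0<..} (g s)" if "0 < s" for s
      unfolding g_def[abs_def] by (rule ip_solution_continuous) (use that in \<open>auto intro!: continuous_intros\<close>)
    show "continuous_on {0<..<c} (\<lambda>x. g x (c - x))" for c
      unfolding g_def[abs_def] by (rule ip_solution_continuous) (auto intro!: continuous_intros)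
    show "g s t = g t s" "k s t = k t s" for s t by (simp_all add: g_def k_def ip_commute)
    show "(\<lambda>(s, t). k s t) \<in> borel_measurable (lborel \<Otimes>\<^sub>M lborel)"
      using gradient_kernel_measurable(1) by (simp add: k_def cong: measurable_cong_sets sets_pair_measure_cong)
    show "\<bar>k s t\<bar> \<le> (1 + k s s) * (1 + k t t)" for s t
      unfolding k_def by (rule gradient_kernel_bound)
    show "0 \<le> 1 + k s s" for s using ip_self_nonneg[of "lebesgue_on S" "ext_gradient s"] by (simp add: k_def)
    show "set_integrable lborel {a..b} (\<lambda>s. 1 + k s s)" if "0 < a" for a b
      unfolding k_def by (rule gradient_energy_integrable[OF that])
    show "g s2 t - g s1 t = - (LBINT s:{s1..s2}. k s t)" if "0 < s1" "s1 \<le> s2" "0 < t" for s1 s2 t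
      unfolding g_def k_def by (rule weak_increment[OF that(3,1,2)])
  qed
  \<comment> \<open>Moving (t - s)/2 from the later time to the earlier one puts both at the
    midpoint.\<close>
  have le: "g s t = g ((s + t) / 2) ((s + t) / 2)" if "0 < s" "s \<le> t" for s t
    using main[of s "(s + t) / 2" "(t - s) / 2"] that by (simp add: field_simps)
  show ?thesis
  proof (cases "s \<le> t")
    case True then show ?thesis using le[OF assms(1) True] by (simp add: g_def)
  next
    case False then show ?thesis using le[of t s] assms by (simp add: g_def ip_commute[of _ "u s"] add.commute)
  qed
qed

text \<open>The definition of a solution gives no time derivative in L2. The bound is extracted from
  the scalar function f alone, on which all inner products of values of u depend.\<close>

lemma solution_locally_Lipschitz:
  assumes t: "0 < t"
  obtains C where "0 \<le> C" "\<And>h. \<bar>h\<bar> \<le> t / 16 \<Longrightarrow>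
    sqnorm (lebesgue_on S) (\<lambda>x. u (t + h) x - u t x) \<le> C * h\<^sup>2"
proof -
  let ?M = "lebesgue_on S"
  define f where "f x = sqnorm ?M (u (x / 2))" for x
  have f: "ip ?M (u s) (u t) = f (s + t)" if "0 < s" "0 < t" for s t
    using ip_solution_function_of_sum[OF that] by (simp add: f_def)
  have D2: "sqnorm ?M (\<lambda>x. u (s + h) x - u s x) = f (2 * s + 2 * h) - 2 * f (2 * s + h) + f (2 * s)"
    if "0 < s" "0 < s + h" for s h
    using ip_diff_self[OF solution_l2 solution_l2, of "s + h" s] that by (simp add: f algebra_simps)
  have d2: "0 \<le> f (x + 2 * h) - 2 * f (x + h) + f x" if "0 < x" "0 < h" for x h
    using D2[of "x / 2" h] that ip_self_nonneg[of ?M "\<lambda>y. u (x / 2 + h) y - u (x / 2) y"] by (simp add: algebra_simps)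
  \<comment> \<open>The fourth difference is the squared norm of u(s + 2h) - 2 u(s + h) + u(s), here
    v - w.\<close>
  have d4: "0 \<le> f (x + 4 * h) - 4 * f (x + 3 * h) + 6 * f (x + 2 * h) - 4 * f (x + h) + f x" if "0 < x" "0 < h" for x h
  proof -
    define s where "s = x / 2"
    have s: "0 < s" "x = 2 * s" using that by (simp_all add: s_def)
    have l: "l2 ?M (u s)" "l2 ?M (u (s + h))" "l2 ?M (u (s + 2 * h))"
      using s that by (auto intro!: solution_l2)
    define v where "v y = u (s + 2 * h) y + u s y" for y
    define w where "w y = 2 *\<^sub>R u (s + h) y" for y
    have vl: "l2 ?M v" and wl: "l2 ?M w" unfolding v_def[abs_def] w_def[abs_def] by (intro l2_add l2_scaleR l)+
    have "sqnorm ?M v = f (2 * s + 4 * h) + 2 * f (2 * s + 2 * h) + f (2 * s)"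
      unfolding v_def[abs_def] ip_add_self[OF l(3,1)] using s that by (simp add: f algebra_simps)
    moreover have "ip ?M v w = 2 * (f (2 * s + 3 * h) + f (2 * s + h))"
    proof -
      have "ip ?M v w = 2 * ip ?M v (u (s + h))" unfolding w_def[abs_def] by (rule ip_scaleR_right)
      also have "ip ?M v (u (s + h)) = ip ?M (u (s + 2 * h)) (u (s + h)) + ip ?M (u s) (u (s + h))"
        unfolding v_def[abs_def] by (rule ip_add_left[OF l(3,1,2)])
      finally show ?thesis using s that by (simp add: f algebra_simps)
    qed
    moreover have "sqnorm ?M w = 4 * f (2 * s + 2 * h)"
      unfolding w_def[abs_def] ip_scaleR_right ip_scaleR_left using s that by (simp add: f algebra_simps)
    ultimately show ?thesis
      using ip_diff_self[OF vl wl] ip_self_nonneg[of ?M "\<lambda>y. v y - w y"] s(2) by (simp add: algebra_simps)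
  qed
  have "continuous_on {0<..} f"
    unfolding f_def[abs_def] by (rule ip_solution_continuous) (auto intro!: continuous_intros)
  then have "continuous_on {t / 2..12 * t} f" by (rule continuous_on_subset) (use t in auto)
  then have "bounded (f ` {t / 2..12 * t})" by (intro compact_imp_bounded compact_continuous_image) auto
  then obtain B where B: "\<And>x. t / 2 \<le> x \<Longrightarrow> x \<le> 12 * t \<Longrightarrow> \<bar>f x\<bar> \<le> B"
    unfolding bounded_iff by fastforce
  have B0: "0 \<le> B" using B[of t] t abs_ge_zero[of "f t"] by linarith
  \<comment> \<open>The argument of f is a sum of two times, so times near t correspond to arguments
    near 2t. These lie between \<alpha> = t and \<beta> = 4t, and f has to be bounded on
    [t/2, 12t].\<close>
  have bd: "f (x + 2 * h) - 2 * f (x + h) + f x \<le> 256 * B / t\<^sup>2 * h\<^sup>2" if "t \<le> x" "x \<le> 4 * t" "0 < h" "h \<le> t / 16" for x h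
    by (rule second_difference_bound[OF d2 d4 t _ that(1,2,3,4)]) (use B in auto)
  show ?thesis
  proof (rule that[of "256 * B / t\<^sup>2"])
    fix h :: real assume h: "\<bar>h\<bar> \<le> t / 16"
    consider "h = 0" | "0 < h" | "h < 0" by linarith
    then show "sqnorm ?M (\<lambda>x. u (t + h) x - u t x) \<le> 256 * B / t\<^sup>2 * h\<^sup>2"
    proof cases
      case 1 then show ?thesis by (simp add: ip_def)
    next
      case 2 then show ?thesis using D2[of t h] bd[of "2 * t" h] t h by simp
    next
      \<comment> \<open>For negative h the same three values of f are read from the left end 2(t +
        h) with step -h.\<close>
      case 3 then show ?thesis using D2[of t h] bd[of "2 * (t + h)" "- h"] t h by (simp add: algebra_simps)
    qed
  qed (use B0 in simp)
qed

end

subsection \<open>Weighted energies\<close>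

lemma ip_scaleR_bounded:
  assumes f: "l2 M f" and w: "w \<in> borel_measurable M" and C: "\<And>x. \<bar>w x\<bar> \<le> C"
  shows "sqnorm M (\<lambda>x. w x *\<^sub>R f x) \<le> C\<^sup>2 * sqnorm M f"
proof -
  have "(\<integral>x. (norm (w x *\<^sub>R f x))\<^sup>2 \<partial>M) \<le> (\<integral>x. C\<^sup>2 * (norm (f x))\<^sup>2 \<partial>M)"
  proof (rule integral_mono)
    show "integrable M (\<lambda>x. (norm (w x *\<^sub>R f x))\<^sup>2)"
      using l2_scaleR_bounded[OF f w C] by (simp only: l2_def)
    show "integrable M (\<lambda>x. C\<^sup>2 * (norm (f x))\<^sup>2)" using f by (simp add: l2_def)
    fix x
    have "\<bar>w x\<bar>\<^sup>2 \<le> C\<^sup>2" by (rule power_mono[OF C]) simp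
    then show "(norm (w x *\<^sub>R f x))\<^sup>2 \<le> C\<^sup>2 * (norm (f x))\<^sup>2"
      by (simp add: power_mult_distrib mult_right_mono)
  qed
  then show ?thesis by (simp add: ip_self)
qed

lemma ip_scaleR_vector_bounded:
  fixes f :: "'a \<Rightarrow> real" and V :: "'a \<Rightarrow> 'b::euclidean_space"
  assumes f: "l2 M f" and V: "V \<in> borel_measurable M" and C: "\<And>x. norm (V x) \<le> C"
  shows "sqnorm M (\<lambda>x. f x *\<^sub>R V x) \<le> C\<^sup>2 * sqnorm M f"
  using ip_scaleR_bounded[OF f, of "\<lambda>x. norm (V x)" C] V C
  by (simp add: ip_self power_mult_distrib mult.commute)

lemma ip_scaleR_tendsto_zero:
  assumes fn: "\<forall>\<^sub>F n in F. l2 M (fn n)" and f: "l2 M f"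
    and w: "w \<in> borel_measurable M" and C: "\<And>x. \<bar>w x\<bar> \<le> C"
    and c: "((\<lambda>n. sqnorm M (\<lambda>x. fn n x - f x)) \<longlongrightarrow> 0) F"
  shows "((\<lambda>n. sqnorm M (\<lambda>x. w x *\<^sub>R fn n x - w x *\<^sub>R f x)) \<longlongrightarrow> 0) F"
proof (rule tendsto_sandwich[of "\<lambda>_. 0"])
  show "((\<lambda>n. C\<^sup>2 * sqnorm M (\<lambda>x. fn n x - f x)) \<longlongrightarrow> 0) F"
    using tendsto_mult_right_zero[OF c] .
  show "\<forall>\<^sub>F n in F. sqnorm M (\<lambda>x. w x *\<^sub>R fn n x - w x *\<^sub>R f x) \<le> C\<^sup>2 * sqnorm M (\<lambda>x. fn n x - f x)"
    using fn
  proof eventually_elim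
    case (elim n)
    show ?case using ip_scaleR_bounded[OF l2_diff[OF elim f] w C] by (simp add: scaleR_diff_right)
  qed
qed (simp_all add: ip_self_nonneg)

lemma ip_scaleR_vector_tendsto_zero:
  fixes f :: "'a \<Rightarrow> real" and V :: "'a \<Rightarrow> 'b::euclidean_space"
  assumes fn: "\<forall>\<^sub>F n in F. l2 M (fn n)" and f: "l2 M f"
    and V: "V \<in> borel_measurable M" and C: "\<And>x. norm (V x) \<le> C"
    and c: "((\<lambda>n. sqnorm M (\<lambda>x. fn n x - f x)) \<longlongrightarrow> 0) F"
  shows "((\<lambda>n. sqnorm M (\<lambda>x. fn n x *\<^sub>R V x - f x *\<^sub>R V x)) \<longlongrightarrow> 0) F"
proof (rule tendsto_sandwich[of "\<lambda>_. 0"])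
  show "((\<lambda>n. C\<^sup>2 * sqnorm M (\<lambda>x. fn n x - f x)) \<longlongrightarrow> 0) F"
    using tendsto_mult_right_zero[OF c] .
  show "\<forall>\<^sub>F n in F. sqnorm M (\<lambda>x. fn n x *\<^sub>R V x - f x *\<^sub>R V x) \<le> C\<^sup>2 * sqnorm M (\<lambda>x. fn n x - f x)"
    using fn
  proof eventually_elim
    case (elim n)
    show ?case using ip_scaleR_vector_bounded[OF l2_diff[OF elim f] V C] by (simp add: scaleR_diff_left)
  qed
qed (simp_all add: ip_self_nonneg)

lemma continuous_measurable_lebesgue_on:
  "continuous_on UNIV f \<Longrightarrow> f \<in> borel_measurable (lebesgue_on S)"
  by (intro measurable_restrict_space1 measurable_completion) (simp add: borel_measurable_continuous_onI)

lemma test_fun_mult: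
  assumes t: "test_fun S \<phi> g" and d: "\<And>x. (w has_derivative (\<lambda>h. dw x \<bullet> h)) (at x)" and c: "continuous_on UNIV dw"
  shows "test_fun S (\<lambda>x. w x * \<phi> x) (\<lambda>x. w x *\<^sub>R g x + \<phi> x *\<^sub>R dw x)"
proof -
  let ?A = "closure {x. \<phi> x \<noteq> 0}" and ?C = "closure {x. w x * \<phi> x \<noteq> 0}"
  have sub: "?C \<subseteq> ?A" by (rule closure_mono) auto
  have "compact ?A" "?A \<subseteq> S" using t by (auto simp only: test_fun_def)
  then have "compact ?C" "?C \<subseteq> S"
    using sub compact_Int_closed[of ?A ?C] by (auto simp: Int_absorb1)
  moreover have "((\<lambda>x. w x * \<phi> x) has_derivative (\<lambda>k. (w x *\<^sub>R g x + \<phi> x *\<^sub>R dw x) \<bullet> k)) (at x)" for x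
  proof -
    have "(\<phi> has_derivative (\<lambda>h. g x \<bullet> h)) (at x)" using t unfolding test_fun_def by blast
    from has_derivative_mult[OF d this] show ?thesis
      by (simp add: inner_add_left mult.commute)
  qed
  moreover have "continuous_on UNIV (\<lambda>x. w x *\<^sub>R g x + \<phi> x *\<^sub>R dw x)"
  proof -
    have "continuous_on UNIV w"
      using d by (meson continuous_at_imp_continuous_on has_derivative_continuous)
    moreover have "continuous_on UNIV g" using t unfolding test_fun_def by blast
    ultimately show ?thesis using test_fun_continuous[OF t] c by (intro continuous_intros)
  qed
  ultimately show ?thesis unfolding test_fun_def by blast
qed

lemma H01_mult:
  assumes S: "S \<in> sets lebesgue" and H: "H01 S v G"
    and d: "\<And>x. (w has_derivative (\<lambda>h. dw x \<bullet> h)) (at x)" and c: "continuous_on UNIV dw"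
    and wb: "\<And>x. \<bar>w x\<bar> \<le> C" and dwb: "\<And>x. norm (dw x) \<le> C"
  shows "H01 S (\<lambda>x. w x * v x) (\<lambda>x. w x *\<^sub>R G x + v x *\<^sub>R dw x)"
proof -
  let ?M = "lebesgue_on S"
  have cw: "continuous_on UNIV w"
    using d by (meson continuous_at_imp_continuous_on has_derivative_continuous)
  note wm = continuous_measurable_lebesgue_on[OF cw, of S] and dwm = continuous_measurable_lebesgue_on[OF c, of S]
  note vl = H01_l2[OF H]
  obtain \<phi> g where T: "\<And>n. test_fun S (\<phi> n) (g n)"
    and c\<phi>: "(\<lambda>n. sqnorm ?M (\<lambda>x. \<phi> n x - v x)) \<longlonglongrightarrow> 0"
    and cg: "(\<lambda>n. sqnorm ?M (\<lambda>x. g n x - G x)) \<longlonglongrightarrow> 0"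
    using H unfolding H01_iff_approx by auto
  note l = test_fun_l2[OF T S]
  have l\<phi>: "\<forall>\<^sub>F n in sequentially. l2 ?M (\<phi> n)" and lg: "\<forall>\<^sub>F n in sequentially. l2 ?M (g n)" using l by auto
  have 1: "l2 ?M (\<lambda>x. w x * v x)" using l2_scaleR_bounded[OF vl(1) wm wb] by simp
  have 2: "l2 ?M (\<lambda>x. w x *\<^sub>R G x + v x *\<^sub>R dw x)"
    by (intro l2_add l2_scaleR_bounded[OF vl(2) wm wb] l2_scaleR_bounded'[OF vl(1) dwm dwb])
  have 3: "(\<lambda>n. sqnorm ?M (\<lambda>x. w x * \<phi> n x - w x * v x)) \<longlonglongrightarrow> 0"
    using ip_scaleR_tendsto_zero[OF l\<phi> vl(1) wm wb c\<phi>] by simp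
  let ?a = "\<lambda>n x. w x *\<^sub>R g n x - w x *\<^sub>R G x" and ?b = "\<lambda>n x. v x *\<^sub>R dw x - \<phi> n x *\<^sub>R dw x"
  have b: "(\<lambda>n. sqnorm ?M (?b n)) \<longlonglongrightarrow> 0"
  proof -
    have "sqnorm ?M (?b n) = sqnorm ?M (\<lambda>x. \<phi> n x *\<^sub>R dw x - v x *\<^sub>R dw x)" for n
      unfolding ip_self by (subst norm_minus_commute) (rule refl)
    then show ?thesis using ip_scaleR_vector_tendsto_zero[OF l\<phi> vl(1) dwm dwb c\<phi>] by simp
  qed
  have 4: "(\<lambda>n. sqnorm ?M (\<lambda>x. (w x *\<^sub>R g n x + \<phi> n x *\<^sub>R dw x) - (w x *\<^sub>R G x + v x *\<^sub>R dw x))) \<longlonglongrightarrow> 0"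
  proof (rule tendsto_sandwich[of "\<lambda>_. 0"])
    show "(\<lambda>n. 2 * sqnorm ?M (?a n) + 2 * sqnorm ?M (?b n)) \<longlonglongrightarrow> 0"
      using tendsto_add[OF tendsto_mult_right_zero[OF ip_scaleR_tendsto_zero[OF lg vl(2) wm wb cg], of 2]
        tendsto_mult_right_zero[OF b, of 2]] by simp
    show "\<forall>\<^sub>F n in sequentially. sqnorm ?M (\<lambda>x. (w x *\<^sub>R g n x + \<phi> n x *\<^sub>R dw x) - (w x *\<^sub>R G x + v x *\<^sub>R dw x)) \<le> 2 *
      sqnorm ?M (?a n) + 2 * sqnorm ?M (?b n)"
    proof (rule always_eventually, rule allI)
      fix n
      have la: "l2 ?M (?a n)" "l2 ?M (?b n)"
        by (intro l2_diff l2_scaleR_bounded[OF l(2) wm wb] l2_scaleR_bounded[OF vl(2) wm wb]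
            l2_scaleR_bounded'[OF l(1) dwm dwb] l2_scaleR_bounded'[OF vl(1) dwm dwb])+
      have "sqnorm ?M (\<lambda>x. ?a n x - ?b n x) \<le> 2 * sqnorm ?M (?a n) + 2 * sqnorm ?M (?b n)"
        using ip_diff_self[OF la] ip_add_self[OF la] ip_self_nonneg[of ?M "\<lambda>x. ?a n x + ?b n x"] by linarith
      then show "sqnorm ?M (\<lambda>x. (w x *\<^sub>R g n x + \<phi> n x *\<^sub>R dw x) - (w x *\<^sub>R G x + v x *\<^sub>R dw x)) \<le> 2 * sqnorm ?M (?a n)
        + 2 * sqnorm ?M (?b n)"
        by (simp add: algebra_simps)
    qed
  qed (simp_all add: ip_self_nonneg)
  show ?thesis unfolding H01_iff_approx
    by (intro conjI 1 2 exI[of _ "\<lambda>n x. w x * \<phi> n x"] exI[of _ "\<lambda>n x. w x *\<^sub>R g n x + \<phi> n x *\<^sub>R dw x"]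
        allI test_fun_mult[OF T d c] 3 4)
qed

text \<open>The Lipschitz bound keeps the difference quotients of u bounded in L2 uniformly in h.
  Hence replacing \<psi> by a nearby test function costs little for all small h at once, and the
  weak equation passes to the closure.\<close>

lemma weak_derivative_H01:
  assumes S: "S \<in> sets lebesgue" and sol: "dirichlet_heat_solution S u0 u G"
    and t: "0 < t" and H: "H01 S \<psi> \<Psi>"
  shows "((\<lambda>h. ip (lebesgue_on S) (\<lambda>x. u (t + h) x - u t x) \<psi> / h) \<longlongrightarrow> - ip (lebesgue_on S) (G t) \<Psi>) (at 0)"
proof -
  let ?M = "lebesgue_on S"
  obtain C where C: "0 \<le> C" "\<And>h. \<bar>h\<bar> \<le> t / 16 \<Longrightarrow> sqnorm ?M (\<lambda>x. u (t + h) x - u t x) \<le> C * h\<^sup>2"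
    by (rule solution_locally_Lipschitz[OF S sol t], rule that)
  obtain \<phi> g where T: "\<And>n. test_fun S (\<phi> n) (g n)"
    and c\<phi>: "(\<lambda>n. sqnorm ?M (\<lambda>x. \<phi> n x - \<psi> x)) \<longlonglongrightarrow> 0"
    and cg: "(\<lambda>n. sqnorm ?M (\<lambda>x. g n x - \<Psi> x)) \<longlonglongrightarrow> 0"
    using H unfolding H01_iff_approx by auto
  note l = test_fun_l2[OF T S]
  note Hl = H01_l2[OF H]
  have lg: "\<forall>\<^sub>F n in sequentially. l2 ?M (g n)" using l by auto
  have c1: "(\<lambda>n. sqrt C * sqrt (sqnorm ?M (\<lambda>x. \<phi> n x - \<psi> x))) \<longlonglongrightarrow> 0"
    using tendsto_mult_right_zero[OF tendsto_real_sqrt[OF c\<phi>, simplified]] .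
  have c2: "(\<lambda>n. ip ?M (G t) (g n)) \<longlonglongrightarrow> ip ?M (G t) \<Psi>"
    using ip_tendsto_left[OF lg Hl(2) gradient_l2[OF S sol t] cg] by (simp add: ip_commute[of _ "G t"])
  show ?thesis
  proof (rule tendstoI)
    fix e :: real assume e: "0 < e"
    have "\<forall>\<^sub>F n in sequentially. sqrt C * sqrt (sqnorm ?M (\<lambda>x. \<phi> n x - \<psi> x)) < e / 3
        \<and> \<bar>ip ?M (G t) (g n) - ip ?M (G t) \<Psi>\<bar> < e / 3"
      using order_tendstoD(2)[OF c1, of "e / 3"] tendstoD[OF c2, of "e / 3"] e
      by (auto simp: dist_real_def elim: eventually_elim2)
    then obtain n where n: "sqrt C * sqrt (sqnorm ?M (\<lambda>x. \<phi> n x - \<psi> x)) < e / 3"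
        "\<bar>ip ?M (G t) (g n) - ip ?M (G t) \<Psi>\<bar> < e / 3" by (auto simp: eventually_sequentially)
    have "((\<lambda>h. (ip ?M (u (t + h)) (\<phi> n) - ip ?M (u t) (\<phi> n)) / h) \<longlongrightarrow> - ip ?M (G t) (g n)) (at 0)"
      using solution_weak_derivative[OF S sol T t] by (simp add: DERIV_def)
    from tendstoD[OF this, of "e / 3"] have "\<forall>\<^sub>F h in at 0. \<bar>(ip ?M (u (t + h)) (\<phi> n) - ip ?M (u t) (\<phi> n)) / h - - ip ?M
      (G t) (g n)\<bar> < e / 3"
      using e by (simp add: dist_real_def)
    moreover have "\<forall>\<^sub>F h in at (0::real). \<bar>h\<bar> \<le> t / 16 \<and> h \<noteq> 0"
      unfolding eventually_at by (rule exI[of _ "t / 16"]) (use t in auto)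
    ultimately show "\<forall>\<^sub>F h in at 0. dist (ip ?M (\<lambda>x. u (t + h) x - u t x) \<psi> / h) (- ip ?M (G t) \<Psi>) < e"
    proof eventually_elim
      case (elim h)
      let ?q = "\<lambda>x. u (t + h) x - u t x"
      have ul: "l2 ?M (u (t + h))" "l2 ?M (u t)" using elim t by (auto intro!: solution_l2[OF S sol])
      have ql: "l2 ?M ?q" by (rule l2_diff[OF ul])
      have "\<bar>ip ?M ?q (\<lambda>x. \<phi> n x - \<psi> x)\<bar> \<le> sqrt (sqnorm ?M ?q) * sqrt (sqnorm ?M (\<lambda>x. \<phi> n x - \<psi> x))"
        by (rule Cauchy_Schwarz_ip[OF ql l2_diff[OF l(1) Hl(1)]])
      also have "\<dots> \<le> sqrt (C * h\<^sup>2) * sqrt (sqnorm ?M (\<lambda>x. \<phi> n x - \<psi> x))"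
        using C(2)[of h] elim by (intro mult_right_mono real_sqrt_le_mono) (auto simp: ip_self_nonneg)
      also have "\<dots> = \<bar>h\<bar> * (sqrt C * sqrt (sqnorm ?M (\<lambda>x. \<phi> n x - \<psi> x)))"
        by (simp add: real_sqrt_mult)
      also have "\<dots> < \<bar>h\<bar> * (e / 3)" using n(1) elim by (intro mult_strict_left_mono) auto
      finally have "\<bar>ip ?M ?q (\<lambda>x. \<phi> n x - \<psi> x) / h\<bar> < e / 3" using elim by (simp add: abs_divide field_simps)
      moreover have "ip ?M ?q (\<lambda>x. \<phi> n x - \<psi> x) / h = (ip ?M (u (t + h)) (\<phi> n) - ip ?M (u t) (\<phi> n)) / h - ip ?M ?q \<psi> / h"
        using ip_diff_right[OF l(1) Hl(1) ql] ip_diff_left[OF ul l(1)] by (simp add: diff_divide_distrib)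
      ultimately show ?case using elim(1) n(2) unfolding dist_real_def by linarith
    qed
  qed
qed


text \<open>\<open>weight_test\<close> is the formal inequality \<open>d/dt \<integral> w u\<^sup>2 \<le> 0\<close>, required of test functions only; the
  boundedness of \<open>w\<close>, \<open>wt\<close> and \<open>dw\<close> carries it over to \<open>H01\<close>.\<close>
lemma weighted_energy_nonincreasing:
  fixes w wt :: "real \<Rightarrow> real \<times> real \<Rightarrow> real" and dw :: "real \<Rightarrow> real \<times> real \<Rightarrow> real \<times> real"
  assumes S: "S \<in> sets lebesgue" and sol: "dirichlet_heat_solution S u0 u G"
    and ab: "0 \<le> a" "a \<le> b"
    and wd: "\<And>t x. t \<in> {a..b} \<Longrightarrow> (w t has_derivative (\<lambda>h. dw t x \<bullet> h)) (at x)"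
    and dwc: "\<And>t. t \<in> {a..b} \<Longrightarrow> continuous_on UNIV (dw t)"
    and wtd: "\<And>t x. t \<in> {a..b} \<Longrightarrow> ((\<lambda>s. w s x) has_real_derivative wt t x) (at t within {a..b})"
    and wtc: "\<And>t. t \<in> {a..b} \<Longrightarrow> continuous_on UNIV (wt t)"
    and wb: "\<And>t x. t \<in> {a..b} \<Longrightarrow> \<bar>w t x\<bar> \<le> C"
    and dwb: "\<And>t x. t \<in> {a..b} \<Longrightarrow> norm (dw t x) \<le> C"
    and wtb: "\<And>t x. t \<in> {a..b} \<Longrightarrow> \<bar>wt t x\<bar> \<le> C"
    and weight_test: "\<And>t \<phi> g. t \<in> {a..b} \<Longrightarrow> test_fun S \<phi> g \<Longrightarrow>
       ip (lebesgue_on S) (\<lambda>x. wt t x * \<phi> x) \<phi> \<le>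
       2 * ip (lebesgue_on S) (\<lambda>x. w t x *\<^sub>R g x + \<phi> x *\<^sub>R dw t x) g"
  shows "ip (lebesgue_on S) (\<lambda>x. w b x * u b x) (u b) \<le> ip (lebesgue_on S) (\<lambda>x. w a x * u a x) (u a)"
proof -
  let ?M = "lebesgue_on S"
  define F where "F t = ip ?M (\<lambda>x. w t x * u t x) (u t)" for t
  have wc: "continuous_on UNIV (w t)" if "t \<in> {a..b}" for t
    using wd[OF that] by (meson continuous_at_imp_continuous_on has_derivative_continuous)
  note wm = continuous_measurable_lebesgue_on[OF wc, of _ S]
    and dwm = continuous_measurable_lebesgue_on[OF dwc, of _ S]
    and wtm = continuous_measurable_lebesgue_on[OF wtc, of _ S]
  have ul: "l2 ?M (u t)" if "t \<in> {a..b}" for t using that ab by (auto intro!: solution_l2[OF S sol])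
  have wLip: "\<bar>w s x - w t x\<bar> \<le> C * \<bar>s - t\<bar>" if "s \<in> {a..b}" "t \<in> {a..b}" for s t x
    using field_differentiable_bound[of "{a..b}" "\<lambda>s. w s x" "\<lambda>t. wt t x" C s t] wtd wtb that by (auto simp:
      convex_real_interval)
  have wu: "l2 ?M (\<lambda>x. w t x * u s x)" if "t \<in> {a..b}" "s \<in> {a..b}" for s t
    using l2_scaleR_bounded[OF ul[OF that(2)] wm[OF that(1)] wb[OF that(1)]] by simp
  have ucont: "((\<lambda>s. sqnorm ?M (\<lambda>x. u s x - u t x)) \<longlongrightarrow> 0) (at t within {a..b})" if "t \<in> {a..b}" for t
    using tendsto_within_subset[OF solution_continuous[OF S sol, of t], of "{a..b}"] that ab by auto
  have ev: "\<forall>\<^sub>F s in at t within {a..b}. s \<in> {a..b}" for t by (simp add: eventually_at_filter)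
  \<comment> \<open>Derivatives are taken only inside the interval. Continuity up to the ends covers
    a = 0, where the initial value need not have a gradient.\<close>
  have contF: "continuous_on {a..b} F"
    unfolding continuous_on_def F_def
  proof
    fix t assume t: "t \<in> {a..b}"
    show "((\<lambda>t. ip ?M (\<lambda>x. w t x * u t x) (u t)) \<longlongrightarrow> ip ?M (\<lambda>x. w t x * u t x) (u t)) (at t within {a..b})"
    proof (rule ip_tendsto[OF _ wu[OF t t] _ ul[OF t] _ ucont[OF t]])
      show "\<forall>\<^sub>F s in at t within {a..b}. l2 ?M (\<lambda>x. w s x * u s x)" by (rule eventually_mono[OF ev wu])
      show "\<forall>\<^sub>F s in at t within {a..b}. l2 ?M (u s)" by (rule eventually_mono[OF ev ul])
      show "((\<lambda>s. sqnorm ?M (\<lambda>x. w s x * u s x - w t x * u t x)) \<longlongrightarrow> 0) (at t within {a..b})"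
      proof (rule tendsto_sandwich[of "\<lambda>_. 0"])
        show "((\<lambda>s. 2 * (C\<^sup>2 * sqnorm ?M (\<lambda>x. u s x - u t x)) + 2 * ((C * \<bar>s - t\<bar>)\<^sup>2 * sqnorm ?M (u t))) \<longlongrightarrow> 0) (at t
          within {a..b})"
        proof -
          have "((\<lambda>s. 2 * (C\<^sup>2 * sqnorm ?M (\<lambda>x. u s x - u t x)) + 2 * ((C * \<bar>s - t\<bar>)\<^sup>2 * sqnorm ?M (u t))) \<longlongrightarrow>
            2 * (C\<^sup>2 * 0) + 2 * ((C * \<bar>t - t\<bar>)\<^sup>2 * sqnorm ?M (u t))) (at t within {a..b})"
            by (intro tendsto_intros ucont[OF t])
          then show ?thesis by simp
        qed
        show "\<forall>\<^sub>F s in at t within {a..b}. sqnorm ?M (\<lambda>x. w s x * u s x - w t x * u t x)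
          \<le> 2 * (C\<^sup>2 * sqnorm ?M (\<lambda>x. u s x - u t x)) + 2 * ((C * \<bar>s - t\<bar>)\<^sup>2 * sqnorm ?M (u t))"
          using ev
        proof eventually_elim
          case (elim s)
          have "sqnorm ?M (\<lambda>x. w s x * u s x - w s x * u t x) \<le> C\<^sup>2 * sqnorm ?M (\<lambda>x. u s x - u t x)"
            using ip_scaleR_bounded[OF l2_diff[OF ul[OF elim] ul[OF t]] wm[OF elim] wb[OF elim]] by (simp add: algebra_simps)
          moreover have "sqnorm ?M (\<lambda>x. w s x * u t x - w t x * u t x) \<le> (C * \<bar>s - t\<bar>)\<^sup>2 * sqnorm ?M (u t)"
            using ip_scaleR_bounded[OF ul[OF t], of "\<lambda>x. w s x - w t x", OF _ wLip[OF elim t]] wm[OF elim] wm[OF t] by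
              (simp add: algebra_simps)
          ultimately show ?case using ip_norm_triangle_sq[OF wu[OF elim elim] wu[OF elim t] wu[OF t t]] by linarith
        qed
      qed (simp_all add: ip_self_nonneg)
    qed
  qed
  have derivF: "\<exists>y. (F has_real_derivative y) (at t) \<and> y \<le> 0" if t': "a < t" "t < b" for t
  proof -
    have t: "t \<in> {a..b}" and tpos: "0 < t" using t' ab by auto
    let ?H = "\<lambda>x. w t x *\<^sub>R G t x + u t x *\<^sub>R dw t x"
    have H: "H01 S (\<lambda>x. w t x * u t x) ?H"
      by (rule H01_mult[OF S solution_H01[OF S sol tpos] wd[OF t] dwc[OF t] wb[OF t] dwb[OF t]])
    have Gl: "l2 ?M (G t)" by (rule gradient_l2[OF S sol tpos])
    have Hl: "l2 ?M ?H" using H01_l2(2)[OF H] .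
    have evh: "\<forall>\<^sub>F h in at 0. t + h \<in> {a..b} \<and> h \<noteq> 0"
      unfolding eventually_at by (rule exI[of _ "min (t - a) (b - t)"]) (use t' in \<open>auto simp: dist_real_def\<close>)
    have "filterlim (\<lambda>h. t + h) (at t within {a..b}) (at 0)"
      unfolding filterlim_at using evh
      by (auto elim!: eventually_mono intro!: tendsto_eq_intros)
    note u0lim = filterlim_compose[OF ucont[OF t] this]
    let ?q = "\<lambda>h x. u (t + h) x - u t x"
    \<comment> \<open>With q = u(t + h) - u(t), the increment of F is 2 <q, w u> + <w q, q> plus the
      increment of w tested with u(t + h). Divided by h these are the terms A, B and D; B is O(h) by
      the Lipschitz bound.\<close>
    have A: "((\<lambda>h. 2 * (ip ?M (?q h) (\<lambda>x. w t x * u t x) / h)) \<longlongrightarrow> 2 * (- ip ?M (G t) ?H)) (at 0)"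
      by (intro tendsto_intros weak_derivative_H01[OF S sol tpos H])
    have B: "((\<lambda>h. ip ?M (\<lambda>x. w t x * ?q h x) (?q h) / h) \<longlongrightarrow> 0) (at 0)"
    proof -
      obtain K where K: "0 \<le> K" "\<And>h. \<bar>h\<bar> \<le> t / 16 \<Longrightarrow> sqnorm ?M (?q h) \<le> K * h\<^sup>2"
        by (rule solution_locally_Lipschitz[OF S sol tpos], rule that)
      have C0: "0 \<le> C" using wb[OF t, of 0] by linarith
      have lim: "((\<lambda>h. C * K * \<bar>h\<bar>) \<longlongrightarrow> 0) (at 0)" by (rule tendsto_eq_intros | simp)+
      have small: "\<forall>\<^sub>F h in at (0::real). \<bar>h\<bar> \<le> t / 16"
        unfolding eventually_at by (rule exI[of _ "t / 16"]) (use tpos in auto)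
      show ?thesis
      proof (rule Lim_null_comparison[OF _ lim])
        show "\<forall>\<^sub>F h in at 0. norm (ip ?M (\<lambda>x. w t x * ?q h x) (?q h) / h) \<le> C * K * \<bar>h\<bar>"
          using evh small
        proof eventually_elim
          case (elim h)
          then have th: "t + h \<in> {a..b}" and h: "h \<noteq> 0" by auto
          have ql: "l2 ?M (?q h)" by (rule l2_diff[OF ul[OF th] ul[OF t]])
          have "\<bar>ip ?M (\<lambda>x. w t x *\<^sub>R ?q h x) (?q h)\<bar> \<le> sqrt (sqnorm ?M (\<lambda>x. w t x *\<^sub>R ?q h x)) * sqrt (sqnorm ?M (?q h))"
            by (rule Cauchy_Schwarz_ip[OF l2_scaleR_bounded[OF ql wm[OF t] wb[OF t]] ql])
          also have "\<dots> \<le> sqrt (C\<^sup>2 * sqnorm ?M (?q h)) * sqrt (sqnorm ?M (?q h))"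
            by (intro mult_right_mono real_sqrt_le_mono ip_scaleR_bounded[OF ql wm[OF t] wb[OF t]]) (simp add:
              ip_self_nonneg)
          also have "\<dots> = C * sqnorm ?M (?q h)"
            using C0 ip_self_nonneg[of ?M "?q h"] by (simp add: real_sqrt_mult)
          also have "\<dots> \<le> C * (K * h\<^sup>2)" using K(2)[of h] elim C0 by (intro mult_left_mono) auto
          finally have "\<bar>ip ?M (\<lambda>x. w t x * ?q h x) (?q h)\<bar> \<le> C * K * \<bar>h\<bar> * \<bar>h\<bar>" by (simp add: power2_eq_square
            abs_mult_self_eq mult.assoc)
          then show ?case using h by (simp add: abs_divide pos_divide_le_eq)
        qed
      qed
    qed
    have D: "((\<lambda>h. ip ?M (\<lambda>x. (w (t + h) x - w t x) / h * u (t + h) x) (u (t + h))) \<longlongrightarrow> ip ?M (\<lambda>x. wt t x * u t x) (u t))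
      (at 0)"
    proof -
      let ?r = "\<lambda>h x. (w (t + h) x - w t x) / h"
      have rb: "\<bar>?r h x\<bar> \<le> C" if "t + h \<in> {a..b}" "h \<noteq> 0" for h x
        using wLip[OF that(1) t, of x] that(2) by (simp add: abs_divide pos_divide_le_eq)
      have rm: "?r h \<in> borel_measurable ?M" if "t + h \<in> {a..b}" for h using wm[OF that] wm[OF t] by simp
      have rl: "l2 ?M (\<lambda>x. ?r h x * f x)" if "t + h \<in> {a..b}" "h \<noteq> 0" "l2 ?M f" for h and f :: "real \<times> real \<Rightarrow> real"
        using l2_scaleR_bounded[OF that(3) rm[OF that(1)] rb[OF that(1,2)]] by simp
      have wtl: "l2 ?M (\<lambda>x. wt t x * u t x)" using l2_scaleR_bounded[OF ul[OF t] wtm[OF t] wtb[OF t]] by simp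
      have rlim: "((\<lambda>h. ?r h x) \<longlongrightarrow> wt t x) (at 0)" for x
        using wtd[OF t, of x] at_within_Icc_at[OF t'] by (simp add: DERIV_def)
      have conv: "((\<lambda>h. sqnorm ?M (\<lambda>x. ?r h x * u (t + h) x - wt t x * u t x)) \<longlongrightarrow> 0) (at 0)"
      proof (rule tendsto_sandwich[of "\<lambda>_. 0"])
        \<comment> \<open>Dominated convergence is applied along sequences of increments. The shift
          by N makes every increment admissible, so that the quotients of w are bounded by C for all
          indices.\<close>
        have d: "((\<lambda>h. sqnorm ?M (\<lambda>x. ?r h x * u t x - wt t x * u t x)) \<longlongrightarrow> 0) (at 0)"
          unfolding tendsto_at_iff_sequentially comp_def
        proof (intro allI impI)
          fix H :: "nat \<Rightarrow> real" assume H: "\<forall>i. H i \<in> UNIV - {0}" "H \<longlonglongrightarrow> 0"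
          have Hat: "filterlim H (at 0) sequentially" using H by (auto simp: filterlim_at)
          then have "\<forall>\<^sub>F i in sequentially. t + H i \<in> {a..b} \<and> H i \<noteq> 0"
            by (rule eventually_compose_filterlim[OF evh])
          then obtain N where N: "\<And>i. i \<ge> N \<Longrightarrow> t + H i \<in> {a..b} \<and> H i \<noteq> 0" by (auto simp: eventually_sequentially)
          have "(\<lambda>i. \<integral>x. (?r (H (i + N)) x * u t x - wt t x * u t x)\<^sup>2 \<partial>?M) \<longlonglongrightarrow> (\<integral>x. 0 \<partial>?M)"
          proof (rule integral_dominated_convergence)
            show "integrable ?M (\<lambda>x. (2 * C)\<^sup>2 * (u t x)\<^sup>2)" using ul[OF t] by (simp add: l2_def)
            show "(\<lambda>x. (?r (H (i + N)) x * u t x - wt t x * u t x)\<^sup>2) \<in> borel_measurable ?M" for i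
              using N[of "i + N"]
              by (intro borel_measurable_power borel_measurable_diff borel_measurable_times rm wtm[OF t]
                l2_measurable[OF ul[OF t]]) simp
            show "AE x in ?M. (\<lambda>i. (?r (H (i + N)) x * u t x - wt t x * u t x)\<^sup>2) \<longlonglongrightarrow> 0"
            proof (rule AE_I2)
              fix x
              have "(\<lambda>i. ?r (H (i + N)) x) \<longlonglongrightarrow> wt t x"
                by (rule LIMSEQ_ignore_initial_segment[OF filterlim_compose[OF rlim Hat]])
              then have "(\<lambda>i. (?r (H (i + N)) x * u t x - wt t x * u t x)\<^sup>2) \<longlonglongrightarrow> (wt t x * u t x - wt t x * u t x)\<^sup>2"
                by (intro tendsto_intros)
              then show "(\<lambda>i. (?r (H (i + N)) x * u t x - wt t x * u t x)\<^sup>2) \<longlonglongrightarrow> 0" by simp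
            qed
            show "AE x in ?M. norm ((?r (H (i + N)) x * u t x - wt t x * u t x)\<^sup>2) \<le> (2 * C)\<^sup>2 * (u t x)\<^sup>2" for i
            proof (rule AE_I2)
              fix x
              have Ni: "t + H (i + N) \<in> {a..b}" "H (i + N) \<noteq> 0" using N[of "i + N"] by auto
              have "\<bar>?r (H (i + N)) x - wt t x\<bar> \<le> 2 * C"
                using rb[OF Ni, of x] wtb[OF t, of x] by linarith
              then have "\<bar>?r (H (i + N)) x - wt t x\<bar>\<^sup>2 \<le> (2 * C)\<^sup>2" by (intro power_mono) auto
              then have "(?r (H (i + N)) x - wt t x)\<^sup>2 * (u t x)\<^sup>2 \<le> (2 * C)\<^sup>2 * (u t x)\<^sup>2" by (simp add: mult_right_mono)
              then show "norm ((?r (H (i + N)) x * u t x - wt t x * u t x)\<^sup>2) \<le> (2 * C)\<^sup>2 * (u t x)\<^sup>2"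
                by (simp only: left_diff_distrib[symmetric] power_mult_distrib real_norm_def abs_mult abs_power2)
            qed
          qed simp
          then have "(\<lambda>i. sqnorm ?M (\<lambda>x. ?r (H (i + N)) x * u t x - wt t x * u t x)) \<longlonglongrightarrow> 0"
            by (simp add: ip_self)
          then show "(\<lambda>i. sqnorm ?M (\<lambda>x. ?r (H i) x * u t x - wt t x * u t x)) \<longlonglongrightarrow> 0"
            by (rule LIMSEQ_offset)
        qed
        have "((\<lambda>h. 2 * (C\<^sup>2 * sqnorm ?M (?q h)) + 2 * sqnorm ?M (\<lambda>x. ?r h x * u t x - wt t x * u t x)) \<longlongrightarrow> 2 * (C\<^sup>2 * 0)
          + 2 * 0) (at 0)"
          by (intro tendsto_intros u0lim d)
        then show "((\<lambda>h. 2 * (C\<^sup>2 * sqnorm ?M (?q h)) + 2 * sqnorm ?M (\<lambda>x. ?r h x * u t x - wt t x * u t x)) \<longlongrightarrow> 0) (at 0)"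
          by simp
        show "\<forall>\<^sub>F h in at 0. sqnorm ?M (\<lambda>x. ?r h x * u (t + h) x - wt t x * u t x)
           \<le> 2 * (C\<^sup>2 * sqnorm ?M (?q h)) + 2 * sqnorm ?M (\<lambda>x. ?r h x * u t x - wt t x * u t x)"
          using evh
        proof eventually_elim
          case (elim h)
          then have th: "t + h \<in> {a..b}" and h: "h \<noteq> 0" by auto
          have "sqnorm ?M (\<lambda>x. ?r h x *\<^sub>R ?q h x) \<le> C\<^sup>2 * sqnorm ?M (?q h)"
            by (rule ip_scaleR_bounded[OF l2_diff[OF ul[OF th] ul[OF t]] rm[OF th] rb[OF th h]])
          moreover have "(\<lambda>x. ?r h x *\<^sub>R ?q h x) = (\<lambda>x. ?r h x * u (t + h) x - ?r h x * u t x)" by (simp add: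
            right_diff_distrib)
          ultimately show ?case
            using ip_norm_triangle_sq[OF rl[OF th h ul[OF th]] rl[OF th h ul[OF t]] wtl] by simp
        qed
      qed (simp_all add: ip_self_nonneg)
      show ?thesis
      proof (rule ip_tendsto[OF _ wtl _ ul[OF t] conv u0lim])
        show "\<forall>\<^sub>F h in at 0. l2 ?M (\<lambda>x. ?r h x * u (t + h) x)" using evh by eventually_elim (use rl ul in blast)
        show "\<forall>\<^sub>F h in at 0. l2 ?M (u (t + h))" using evh by eventually_elim (use ul in blast)
      qed
    qed
    have "((\<lambda>h. (F (t + h) - F t) / h) \<longlongrightarrow> 2 * (- ip ?M (G t) ?H) + 0 + ip ?M (\<lambda>x. wt t x * u t x) (u t)) (at 0)"
    proof (rule Lim_transform_eventually[OF tendsto_add[OF tendsto_add[OF A B] D]])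
      show "\<forall>\<^sub>F h in at 0. 2 * (ip ?M (?q h) (\<lambda>x. w t x * u t x) / h) + ip ?M (\<lambda>x. w t x * ?q h x) (?q h) / h
         + ip ?M (\<lambda>x. (w (t + h) x - w t x) / h * u (t + h) x) (u (t + h)) = (F (t + h) - F t) / h"
        using evh
      proof eventually_elim
        case (elim h)
        then have th: "t + h \<in> {a..b}" and h: "h \<noteq> 0" by auto
        note il = l2_integrable_inner[OF wu[OF th th] ul[OF th]] l2_integrable_inner[OF wu[OF t t] ul[OF t]]
           l2_integrable_inner[OF wu[OF t th] ul[OF th]] l2_integrable_inner[OF wu[OF t t] ul[OF th]]
        have e1: "ip ?M (?q h) (\<lambda>x. w t x * u t x) = ip ?M (\<lambda>x. w t x * u t x) (u (t + h)) - F t"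
          using ip_diff_left[OF ul[OF th] ul[OF t] wu[OF t t]] by (simp add: F_def ip_commute[of _ _ "\<lambda>x. w t x * u t x"])
        have wq: "l2 ?M (\<lambda>x. w t x * ?q h x)"
          using l2_diff[OF wu[OF t th] wu[OF t t]] by (simp add: right_diff_distrib)
        have sym: "ip ?M (\<lambda>x. w t x * u (t + h) x) (u t) = ip ?M (\<lambda>x. w t x * u t x) (u (t + h))"
          by (simp add: ip_def mult_ac)
        have e2: "ip ?M (\<lambda>x. w t x * ?q h x) (?q h) = ip ?M (\<lambda>x. w t x * u (t + h) x) (u (t + h)) - 2 * ip ?M (\<lambda>x. w t x
          * u t x) (u (t + h)) + F t"
          unfolding ip_diff_right[OF ul[OF th] ul[OF t] wq]
          using ip_diff_left[OF wu[OF t th] wu[OF t t] ul[OF th]] ip_diff_left[OF wu[OF t th] wu[OF t t] ul[OF t]] sym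
          by (simp add: F_def right_diff_distrib)
        have "ip ?M (\<lambda>x. (w (t + h) x - w t x) / h * u (t + h) x) (u (t + h)) = ip ?M (\<lambda>x. w (t + h) x * u (t + h) x - w
          t x * u (t + h) x) (u (t + h)) / h"
        proof -
          have "(\<lambda>x. ((w (t + h) x - w t x) / h * u (t + h) x) \<bullet> u (t + h) x) =
              (\<lambda>x. ((w (t + h) x * u (t + h) x - w t x * u (t + h) x) \<bullet> u (t + h) x) / h)"
            by (simp add: left_diff_distrib diff_divide_distrib)
          then show ?thesis unfolding ip_def by (simp only: integral_divide_zero)
        qed
        also have "\<dots> = (F (t + h) - ip ?M (\<lambda>x. w t x * u (t + h) x) (u (t + h))) / h"
          using ip_diff_left[OF wu[OF th th] wu[OF t th] ul[OF th]] by (simp add: F_def)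
        finally have e3: "ip ?M (\<lambda>x. (w (t + h) x - w t x) / h * u (t + h) x) (u (t + h)) =
            (F (t + h) - ip ?M (\<lambda>x. w t x * u (t + h) x) (u (t + h))) / h" .
        show ?case unfolding e1 e2 e3
          by (simp add: diff_divide_distrib add_divide_distrib right_diff_distrib)
      qed
    qed
    then have "(F has_real_derivative 2 * (- ip ?M (G t) ?H) + ip ?M (\<lambda>x. wt t x * u t x) (u t)) (at t)"
      by (simp add: DERIV_def)
    moreover have "ip ?M (\<lambda>x. wt t x * u t x) (u t) \<le> 2 * ip ?M ?H (G t)"
    proof -
      obtain \<phi> g where T: "\<And>n. test_fun S (\<phi> n) (g n)"
        and c\<phi>: "(\<lambda>n. sqnorm ?M (\<lambda>x. \<phi> n x - u t x)) \<longlonglongrightarrow> 0"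
        and cg: "(\<lambda>n. sqnorm ?M (\<lambda>x. g n x - G t x)) \<longlonglongrightarrow> 0"
        using solution_H01[OF S sol tpos] unfolding H01_iff_approx by auto
      note l = test_fun_l2[OF T S]
      have l\<phi>: "\<forall>\<^sub>F n in sequentially. l2 ?M (\<phi> n)" and lg: "\<forall>\<^sub>F n in sequentially. l2 ?M (g n)" using l by auto
      have "(\<lambda>n. ip ?M (\<lambda>x. wt t x *\<^sub>R \<phi> n x) (\<phi> n)) \<longlonglongrightarrow> ip ?M (\<lambda>x. wt t x *\<^sub>R u t x) (u t)"
        by (rule ip_tendsto[OF _ _ l\<phi> ul[OF t] ip_scaleR_tendsto_zero[OF l\<phi> ul[OF t] wtm[OF t] wtb[OF t] c\<phi>] c\<phi>])
          (auto intro!: always_eventually l2_scaleR_bounded[OF l(1) wtm[OF t] wtb[OF t]] l2_scaleR_bounded[OF ul[OF t]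
            wtm[OF t] wtb[OF t]] simp del: real_scaleR_def)
      then have L: "(\<lambda>n. ip ?M (\<lambda>x. wt t x * \<phi> n x) (\<phi> n)) \<longlonglongrightarrow> ip ?M (\<lambda>x. wt t x * u t x) (u t)" by simp
      have R1: "(\<lambda>n. ip ?M (\<lambda>x. w t x *\<^sub>R g n x) (g n)) \<longlonglongrightarrow> ip ?M (\<lambda>x. w t x *\<^sub>R G t x) (G t)"
        by (rule ip_tendsto[OF _ _ lg Gl ip_scaleR_tendsto_zero[OF lg Gl wm[OF t] wb[OF t] cg] cg])
          (auto intro!: always_eventually l2_scaleR_bounded[OF l(2) wm[OF t] wb[OF t]] l2_scaleR_bounded[OF Gl wm[OF t]
            wb[OF t]])
      have R2: "(\<lambda>n. ip ?M (\<lambda>x. \<phi> n x *\<^sub>R dw t x) (g n)) \<longlonglongrightarrow> ip ?M (\<lambda>x. u t x *\<^sub>R dw t x) (G t)"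
        by (rule ip_tendsto[OF _ _ lg Gl ip_scaleR_vector_tendsto_zero[OF l\<phi> ul[OF t] dwm[OF t] dwb[OF t] c\<phi>] cg])
          (auto intro!: always_eventually l2_scaleR_bounded'[OF l(1) dwm[OF t] dwb[OF t]] l2_scaleR_bounded'[OF ul[OF t]
            dwm[OF t] dwb[OF t]])
      have split: "ip ?M (\<lambda>x. w t x *\<^sub>R g x + f x *\<^sub>R dw t x) g = ip ?M (\<lambda>x. w t x *\<^sub>R g x) g + ip ?M (\<lambda>x. f x *\<^sub>R dw t x) g"
        if "l2 ?M f" "l2 ?M g" for f g
        by (rule ip_add_left[OF l2_scaleR_bounded[OF that(2) wm[OF t] wb[OF t]] l2_scaleR_bounded'[OF that(1) dwm[OF t]
          dwb[OF t]] that(2)])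
      have R: "(\<lambda>n. 2 * ip ?M (\<lambda>x. w t x *\<^sub>R g n x + \<phi> n x *\<^sub>R dw t x) (g n)) \<longlonglongrightarrow> 2 * ip ?M ?H (G t)"
        unfolding split[OF l] split[OF ul[OF t] Gl] by (intro tendsto_intros R1 R2)
      show ?thesis by (rule LIMSEQ_le[OF L R]) (use weight_test[OF t T] in auto)
    qed
    ultimately show ?thesis by (auto simp: ip_commute[of _ "G t"])
  qed
  show ?thesis
    using DERIV_nonpos_imp_decreasing_open[OF ab(2) derivF contF] by (simp add: F_def)
qed

subsection \<open>Integration by parts against a vector field\<close>

text \<open>The fundamental theorem of calculus on each horizontal segment with both ends outside
  the support, followed by Fubini.\<close>

lemma integral_partial_fst_zero:
  fixes f f1 :: "real \<times> real \<Rightarrow> real"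
  assumes d: "\<And>x y. ((\<lambda>x. f (x, y)) has_real_derivative f1 (x, y)) (at x)" and c: "continuous_on UNIV f1"
    and f0: "\<And>p. r < norm p \<Longrightarrow> f p = 0" and f10: "\<And>p. r < norm p \<Longrightarrow> f1 p = 0"
  shows "integrable lborel f1" "(\<integral>p. f1 p \<partial>lborel) = 0"
proof -
  have "integrable lborel (\<lambda>p. indicator (cball 0 r) p *\<^sub>R f1 p)"
    by (rule borel_integrable_compact) (auto intro: continuous_on_subset[OF c])
  moreover have "(\<lambda>p. indicator (cball 0 r) p *\<^sub>R f1 p) = f1"
    using f10 by (auto simp: indicator_def fun_eq_iff)
  ultimately show i: "integrable lborel f1" by simp
  define R where "R = max r 0 + 1"
  have out: "r < norm (x, y)" if "R \<le> \<bar>x\<bar>" for x y :: real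
    using that norm_fst_le[of x y] by (auto simp: R_def)
  have slice: "(\<integral>x. f1 (x, y) \<partial>lborel) = 0" for y
  proof -
    have cs: "continuous_on A (\<lambda>x. f1 (x, y))" for A
      by (rule continuous_on_compose2[OF c]) (auto intro!: continuous_intros)
    have "(\<integral>x. f1 (x, y) \<partial>lborel) = (\<integral>x. f1 (x, y) * indicator {- R..R} x \<partial>lborel)"
    proof (rule Bochner_Integration.integral_cong[OF refl])
      fix x
      show "f1 (x, y) = f1 (x, y) * indicator {- R..R} x"
        using f10[OF out[of x y]] by (cases "x \<in> {- R..R}") auto
    qed
    also have "\<dots> = f (R, y) - f (- R, y)"
      by (rule integral_FTC_Icc_real) (use d cs in \<open>auto simp: R_def continuous_on_eq_continuous_at intro!:
        continuous_on_interior[OF cs[of UNIV]]\<close>)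
    also have "\<dots> = 0" using f0[OF out[of R y]] f0[OF out[of "- R" y]] by simp
    finally show ?thesis .
  qed
  have "integrable (lborel \<Otimes>\<^sub>M lborel) (\<lambda>(x, y). f1 (x, y))" using i by (simp add: lborel_prod)
  from lborel_pair.integral_snd[OF this] show "(\<integral>p. f1 p \<partial>lborel) = 0" by (simp add: slice lborel_prod)
qed

lemma integral_partial_snd_zero:
  fixes f f2 :: "real \<times> real \<Rightarrow> real"
  assumes d: "\<And>x y. ((\<lambda>y. f (x, y)) has_real_derivative f2 (x, y)) (at y)" and c: "continuous_on UNIV f2"
    and f0: "\<And>p. r < norm p \<Longrightarrow> f p = 0" and f20: "\<And>p. r < norm p \<Longrightarrow> f2 p = 0"
  shows "integrable lborel f2" "(\<integral>p. f2 p \<partial>lborel) = 0"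
proof -
  let ?s = "\<lambda>p. f2 (snd p, fst p)"
  have n: "norm (b, a) = norm (a, b)" for a b :: real by (simp add: norm_Pair add.commute)
  have *: "integrable lborel ?s" "(\<integral>p. ?s p \<partial>lborel) = 0"
    by (rule integral_partial_fst_zero[of "\<lambda>p. f (snd p, fst p)" ?s r];
        use d f0 f20 n in \<open>force intro!: continuous_on_compose2[OF c] continuous_intros\<close>)+
  have eq: "(\<lambda>p. ?s (snd p, fst p)) = f2" by simp
  have "integrable (lborel \<Otimes>\<^sub>M lborel) (\<lambda>(x, y). f2 (y, x))" using *(1) by (simp add: lborel_prod case_prod_beta')
  then have "integrable (lborel \<Otimes>\<^sub>M lborel) (\<lambda>(x, y). f2 (x, y))" by (subst (asm)
    lborel_pair.integrable_product_swap_iff[symmetric]) (simp add: case_prod_beta')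
  then show "integrable lborel f2" by (simp add: lborel_prod)
  have "(\<integral>(x, y). f2 (y, x) \<partial>(lborel \<Otimes>\<^sub>M lborel)) = (\<integral>p. f2 p \<partial>(lborel \<Otimes>\<^sub>M lborel))"
    by (rule lborel_pair.integral_product_swap) (use \<open>integrable lborel f2\<close> in \<open>simp add: lborel_prod
      borel_measurable_integrable\<close>)
  then show "(\<integral>p. f2 p \<partial>lborel) = 0" using *(2) by (simp add: lborel_prod case_prod_beta')
qed

lemma integrable_lebesgue_on_compact_support:
  fixes h :: "real \<times> real \<Rightarrow> real"
  assumes S: "open S" and c: "continuous_on S h" and K: "compact K" "K \<subseteq> S" and z: "\<And>x. x \<in> S \<Longrightarrow> x \<notin> K \<Longrightarrow> h x = 0"
  shows "integrable (lebesgue_on S) h"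
proof -
  have "integrable lborel (\<lambda>x. indicator K x *\<^sub>R h x)"
    by (rule borel_integrable_compact[OF K(1) continuous_on_subset[OF c K(2)]])
  moreover have "(\<lambda>x. indicator K x *\<^sub>R h x) = (\<lambda>x. indicator S x *\<^sub>R h x)"
    using z K(2) by (auto simp: indicator_def fun_eq_iff)
  ultimately have "integrable lborel (\<lambda>x. indicator S x *\<^sub>R h x)" by simp
  then have "integrable lebesgue (\<lambda>x. indicator S x *\<^sub>R h x)"
    using integrable_completion borel_measurable_integrable by blast
  then show ?thesis using S by (subst integrable_restrict_space) auto
qed

lemma integral_lebesgue_on_lborel:
  fixes h :: "real \<times> real \<Rightarrow> real"
  assumes S: "open S" and m: "h \<in> borel_measurable borel" and z: "\<And>x. x \<notin> S \<Longrightarrow> h x = 0"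
  shows "(\<integral>x. h x \<partial>lebesgue_on S) = (\<integral>x. h x \<partial>lborel)"
proof -
  have "(\<integral>x. h x \<partial>lebesgue_on S) = (\<integral>x. indicator S x *\<^sub>R h x \<partial>lebesgue)"
    using S by (subst integral_restrict_space) auto
  also have "(\<lambda>x. indicator S x *\<^sub>R h x) = h" using z by (auto simp: indicator_def fun_eq_iff)
  also have "(\<integral>x. h x \<partial>lebesgue) = (\<integral>x. h x \<partial>lborel)" using m by (intro integral_completion) simp
  finally show ?thesis .
qed

text \<open>The integrand is the divergence of \<phi>^2 X. The field X is differentiable only on S,
  but the support of \<phi> is compact in S, so \<phi>^2 X extended by zero is differentiable on the
  plane with continuous partial derivatives, and no boundary term arises whatever the regularity of
  the boundary.\<close>

lemma test_fun_divergence: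
  fixes X :: "real \<times> real \<Rightarrow> real \<times> real"
  assumes S: "open S" and t: "test_fun S \<phi> g"
    and X: "\<And>x. x \<in> S \<Longrightarrow> (X has_derivative DX x) (at x)"
    and c1: "continuous_on S (\<lambda>x. DX x (1, 0))" and c2: "continuous_on S (\<lambda>x. DX x (0, 1))"
  shows "integrable (lebesgue_on S) (\<lambda>x. 2 * \<phi> x * (g x \<bullet> X x) + (\<phi> x)\<^sup>2 * (fst (DX x (1, 0)) + snd (DX x (0, 1))))"
    and "(\<integral>x. 2 * \<phi> x * (g x \<bullet> X x) + (\<phi> x)\<^sup>2 * (fst (DX x (1, 0)) + snd (DX x (0, 1))) \<partial>lebesgue_on S) = 0"
proof -
  define K where "K = closure {x. \<phi> x \<noteq> 0}"
  have K: "compact K" "K \<subseteq> S" using t unfolding test_fun_def K_def by blast+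
  have K0: "\<phi> x = 0" if "x \<notin> K" for x using that closure_subset[of "{x. \<phi> x \<noteq> 0}"] unfolding K_def by blast
  have g0: "g x = 0" if "x \<notin> K" for x using test_fun_grad_zero[OF t] that unfolding K_def .
  have oK: "open (- K)" using K(1) by (simp add: compact_imp_closed open_Compl)
  have cX: "continuous_on S X"
    using X by (meson S continuous_on_eq_continuous_at has_derivative_continuous)
  have c\<phi>: "continuous_on UNIV \<phi>" by (rule test_fun_continuous[OF t])
  have cg: "continuous_on UNIV g" using t unfolding test_fun_def by blast
  define F where "F x = (if x \<in> S then (\<phi> x)\<^sup>2 *\<^sub>R X x else 0)" for x
  define DF where "DF x h = (if x \<in> S then (2 * \<phi> x * (g x \<bullet> h)) *\<^sub>R X x + (\<phi> x)\<^sup>2 *\<^sub>R DX x h else 0)" for x h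
  have F0: "F x = 0" if "x \<notin> K" for x using K0[OF that] by (simp add: F_def)
  have DF0: "DF x h = 0" if "x \<notin> K" for x h using K0[OF that] by (simp add: DF_def)
  have FD: "(F has_derivative DF x) (at x)" for x
  proof (cases "x \<in> S")
    case True
    have d\<phi>: "(\<phi> has_derivative (\<lambda>h. g x \<bullet> h)) (at x)" using t unfolding test_fun_def by blast
    have "((\<lambda>x. (\<phi> x * \<phi> x) *\<^sub>R X x) has_derivative DF x) (at x)"
      by (rule has_derivative_eq_rhs[OF has_derivative_scaleR[OF has_derivative_mult[OF d\<phi> d\<phi>] X[OF True]]])
        (use True in \<open>auto simp: DF_def power2_eq_square algebra_simps fun_eq_iff scaleR_left_distrib[symmetric]\<close>)
    then show ?thesis
      by (rule has_derivative_transform_within_open[OF _ S True]) (simp add: F_def power2_eq_square)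
  next
    case False
    then have x: "x \<in> - K" using K by auto
    have "DF x = (\<lambda>h. 0)" using x by (intro ext DF0) simp
    moreover have "((\<lambda>_. 0) has_derivative (\<lambda>h. 0)) (at x)" by simp
    then have "(F has_derivative (\<lambda>h. 0)) (at x)"
      by (rule has_derivative_transform_within_open[OF _ oK x]) (use F0 in auto)
    ultimately show ?thesis by simp
  qed
  have cDF: "continuous_on UNIV (\<lambda>x. DF x e)" if ce: "continuous_on S (\<lambda>x. DX x e)" for e
  proof -
    have "continuous_on S (\<lambda>x. (2 * \<phi> x * (g x \<bullet> e)) *\<^sub>R X x + (\<phi> x)\<^sup>2 *\<^sub>R DX x e)"
      by (intro continuous_intros cX ce continuous_on_subset[OF c\<phi>] continuous_on_subset[OF cg]) auto
    then have "continuous_on S (\<lambda>x. DF x e)" by (rule continuous_on_eq) (simp add: DF_def)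
    moreover have "continuous_on (- K) (\<lambda>x. DF x e)"
      by (rule continuous_on_eq[of _ "\<lambda>_. 0"]) (use DF0 in auto)
    ultimately have "continuous_on (S \<union> - K) (\<lambda>x. DF x e)" by (intro continuous_on_open_Un S oK)
    moreover have "S \<union> - K = UNIV" using K by auto
    ultimately show ?thesis by simp
  qed
  obtain r where r: "\<And>x. x \<in> K \<Longrightarrow> norm x \<le> r" using compact_imp_bounded[OF K(1)] unfolding bounded_iff by blast
  have far: "p \<notin> K" if "r < norm p" for p using r[of p] that by (auto simp: not_le)
  have p1: "((\<lambda>x. fst (F (x, y))) has_real_derivative fst (DF (x, y) (1, 0))) (at x)" for x y
  proof -
    have "((\<lambda>x. (x, y)) has_derivative (\<lambda>h. (h, 0))) (at x)" by (auto intro!: derivative_eq_intros)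
    from has_derivative_fst[OF has_derivative_compose[OF this FD]]
    have "((\<lambda>x. fst (F (x, y))) has_derivative (\<lambda>h. fst (DF (x, y) (h, 0)))) (at x)" .
    moreover have "(\<lambda>h. fst (DF (x, y) (h, 0))) = (*) (fst (DF (x, y) (1, 0)))"
    proof
      fix h
      show "fst (DF (x, y) (h, 0)) = fst (DF (x, y) (1, 0)) * h"
        using linear_cmul[OF has_derivative_linear[OF FD[of "(x, y)"]], of h "(1, 0)"] by simp
    qed
    ultimately show ?thesis unfolding has_field_derivative_def by (simp only:)
  qed
  have p2: "((\<lambda>y. snd (F (x, y))) has_real_derivative snd (DF (x, y) (0, 1))) (at y)" for x y
  proof -
    have "((\<lambda>y. (x, y)) has_derivative (\<lambda>h. (0, h))) (at y)" by (auto intro!: derivative_eq_intros)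
    from has_derivative_snd[OF has_derivative_compose[OF this FD]]
    have "((\<lambda>y. snd (F (x, y))) has_derivative (\<lambda>h. snd (DF (x, y) (0, h)))) (at y)" .
    moreover have "(\<lambda>h. snd (DF (x, y) (0, h))) = (*) (snd (DF (x, y) (0, 1)))"
    proof
      fix h
      show "snd (DF (x, y) (0, h)) = snd (DF (x, y) (0, 1)) * h"
        using linear_cmul[OF has_derivative_linear[OF FD[of "(x, y)"]], of h "(0, 1)"] by simp
    qed
    ultimately show ?thesis unfolding has_field_derivative_def by (simp only:)
  qed
  have i1: "integrable lborel (\<lambda>p. fst (DF p (1, 0)))" "(\<integral>p. fst (DF p (1, 0)) \<partial>lborel) = 0"
    by (rule integral_partial_fst_zero[OF p1, of r]; use cDF[OF c1] far F0 DF0 in \<open>auto intro!: continuous_intros\<close>)+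
  have i2: "integrable lborel (\<lambda>p. snd (DF p (0, 1)))" "(\<integral>p. snd (DF p (0, 1)) \<partial>lborel) = 0"
    by (rule integral_partial_snd_zero[OF p2, of r]; use cDF[OF c2] far F0 DF0 in \<open>auto intro!: continuous_intros\<close>)+
  let ?h = "\<lambda>x. 2 * \<phi> x * (g x \<bullet> X x) + (\<phi> x)\<^sup>2 * (fst (DX x (1, 0)) + snd (DX x (0, 1)))"
  let ?k = "\<lambda>x. fst (DF x (1, 0)) + snd (DF x (0, 1))"
  have hk: "?h x = ?k x" if "x \<in> S" for x
    using that by (cases "X x"; cases "g x") (simp add: DF_def inner_prod_def algebra_simps)
  show "integrable (lebesgue_on S) ?h"
    by (rule integrable_lebesgue_on_compact_support[OF S _ K])
      (use K0 in \<open>auto intro!: continuous_intros cX c1 c2 continuous_on_subset[OF c\<phi>] continuous_on_subset[OF cg]\<close>)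
  have "(\<integral>x. ?h x \<partial>lebesgue_on S) = (\<integral>x. ?k x \<partial>lebesgue_on S)"
    by (rule Bochner_Integration.integral_cong) (use hk in auto)
  also have "\<dots> = (\<integral>x. ?k x \<partial>lborel)"
    by (rule integral_lebesgue_on_lborel[OF S]) (use i1 i2 in \<open>auto simp: DF_def dest!: borel_measurable_integrable\<close>)
  also have "\<dots> = 0" using i1 i2 by simp
  finally show "(\<integral>x. ?h x \<partial>lebesgue_on S) = 0" .
qed

text \<open>\<open>b\<close> plays the role of the logarithmic gradient of a ground state: expanding
  \<open>2 w \<bar>g - \<phi> b\<bar>\<^sup>2 \<ge> 0\<close> and integrating the cross term by parts leaves the divergence condition.\<close>
lemma weight_test_of_vector_field:
  fixes b :: "real \<times> real \<Rightarrow> real \<times> real"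
  assumes S: "open S" and t: "test_fun S \<phi> g"
    and X: "\<And>x. x \<in> S \<Longrightarrow> ((\<lambda>x. (2 * w x) *\<^sub>R b x + dw x) has_derivative DX x) (at x)"
    and c1: "continuous_on S (\<lambda>x. DX x (1, 0))" and c2: "continuous_on S (\<lambda>x. DX x (0, 1))"
    and w: "continuous_on UNIV w" "\<And>x. 0 \<le> w x" and dw: "continuous_on UNIV dw" and wt: "continuous_on UNIV wt"
    and div: "\<And>x. x \<in> S \<Longrightarrow> fst (DX x (1, 0)) + snd (DX x (0, 1)) + 2 * w x * (norm (b x))\<^sup>2 + wt x \<le> 0"
  shows "ip (lebesgue_on S) (\<lambda>x. wt x * \<phi> x) \<phi> \<le> 2 * ip (lebesgue_on S) (\<lambda>x. w x *\<^sub>R g x + \<phi> x *\<^sub>R dw x) g"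
proof -
  let ?M = "lebesgue_on S"
  let ?X = "\<lambda>x. (2 * w x) *\<^sub>R b x + dw x"
  let ?D = "\<lambda>x. 2 * \<phi> x * (g x \<bullet> ?X x) + (\<phi> x)\<^sup>2 * (fst (DX x (1, 0)) + snd (DX x (0, 1)))"
  define K where "K = closure {x. \<phi> x \<noteq> 0}"
  have K: "compact K" "K \<subseteq> S" using t unfolding test_fun_def K_def by blast+
  have K0: "\<phi> x = 0" if "x \<notin> K" for x using that closure_subset[of "{x. \<phi> x \<noteq> 0}"] unfolding K_def by blast
  have g0: "g x = 0" if "x \<notin> K" for x using test_fun_grad_zero[OF t] that unfolding K_def .
  have c\<phi>: "continuous_on S \<phi>" by (rule continuous_on_subset[OF test_fun_continuous[OF t]]) simp
  have cg: "continuous_on S g" using t unfolding test_fun_def by (blast intro: continuous_on_subset)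
  note cs = continuous_on_subset[OF w(1)] continuous_on_subset[OF dw] continuous_on_subset[OF wt]
  have i1: "integrable ?M (\<lambda>x. (w x *\<^sub>R g x + \<phi> x *\<^sub>R dw x) \<bullet> g x)"
    by (rule integrable_lebesgue_on_compact_support[OF S _ K]) (use K0 g0 in \<open>auto intro!: continuous_intros cs c\<phi> cg\<close>)
  have i2: "integrable ?M (\<lambda>x. (wt x * \<phi> x) \<bullet> \<phi> x)"
    by (rule integrable_lebesgue_on_compact_support[OF S _ K]) (use K0 g0 in \<open>auto intro!: continuous_intros cs c\<phi> cg\<close>)
  have "0 = (\<integral>x. ?D x \<partial>?M)" using test_fun_divergence(2)[OF S t X c1 c2] by simp
  also have "\<dots> \<le> (\<integral>x. 2 * ((w x *\<^sub>R g x + \<phi> x *\<^sub>R dw x) \<bullet> g x) - (wt x * \<phi> x) \<bullet> \<phi> x \<partial>?M)"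
  proof (rule integral_mono)
    show "integrable ?M ?D" by (rule test_fun_divergence(1)[OF S t X c1 c2])
    show "integrable ?M (\<lambda>x. 2 * ((w x *\<^sub>R g x + \<phi> x *\<^sub>R dw x) \<bullet> g x) - (wt x * \<phi> x) \<bullet> \<phi> x)" using i1 i2 by simp
    fix x assume "x \<in> space ?M"
    then have x: "x \<in> S" by simp
    have "0 \<le> 2 * w x * ((g x - \<phi> x *\<^sub>R b x) \<bullet> (g x - \<phi> x *\<^sub>R b x))" using w(2) by simp
    also have "\<dots> = 2 * w x * (g x \<bullet> g x) - 4 * w x * \<phi> x * (g x \<bullet> b x) + (\<phi> x)\<^sup>2 * (2 * w x * (norm (b x))\<^sup>2)"
      by (simp add: inner_diff_left inner_diff_right inner_commute power2_eq_square[of "\<phi> x"] power2_norm_eq_inner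
        algebra_simps)
    finally have 1: "4 * w x * \<phi> x * (g x \<bullet> b x) \<le> 2 * w x * (g x \<bullet> g x) + (\<phi> x)\<^sup>2 * (2 * w x * (norm (b x))\<^sup>2)" by simp
    have "(\<phi> x)\<^sup>2 * (fst (DX x (1, 0)) + snd (DX x (0, 1)) + 2 * w x * (norm (b x))\<^sup>2 + wt x) \<le> 0"
      using div[OF x] by (simp add: mult_nonneg_nonpos)
    then have 2: "(\<phi> x)\<^sup>2 * (fst (DX x (1, 0)) + snd (DX x (0, 1))) + (\<phi> x)\<^sup>2 * (2 * w x * (norm (b x))\<^sup>2) + (\<phi> x)\<^sup>2 *
      wt x \<le> 0"
      by (simp add: algebra_simps)
    have "2 * \<phi> x * (g x \<bullet> ?X x) = 4 * w x * \<phi> x * (g x \<bullet> b x) + 2 * \<phi> x * (g x \<bullet> dw x)"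
      by (simp add: inner_add_right algebra_simps)
    moreover have "2 * ((w x *\<^sub>R g x + \<phi> x *\<^sub>R dw x) \<bullet> g x) = 2 * w x * (g x \<bullet> g x) + 2 * \<phi> x * (g x \<bullet> dw x)"
      by (simp add: inner_add_left inner_commute[of "dw x" "g x"])
    moreover have "(wt x * \<phi> x) \<bullet> \<phi> x = (\<phi> x)\<^sup>2 * wt x" by (simp add: power2_eq_square)
    ultimately show "?D x \<le> 2 * ((w x *\<^sub>R g x + \<phi> x *\<^sub>R dw x) \<bullet> g x) - (wt x * \<phi> x) \<bullet> \<phi> x"
      using 1 2 by linarith
  qed
  also have "\<dots> = 2 * ip ?M (\<lambda>x. w x *\<^sub>R g x + \<phi> x *\<^sub>R dw x) g - ip ?M (\<lambda>x. wt x * \<phi> x) \<phi>"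
    using i1 i2 by (simp add: ip_def)
  finally show ?thesis by simp
qed

subsection \<open>The angular coordinate of the curved wedge\<close>

text \<open>\<open>rot1\<close> and \<open>rot2\<close> are the coordinates of x after rotating back
  by \<theta>(|x|). They straighten the curved wedge and equal r cos \<phi> and r sin
  \<phi>.\<close>

definition rot1 :: "(real \<Rightarrow> real) \<Rightarrow> real \<times> real \<Rightarrow> real" where
  "rot1 \<theta> x = cos (\<theta> (norm x)) * fst x + sin (\<theta> (norm x)) * snd x"

definition rot2 :: "(real \<Rightarrow> real) \<Rightarrow> real \<times> real \<Rightarrow> real" where
  "rot2 \<theta> x = cos (\<theta> (norm x)) * snd x - sin (\<theta> (norm x)) * fst x"

text \<open>The angular coordinate \<open>\<phi> \<in> (0, 2\<pi>)\<close>, from \<open>cot (\<phi> / 2) = sin \<phi> / (1 - cos \<phi>)\<close>; smooth off the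
  curve \<open>\<phi> = 0\<close>, where \<open>rot1 \<theta> x = norm x\<close>.\<close>
definition wedge_angle :: "(real \<Rightarrow> real) \<Rightarrow> real \<times> real \<Rightarrow> real" where
  "wedge_angle \<theta> x = pi - 2 * arctan (rot2 \<theta> x / (norm x - rot1 \<theta> x))"

lemma norm_pair_sq: "(norm x)\<^sup>2 = (fst x)\<^sup>2 + (snd x)\<^sup>2" for x :: "real \<times> real"
  by (cases x) (simp add: norm_Pair)

lemma rot_sq: "(rot1 \<theta> x)\<^sup>2 + (rot2 \<theta> x)\<^sup>2 = (norm x)\<^sup>2"
proof -
  have "(rot1 \<theta> x)\<^sup>2 + (rot2 \<theta> x)\<^sup>2 = ((cos (\<theta> (norm x)))\<^sup>2 + (sin (\<theta> (norm x)))\<^sup>2) * ((fst x)\<^sup>2 + (snd x)\<^sup>2)"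
    unfolding rot1_def rot2_def by algebra
  then show ?thesis by (simp add: norm_pair_sq)
qed

lemma unrot:
  "cos (\<theta> (norm x)) * rot1 \<theta> x - sin (\<theta> (norm x)) * rot2 \<theta> x = fst x"
  "sin (\<theta> (norm x)) * rot1 \<theta> x + cos (\<theta> (norm x)) * rot2 \<theta> x = snd x"
proof -
  let ?c = "cos (\<theta> (norm x))" and ?s = "sin (\<theta> (norm x))"
  have "?c * rot1 \<theta> x - ?s * rot2 \<theta> x = (?c\<^sup>2 + ?s\<^sup>2) * fst x" unfolding rot1_def rot2_def by algebra
  then show "?c * rot1 \<theta> x - ?s * rot2 \<theta> x = fst x" by simp
  have "?s * rot1 \<theta> x + ?c * rot2 \<theta> x = (?c\<^sup>2 + ?s\<^sup>2) * snd x" unfolding rot1_def rot2_def by algebra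
  then show "?s * rot1 \<theta> x + ?c * rot2 \<theta> x = snd x" by simp
qed

lemma wedge_angle_bounds: "0 < wedge_angle \<theta> x" "wedge_angle \<theta> x < 2 * pi"
  using arctan_bounded[of "rot2 \<theta> x / (norm x - rot1 \<theta> x)"] by (auto simp: wedge_angle_def)

text \<open>The quotient q is the cotangent of half the angle, and \<open>rot_sq\<close> gives (1 +
  q^2) (r - \<open>rot1\<close>) = 2r; the double-angle formulas do the rest.\<close>

lemma rot_polar:
  assumes lt: "rot1 \<theta> x < norm x"
  shows "rot1 \<theta> x = norm x * cos (wedge_angle \<theta> x)" "rot2 \<theta> x = norm x * sin (wedge_angle \<theta> x)"
proof -
  define q where "q = rot2 \<theta> x / (norm x - rot1 \<theta> x)"
  define m where "m = norm x - rot1 \<theta> x"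
  have m: "0 < m" using lt by (simp add: m_def)
  have pos: "0 < norm x"
  proof (rule ccontr)
    assume "\<not> 0 < norm x"
    then have "x = 0" by simp
    then show False using lt by (simp add: rot1_def)
  qed
  have qm: "q * m = rot2 \<theta> x" using m by (simp add: q_def m_def)
  have q1: "(1 + q\<^sup>2) * m = 2 * norm x"
  proof -
    have "(1 + q\<^sup>2) * m * m = m\<^sup>2 + (q * m)\<^sup>2" by (simp add: power2_eq_square algebra_simps)
    also have "\<dots> = 2 * norm x * m" unfolding qm using rot_sq[of \<theta> x] by (simp add: m_def power2_eq_square algebra_simps)
    finally show ?thesis using m by simp
  qed
  have q0: "0 < 1 + q\<^sup>2" by (simp add: add_pos_nonneg)
  have c: "(cos (arctan q))\<^sup>2 = 1 / (1 + q\<^sup>2)" using q0 by (simp add: cos_arctan power_divide)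
  have cs: "sin (arctan q) * cos (arctan q) = q / (1 + q\<^sup>2)" using q0 by (simp add: cos_arctan sin_arctan)
  have "cos (wedge_angle \<theta> x) = - cos (2 * arctan q)" by (simp add: wedge_angle_def q_def cos_diff)
  also have "\<dots> = 1 - 2 / (1 + q\<^sup>2)" by (simp add: cos_double_cos c)
  finally have "norm x * cos (wedge_angle \<theta> x) = norm x - 2 * norm x / (1 + q\<^sup>2)" by (simp add: right_diff_distrib)
  also have "2 * norm x / (1 + q\<^sup>2) = m" using q1 q0 by (simp add: field_simps)
  finally show "rot1 \<theta> x = norm x * cos (wedge_angle \<theta> x)" by (simp add: m_def)
  have "sin (wedge_angle \<theta> x) = sin (2 * arctan q)" by (simp add: wedge_angle_def q_def sin_diff)
  also have "\<dots> = 2 * q / (1 + q\<^sup>2)" by (simp add: sin_double mult.assoc cs)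
  finally have "norm x * sin (wedge_angle \<theta> x) = q * (2 * norm x / (1 + q\<^sup>2))" by simp
  also have "2 * norm x / (1 + q\<^sup>2) = m" using q1 q0 by (simp add: field_simps)
  finally show "rot2 \<theta> x = norm x * sin (wedge_angle \<theta> x)" using qm by simp
qed

lemma rot1_less_imp_norm_pos:
  assumes "rot1 \<theta> x < norm x" shows "0 < norm x"
  using assms by (cases "x = 0") (auto simp: rot1_def)

text \<open>This replaces the parametrisation by conditions on x itself. The first condition removes
  the origin and the curve \<phi> = 0; off these the angle is a continuous function, so the
  description also yields openness.\<close>

lemma curved_wedge_eq:
  assumes a: "0 < a" "a \<le> 1"
  shows "curved_wedge a \<theta> = {x. rot1 \<theta> x < norm x \<and> wedge_angle \<theta> x < 2 * pi * a}"
proof (intro subset_antisym subsetI)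
  fix x assume "x \<in> curved_wedge a \<theta>"
  then obtain r \<phi> where x: "x = (r * cos (\<phi> + \<theta> r), r * sin (\<phi> + \<theta> r))" and r: "0 < r" and \<phi>: "0 < \<phi>" "\<phi> < 2 * pi * a"
    unfolding curved_wedge_def by blast
  have "2 * pi * a \<le> 2 * pi * 1" using a by (intro mult_left_mono) auto
  then have \<phi>2: "\<phi> / 2 < pi" using \<phi> by linarith
  have nx: "norm x = r"
  proof -
    have "(r * cos (\<phi> + \<theta> r))\<^sup>2 + (r * sin (\<phi> + \<theta> r))\<^sup>2 = r\<^sup>2 * ((cos (\<phi> + \<theta> r))\<^sup>2 + (sin (\<phi> + \<theta> r))\<^sup>2)" by algebra
    then show ?thesis using r by (simp add: x norm_Pair)
  qed
  have r1: "rot1 \<theta> x = r * cos \<phi>"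
  proof -
    have "rot1 \<theta> x = r * cos (\<phi> + \<theta> r - \<theta> r)" unfolding rot1_def nx cos_diff by (simp add: x algebra_simps)
    then show ?thesis by simp
  qed
  have r2: "rot2 \<theta> x = r * sin \<phi>"
  proof -
    have "rot2 \<theta> x = r * sin (\<phi> + \<theta> r - \<theta> r)" unfolding rot2_def nx sin_diff by (simp add: x algebra_simps)
    then show ?thesis by simp
  qed
  define s c where "s = sin (\<phi> / 2)" and "c = cos (\<phi> / 2)"
  have s: "0 < s" unfolding s_def using \<phi> \<phi>2 by (intro sin_gt_zero) auto
  have cos\<phi>: "cos \<phi> = 1 - 2 * s\<^sup>2" using cos_double_sin[of "\<phi> / 2"] by (simp add: s_def)
  have sin\<phi>: "sin \<phi> = 2 * s * c" using sin_double[of "\<phi> / 2"] by (simp add: s_def c_def)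
  have lt: "rot1 \<theta> x < norm x" using r s by (simp add: r1 nx cos\<phi>)
  have "rot2 \<theta> x / (norm x - rot1 \<theta> x) = c / s"
    unfolding r1 r2 nx cos\<phi> sin\<phi> using r s by (simp add: field_simps power2_eq_square)
  \<comment> \<open>Here c / s is cot(\<phi>/2). The arctangent has the right branch because \<phi>
    lies in (0, 2 pi), which uses a \<le> 1.\<close>
  moreover have "arctan (c / s) = pi / 2 - \<phi> / 2"
    by (rule arctan_unique) (use \<phi> \<phi>2 in \<open>auto simp: tan_def s_def c_def sin_diff cos_diff\<close>)
  ultimately have "wedge_angle \<theta> x = \<phi>" by (simp add: wedge_angle_def)
  then show "x \<in> {x. rot1 \<theta> x < norm x \<and> wedge_angle \<theta> x < 2 * pi * a}" using lt \<phi> by simp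
next
  fix x assume "x \<in> {x. rot1 \<theta> x < norm x \<and> wedge_angle \<theta> x < 2 * pi * a}"
  then have x: "rot1 \<theta> x < norm x" "wedge_angle \<theta> x < 2 * pi * a" by auto
  let ?\<phi> = "wedge_angle \<theta> x"
  have "fst x = norm x * cos (?\<phi> + \<theta> (norm x))" "snd x = norm x * sin (?\<phi> + \<theta> (norm x))"
    using unrot[of \<theta> x] unfolding rot_polar[OF x(1)] by (simp_all add: cos_add sin_add algebra_simps)
  then have "x = (norm x * cos (?\<phi> + \<theta> (norm x)), norm x * sin (?\<phi> + \<theta> (norm x)))" by (simp add: prod_eq_iff)
  then show "x \<in> curved_wedge a \<theta>"
    unfolding curved_wedge_def using rot1_less_imp_norm_pos[OF x(1)] wedge_angle_bounds(1) x(2) by blast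
qed

text \<open>Since \<phi> is the polar angle minus \<theta>(r), its gradient is e_\<phi> / r -
  \<theta>'(r) e_r: the twist adds only a radial component.\<close>

lemma wedge_angle_has_derivative:
  assumes lt: "rot1 \<theta> x < norm x" and d: "(\<theta> has_real_derivative \<theta>') (at (norm x))"
  shows "(wedge_angle \<theta> has_derivative
     (\<lambda>h. (1 / (norm x)\<^sup>2) * (fst x * snd h - snd x * fst h) - \<theta>' / norm x * (x \<bullet> h))) (at x)"
proof -
  define r where "r = norm x"
  have r: "0 < r" unfolding r_def by (rule rot1_less_imp_norm_pos[OF lt])
  then have x0: "x \<noteq> 0" by (auto simp: r_def)
  define c s where "c = cos (\<theta> r)" and "s = sin (\<theta> r)"
  define dr where "dr h = (x \<bullet> h) / r" for h
  have dn: "(norm has_derivative dr) (at x)"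
    using has_derivative_norm[OF x0]
    by (simp add: dr_def[abs_def] r_def sgn_div_norm inner_commute divide_inverse mult.commute)
  have d\<theta>: "((\<lambda>x. \<theta> (norm x)) has_derivative (\<lambda>h. \<theta>' * dr h)) (at x)"
    by (rule has_derivative_compose[OF dn d[unfolded has_field_derivative_def]])
  let ?p = "\<lambda>h. \<theta>' * dr h"
  have d1: "(rot1 \<theta> has_derivative (\<lambda>h. (c * fst h + s * snd h) + ?p h * rot2 \<theta> x)) (at x)"
    unfolding rot1_def[abs_def]
    by (rule has_derivative_eq_rhs, (rule derivative_intros has_derivative_cos d\<theta> has_derivative_sin)+)
      (simp add: c_def s_def r_def rot2_def fun_eq_iff algebra_simps)
  have d2: "(rot2 \<theta> has_derivative (\<lambda>h. (c * snd h - s * fst h) - ?p h * rot1 \<theta> x)) (at x)"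
    unfolding rot2_def[abs_def]
    by (rule has_derivative_eq_rhs, (rule derivative_intros has_derivative_cos d\<theta> has_derivative_sin)+)
      (simp add: c_def s_def r_def rot1_def fun_eq_iff algebra_simps)
  define A B where "A = rot1 \<theta> x" and "B = rot2 \<theta> x"
  have m: "0 < r - A" using lt by (simp add: r_def A_def)
  define q where "q = B / (r - A)"
  let ?H1 = "\<lambda>h. c * fst h + s * snd h" and ?H2 = "\<lambda>h. c * snd h - s * fst h"
  let ?dq = "\<lambda>h. ((?H2 h - ?p h * A) * (r - A) - B * (dr h - (?H1 h + ?p h * B))) / ((r - A) * (r - A))"
  have dq: "((\<lambda>x. rot2 \<theta> x / (norm x - rot1 \<theta> x)) has_derivative ?dq) (at x)"
    using has_derivative_divide'[OF d2 has_derivative_diff[OF dn d1]] m by (simp add: A_def B_def r_def)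
  have "(wedge_angle \<theta> has_derivative (\<lambda>h. - (2 * (inverse (1 + q\<^sup>2) * ?dq h)))) (at x)"
  proof -
    have "(arctan has_derivative (*) (inverse (1 + q\<^sup>2))) (at (rot2 \<theta> x / (norm x - rot1 \<theta> x)))"
      using DERIV_arctan[of q] by (simp add: has_field_derivative_def q_def A_def B_def r_def)
    from has_derivative_compose[OF dq this]
    have "((\<lambda>x. arctan (rot2 \<theta> x / (norm x - rot1 \<theta> x))) has_derivative (\<lambda>h. inverse (1 + q\<^sup>2) * ?dq h)) (at x)" .
    from has_derivative_diff[OF has_derivative_const[of pi] has_derivative_mult_right[OF this, of 2]]
    show ?thesis unfolding wedge_angle_def[abs_def] diff_0 .
  qed
  moreover have "- (2 * (inverse (1 + q\<^sup>2) * ?dq h)) = (1 / (norm x)\<^sup>2) * (fst x * snd h - snd x * fst h) - \<theta>' / norm x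
    * (x \<bullet> h)" for h
  proof -
    have AB: "A\<^sup>2 + B\<^sup>2 = r\<^sup>2" using rot_sq[of \<theta> x] by (simp add: A_def B_def r_def)
    have "1 + q\<^sup>2 = 2 * r / (r - A)"
    proof -
      have "(1 + q\<^sup>2) * (r - A)\<^sup>2 = (r - A)\<^sup>2 + B\<^sup>2" using m by (simp add: q_def power_divide distrib_right)
      also have "\<dots> = 2 * r * (r - A)" using AB by algebra
      finally have "((1 + q\<^sup>2) * (r - A)) * (r - A) = (2 * r) * (r - A)" by (simp add: power2_eq_square mult.assoc)
      then have "(1 + q\<^sup>2) * (r - A) = 2 * r" using m by simp
      then show ?thesis using m by (simp add: nonzero_eq_divide_eq)
    qed
    then have i: "inverse (1 + q\<^sup>2) = (r - A) / (2 * r)" by simp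
    \<comment> \<open>U and V are the components of h in the rotated frame and P is the contribution
      of the twist. In these variables the claim becomes a polynomial identity modulo A^2 + B^2 =
      r^2 and r dr = A U + B V.\<close>
    define U V P where "U = ?H1 h" and "V = ?H2 h" and "P = ?p h"
    have drh: "r * dr h = A * U + B * V"
    proof -
      have "A * U + B * V = (c\<^sup>2 + s\<^sup>2) * (fst x * fst h + snd x * snd h)"
        unfolding A_def B_def U_def V_def rot1_def rot2_def c_def s_def r_def by algebra
      also have "\<dots> = x \<bullet> h" by (cases x; cases h) (simp add: c_def s_def inner_prod_def)
      finally show ?thesis using r by (simp add: dr_def)
    qed
    have cr: "A * V - B * U = fst x * snd h - snd x * fst h"
    proof -
      have "A * V - B * U = (c\<^sup>2 + s\<^sup>2) * (fst x * snd h - snd x * fst h)"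
        unfolding A_def B_def U_def V_def rot1_def rot2_def c_def s_def r_def by algebra
      then show ?thesis by (simp add: c_def s_def)
    qed
    define N where "N = (V - P * A) * (r - A) - B * (dr h - (U + P * B))"
    have rN: "r * N = (r - A) * (B * U - A * V) + P * r * r * (r - A)"
      using AB drh unfolding N_def by algebra
    have "- (2 * (((r - A) / (2 * r)) * (N / ((r - A) * (r - A))))) = - (r * N / (r * r * (r - A)))"
    proof -
      have "- (2 * ((M / (2 * r)) * (N / (M * M)))) = - (r * N / (r * r * M))" if "0 < M" for M
        using that r by (simp add: field_simps)
      from this[OF m] show ?thesis .
    qed
    also have "\<dots> = - (((B * U - A * V) + P * r * r) * (r - A) / ((r * r) * (r - A)))"
      unfolding rN by (simp add: algebra_simps)
    also have "\<dots> = - (((B * U - A * V) + P * r * r) / (r * r))" using m by simp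
    also have "\<dots> = (1 / r\<^sup>2) * (A * V - B * U) - P" using r by (simp add: field_simps power2_eq_square)
    finally show ?thesis unfolding i cr by (simp add: N_def U_def V_def P_def dr_def r_def)
  qed
  ultimately show ?thesis by (simp only:)
qed


text \<open>Coefficients depending on x \<bullet> x instead of the norm keep square roots out of the
  derivatives; (- snd x, fst x) is r e_\<phi>.\<close>

lemma radial_angular_field_has_derivative:
  fixes x z :: "real \<times> real"
  assumes A: "(A has_real_derivative A') (at (x \<bullet> x))" and B: "(B has_real_derivative B') (at (x \<bullet> x))"
    and \<zeta>: "(\<zeta> has_derivative (\<lambda>h. z \<bullet> h)) (at x)"
  shows "((\<lambda>x. A (x \<bullet> x) *\<^sub>R x + (B (x \<bullet> x) * \<zeta> x) *\<^sub>R (- snd x, fst x)) has_derivative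
    (\<lambda>h. A (x \<bullet> x) *\<^sub>R h + (2 * A' * (x \<bullet> h)) *\<^sub>R x + (B (x \<bullet> x) * \<zeta> x) *\<^sub>R (- snd h, fst h)
       + (2 * B' * (x \<bullet> h) * \<zeta> x + B (x \<bullet> x) * (z \<bullet> h)) *\<^sub>R (- snd x, fst x))) (at x)"
proof -
  have sq: "((\<lambda>x. x \<bullet> x) has_derivative (\<lambda>h. 2 * (x \<bullet> h))) (at x)"
    by (auto intro!: derivative_eq_intros simp: inner_commute)
  have dA: "((\<lambda>x. A (x \<bullet> x)) has_derivative (\<lambda>h. A' * (2 * (x \<bullet> h)))) (at x)"
    using has_derivative_compose[OF sq, of A "(*) A'"] A by (simp add: has_field_derivative_def)
  have dB: "((\<lambda>x. B (x \<bullet> x)) has_derivative (\<lambda>h. B' * (2 * (x \<bullet> h)))) (at x)"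
    using has_derivative_compose[OF sq, of B "(*) B'"] B by (simp add: has_field_derivative_def)
  have dJ: "((\<lambda>x::real \<times> real. (- snd x, fst x)) has_derivative (\<lambda>h. (- snd h, fst h))) (at x)"
    by (auto intro!: derivative_eq_intros)
  show ?thesis
    by (rule has_derivative_eq_rhs[OF has_derivative_add[OF has_derivative_scaleR[OF dA has_derivative_ident]
          has_derivative_scaleR[OF has_derivative_mult[OF dB \<zeta>] dJ]]])
      (simp add: fun_eq_iff algebra_simps)
qed

lemma rot_continuous:
  assumes "continuous_on {0<..} \<theta>"
  shows "continuous_on (- {0}) (rot1 \<theta>)" "continuous_on (- {0}) (rot2 \<theta>)"
proof -
  have "continuous_on (- {0}) (\<lambda>x::real \<times> real. \<theta> (norm x))"
    by (rule continuous_on_compose2[OF assms]) (auto intro!: continuous_intros)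
  then show "continuous_on (- {0}) (rot1 \<theta>)" "continuous_on (- {0}) (rot2 \<theta>)"
    unfolding rot1_def[abs_def] rot2_def[abs_def] by (auto intro!: continuous_intros)
qed

lemma open_curved_wedge:
  assumes a: "0 < a" "a \<le> 1" and c: "continuous_on {0<..} \<theta>"
  shows "open (curved_wedge a \<theta>)"
proof -
  let ?N = "{x. rot1 \<theta> x < norm x}"
  have N0: "?N \<subseteq> - {0}" by (auto simp: rot1_def)
  have "open (- {0} \<inter> (\<lambda>x. norm x - rot1 \<theta> x) -` {0<..})"
    by (intro continuous_open_preimage continuous_intros rot_continuous c)
  moreover have "- {0} \<inter> (\<lambda>x. norm x - rot1 \<theta> x) -` {0<..} = ?N" using N0 by auto
  ultimately have oN: "open ?N" by simp
  have "continuous_on ?N (wedge_angle \<theta>)"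
    unfolding wedge_angle_def[abs_def]
    by (intro continuous_intros continuous_on_subset[OF rot_continuous(1)[OF c] N0] continuous_on_subset[OF
      rot_continuous(2)[OF c] N0]) auto
  then have "open (?N \<inter> wedge_angle \<theta> -` {..<2 * pi * a})"
    using oN by (rule continuous_open_preimage) simp
  moreover have "?N \<inter> wedge_angle \<theta> -` {..<2 * pi * a} = curved_wedge a \<theta>" unfolding curved_wedge_eq[OF a] by auto
  ultimately show ?thesis by simp
qed

text \<open>With \<open>\<nu> = 1 / (2 a)\<close> and \<open>E = \<kappa> exp (- \<bar>x\<bar>\<^sup>2 / (4 \<tau>))\<close>, the weight is \<open>W = 1 / (E + \<mu>)\<close>. The field used is
  \<open>b = (\<nu> / r + W \<partial>\<^sub>r E) e\<^sub>r + (\<nu> / r) cot (\<nu> \<phi>) e\<^sub>\<phi>\<close>, for which the divergence condition is an identity;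
  only \<open>\<partial>\<^sub>\<phi> \<phi> = 1\<close> enters, so that the curve \<open>\<theta>\<close> plays no role.\<close>
lemma wedge_weight_test:
  fixes \<theta> \<theta>' :: "real \<Rightarrow> real"
  assumes a: "0 < a" "a \<le> 1"
    and deriv: "\<And>r. 0 < r \<Longrightarrow> (\<theta> has_real_derivative \<theta>' r) (at r)"
    and cont: "continuous_on {0<..} \<theta>'"
    and \<tau>: "0 < \<tau>" and \<mu>: "0 < \<mu>" and \<kappa>: "0 < \<kappa>"
    and t: "test_fun (curved_wedge a \<theta>) \<phi> g"
  defines "E \<equiv> \<lambda>\<rho>. \<kappa> * exp (- \<rho> / (4 * \<tau>))"
  defines "W \<equiv> \<lambda>\<rho>. 1 / (E \<rho> + \<mu>)"
  shows "ip (lebesgue_on (curved_wedge a \<theta>))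
      (\<lambda>x. ((1 + 1 / (2 * a)) * E (x \<bullet> x) * (W (x \<bullet> x))\<^sup>2 / \<tau> - (x \<bullet> x) * E (x \<bullet> x) * (W (x \<bullet> x))\<^sup>2 / (4 * \<tau>\<^sup>2)) * \<phi> x) \<phi>
    \<le> 2 * ip (lebesgue_on (curved_wedge a \<theta>))
      (\<lambda>x. W (x \<bullet> x) *\<^sub>R g x + \<phi> x *\<^sub>R ((W (x \<bullet> x))\<^sup>2 * E (x \<bullet> x) / (2 * \<tau>)) *\<^sub>R x) g"
proof -
  define \<nu> where "\<nu> = 1 / (2 * a)"
  let ?S = "curved_wedge a \<theta>"
  have \<theta>c: "continuous_on {0<..} \<theta>"
    using deriv by (intro continuous_at_imp_continuous_on) (auto intro: DERIV_isCont)
  have S: "open ?S" by (rule open_curved_wedge[OF a \<theta>c])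
  have Sx: "rot1 \<theta> x < norm x" "0 < \<nu> * wedge_angle \<theta> x" "\<nu> * wedge_angle \<theta> x < pi" "0 < norm x" if "x \<in> ?S" for x
  proof -
    show lt: "rot1 \<theta> x < norm x" using that unfolding curved_wedge_eq[OF a] by simp
    show "0 < norm x" by (rule rot1_less_imp_norm_pos[OF lt])
    show "0 < \<nu> * wedge_angle \<theta> x" using wedge_angle_bounds(1) a by (simp add: \<nu>_def)
    show "\<nu> * wedge_angle \<theta> x < pi" using that a unfolding curved_wedge_eq[OF a] by (simp add: \<nu>_def field_simps)
  qed
  have E0: "0 < E \<rho>" for \<rho> using \<kappa> by (simp add: E_def)
  have EM: "E \<rho> + \<mu> \<noteq> 0" for \<rho> using E0[of \<rho>] \<mu> by simp
  have W0: "0 < W \<rho>" for \<rho> using E0[of \<rho>] \<mu> by (simp add: W_def)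
  have dE: "(E has_real_derivative - E \<rho> / (4 * \<tau>)) (at \<rho>)" for \<rho>
    unfolding E_def using \<tau> by (auto intro!: derivative_eq_intros simp: field_simps)
  have dW: "(W has_real_derivative (W \<rho>)\<^sup>2 * E \<rho> / (4 * \<tau>)) (at \<rho>)" for \<rho>
    unfolding W_def using EM[of \<rho>] \<tau> by (auto intro!: derivative_eq_intros dE simp: field_simps power2_eq_square)
  have cE: "continuous_on A E" and cW: "continuous_on A W" for A
    by (intro continuous_at_imp_continuous_on ballI DERIV_isCont[OF dE] DERIV_isCont[OF dW])+
  define W' where "W' \<rho> = (W \<rho>)\<^sup>2 * E \<rho> / (4 * \<tau>)" for \<rho>
  \<comment> \<open>A and B \<zeta> are the coefficients of the field 2 W b + dw along x and along x
    turned by a right angle, as functions of \<rho> = |x|^2; see \<open>field_eq\<close>.\<close>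
  define A where "A \<rho> = 2 * \<nu> * W \<rho> / \<rho> - E \<rho> * (W \<rho>)\<^sup>2 / (2 * \<tau>)" for \<rho>
  define A' where "A' \<rho> = 2 * \<nu> * W' \<rho> / \<rho> - 2 * \<nu> * W \<rho> / \<rho>\<^sup>2 + E \<rho> * (W \<rho>)\<^sup>2 / (8 * \<tau>\<^sup>2) - (E \<rho>)\<^sup>2 * (W \<rho>) ^ 3 / (4 *
    \<tau>\<^sup>2)" for \<rho>
  define B where "B \<rho> = 2 * \<nu> * W \<rho> / \<rho>" for \<rho>
  define B' where "B' \<rho> = 2 * \<nu> * W' \<rho> / \<rho> - 2 * \<nu> * W \<rho> / \<rho>\<^sup>2" for \<rho>
  have dB: "(B has_real_derivative B' \<rho>) (at \<rho>)" if "0 < \<rho>" for \<rho>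
    unfolding B_def[abs_def]
    by (rule DERIV_cong[OF DERIV_divide[OF DERIV_cmult[OF dW] DERIV_ident]])
      (use that in \<open>simp_all add: B'_def W'_def diff_divide_distrib power2_eq_square\<close>)
  have dA: "(A has_real_derivative A' \<rho>) (at \<rho>)" if "0 < \<rho>" for \<rho>
  proof -
    have "((\<lambda>\<rho>. B \<rho> - E \<rho> * (W \<rho>)\<^sup>2 / (2 * \<tau>)) has_real_derivative A' \<rho>) (at \<rho>)"
      by (rule DERIV_cong[OF DERIV_diff[OF dB[OF that] DERIV_cdivide[OF DERIV_mult[OF dE DERIV_power[OF dW, of 2]]]]])
        (use \<tau> in \<open>simp add: A'_def B'_def add_divide_distrib power2_eq_square power3_eq_cube, simp add: field_simps\<close>)
    then show ?thesis unfolding A_def[abs_def] B_def .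
  qed
  \<comment> \<open>\<nu> \<zeta> is the logarithmic derivative of sin(\<nu> \<phi>), the first
    Dirichlet eigenfunction on (0, 2 pi a), where \<nu> \<phi> runs through (0, pi). The Riccati
    equation \<zeta>' = -\<nu> (1 + \<zeta>^2) in \<phi> encodes the eigenvalue equation.\<close>
  define \<zeta> where "\<zeta> x = cot (\<nu> * wedge_angle \<theta> x)" for x
  define \<alpha> where "\<alpha> x = (1 / (norm x)\<^sup>2) *\<^sub>R (- snd x, fst x) - (\<theta>' (norm x) / norm x) *\<^sub>R x" for x :: "real \<times> real"
  define z where "z x = (- \<nu> * (1 + (\<zeta> x)\<^sup>2)) *\<^sub>R \<alpha> x" for x
  have d\<zeta>: "(\<zeta> has_derivative (\<lambda>h. z x \<bullet> h)) (at x)" if x: "x \<in> ?S" for x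
  proof -
    have "(- snd x, fst x) \<bullet> h = fst x * snd h - snd x * fst h" for h
      by (cases h) (simp add: inner_prod_def)
    then have "(wedge_angle \<theta> has_derivative (\<lambda>h. \<alpha> x \<bullet> h)) (at x)"
      using wedge_angle_has_derivative[OF Sx(1)[OF x] deriv[OF Sx(4)[OF x]]]
      unfolding \<alpha>_def inner_diff_left inner_scaleR_left by (simp only:)
    from has_derivative_mult_right[OF this, of \<nu>]
    have d: "((\<lambda>x. \<nu> * wedge_angle \<theta> x) has_derivative (\<lambda>h. \<nu> * (\<alpha> x \<bullet> h))) (at x)" .
    have s0: "sin (\<nu> * wedge_angle \<theta> x) \<noteq> 0" using sin_gt_zero[OF Sx(2,3)[OF x]] by simp
    have "(cot has_real_derivative - inverse ((sin (\<nu> * wedge_angle \<theta> x))\<^sup>2)) (at (\<nu> * wedge_angle \<theta> x))"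
      by (rule DERIV_cot[OF s0])
    moreover have "- inverse ((sin (\<nu> * wedge_angle \<theta> x))\<^sup>2) = - (1 + (\<zeta> x)\<^sup>2)"
    proof -
      have "1 + (\<zeta> x)\<^sup>2 = ((sin (\<nu> * wedge_angle \<theta> x))\<^sup>2 + (cos (\<nu> * wedge_angle \<theta> x))\<^sup>2) / (sin (\<nu> * wedge_angle \<theta> x))\<^sup>2"
        using s0 unfolding \<zeta>_def cot_def power_divide add_divide_distrib by simp
      then show ?thesis by (simp add: divide_inverse)
    qed
    ultimately have c: "(cot has_derivative (*) (- (1 + (\<zeta> x)\<^sup>2))) (at (\<nu> * wedge_angle \<theta> x))"
      unfolding has_field_derivative_def by (rule back_subst[of "\<lambda>y. (cot has_derivative (*) y) (at (\<nu> * wedge_angle \<theta> x))"])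
    have "((\<lambda>x. cot (\<nu> * wedge_angle \<theta> x)) has_derivative (\<lambda>h. - (1 + (\<zeta> x)\<^sup>2) * (\<nu> * (\<alpha> x \<bullet> h)))) (at x)"
      by (rule has_derivative_compose[OF d c])
    then have "(\<zeta> has_derivative (\<lambda>h. - (1 + (\<zeta> x)\<^sup>2) * (\<nu> * (\<alpha> x \<bullet> h)))) (at x)"
      unfolding \<zeta>_def[abs_def] .
    then show ?thesis
      by (rule has_derivative_eq_rhs) (simp add: z_def fun_eq_iff, simp add: algebra_simps)
  qed
  have c\<zeta>: "continuous_on ?S \<zeta>"
    by (intro continuous_at_imp_continuous_on ballI has_derivative_continuous[OF d\<zeta>])
  have c\<alpha>: "continuous_on ?S \<alpha>"
  proof -
    have "continuous_on ?S (\<lambda>x. \<theta>' (norm x))"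
      by (rule continuous_on_compose2[OF cont]) (use Sx(4) in \<open>auto intro!: continuous_intros\<close>)
    then show ?thesis unfolding \<alpha>_def[abs_def] using Sx(4) by (intro continuous_intros) auto
  qed
  have cz: "continuous_on ?S z" unfolding z_def[abs_def] by (intro continuous_intros c\<zeta> c\<alpha>)
  have \<rho>0: "0 < x \<bullet> x" if "x \<in> ?S" for x using Sx(4)[OF that] by simp
  define DX where "DX x h = A (x \<bullet> x) *\<^sub>R h + (2 * A' (x \<bullet> x) * (x \<bullet> h)) *\<^sub>R x + (B (x \<bullet> x) * \<zeta> x) *\<^sub>R (- snd h, fst h)
       + (2 * B' (x \<bullet> x) * (x \<bullet> h) * \<zeta> x + B (x \<bullet> x) * (z x \<bullet> h)) *\<^sub>R (- snd x, fst x)" for x h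
  \<comment> \<open>When \<theta> is constant, b is the gradient of log (r^\<nu> sin(\<nu> \<phi>)
    (E + \<mu>)). In general the same radial and angular components are kept.\<close>
  define b where "b x = (\<nu> / (x \<bullet> x) - E (x \<bullet> x) * W (x \<bullet> x) / (2 * \<tau>)) *\<^sub>R x + (\<nu> * \<zeta> x / (x \<bullet> x)) *\<^sub>R (- snd x, fst
    x)" for x
  define dw where "dw x = ((W (x \<bullet> x))\<^sup>2 * E (x \<bullet> x) / (2 * \<tau>)) *\<^sub>R x" for x :: "real \<times> real"
  define wt where "wt x = (1 + \<nu>) * E (x \<bullet> x) * (W (x \<bullet> x))\<^sup>2 / \<tau> - (x \<bullet> x) * E (x \<bullet> x) * (W (x \<bullet> x))\<^sup>2 / (4 * \<tau>\<^sup>2)" for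
    x :: "real \<times> real"
  have field_eq: "(2 * W (x \<bullet> x)) *\<^sub>R b x + dw x = A (x \<bullet> x) *\<^sub>R x + (B (x \<bullet> x) * \<zeta> x) *\<^sub>R (- snd x, fst x)" for x
  proof -
    have "2 * W (x \<bullet> x) * (\<nu> / (x \<bullet> x) - E (x \<bullet> x) * W (x \<bullet> x) / (2 * \<tau>)) + (W (x \<bullet> x))\<^sup>2 * E (x \<bullet> x) / (2 * \<tau>) = A (x \<bullet> x)"
      using \<tau> by (simp add: A_def power2_eq_square right_diff_distrib)
    moreover have "m *\<^sub>R (p *\<^sub>R x + q *\<^sub>R y) + r *\<^sub>R x = k *\<^sub>R x + (m * q) *\<^sub>R y" if "m * p + r = k"
      for m p q r k and y :: "real \<times> real"
      unfolding that[symmetric] by (simp add: scaleR_add_right scaleR_add_left)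
    ultimately have "(2 * W (x \<bullet> x)) *\<^sub>R b x + dw x = A (x \<bullet> x) *\<^sub>R x + (2 * W (x \<bullet> x) * (\<nu> * \<zeta> x / (x \<bullet> x))) *\<^sub>R (- snd
      x, fst x)"
      unfolding b_def dw_def by blast
    then show ?thesis by (simp add: B_def mult_ac)
  qed
  have cA: "continuous_on ?S (\<lambda>x. A (x \<bullet> x))" "continuous_on ?S (\<lambda>x. B (x \<bullet> x))"
      "continuous_on ?S (\<lambda>x. A' (x \<bullet> x))" "continuous_on ?S (\<lambda>x. B' (x \<bullet> x))"
  proof -
    have S0: "(0, 0) \<notin> ?S" using \<rho>0[of "(0, 0)"] by auto
    have [continuous_intros]: "continuous_on ?S (\<lambda>x. E (x \<bullet> x))" "continuous_on ?S (\<lambda>x. W (x \<bullet> x))"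
      by (auto intro!: continuous_on_compose2[OF cE[of UNIV]] continuous_on_compose2[OF cW[of UNIV]] continuous_intros)
    show "continuous_on ?S (\<lambda>x. A (x \<bullet> x))" "continuous_on ?S (\<lambda>x. B (x \<bullet> x))"
      "continuous_on ?S (\<lambda>x. A' (x \<bullet> x))" "continuous_on ?S (\<lambda>x. B' (x \<bullet> x))"
      unfolding A_def B_def A'_def B'_def W'_def using S0 \<tau> by (auto intro!: continuous_intros)
  qed
  have cDX: "continuous_on ?S (\<lambda>x. DX x e)" for e
    unfolding DX_def by (intro continuous_intros cA c\<zeta> cz)
  have wc: "continuous_on UNIV (\<lambda>x::real \<times> real. W (x \<bullet> x))"
    by (auto intro!: continuous_on_compose2[OF cW[of UNIV]] continuous_intros)
  have Ec: "continuous_on UNIV (\<lambda>x::real \<times> real. E (x \<bullet> x))"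
    by (auto intro!: continuous_on_compose2[OF cE[of UNIV]] continuous_intros)
  have "ip (lebesgue_on ?S) (\<lambda>x. wt x * \<phi> x) \<phi> \<le> 2 * ip (lebesgue_on ?S) (\<lambda>x. W (x \<bullet> x) *\<^sub>R g x + \<phi> x *\<^sub>R dw x) g"
  proof (rule weight_test_of_vector_field[OF S t, of _ b dw DX])
    show "((\<lambda>x. (2 * W (x \<bullet> x)) *\<^sub>R b x + dw x) has_derivative DX x) (at x)" if "x \<in> ?S" for x
      unfolding field_eq DX_def[abs_def]
      by (rule radial_angular_field_has_derivative[OF dA[OF \<rho>0[OF that]] dB[OF \<rho>0[OF that]] d\<zeta>[OF that]])
    show "0 \<le> W (x \<bullet> x)" for x :: "real \<times> real" using W0 by (simp add: less_imp_le)
    show "continuous_on UNIV dw" "continuous_on UNIV wt"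
      unfolding dw_def[abs_def] wt_def[abs_def] using \<tau> by (auto intro!: continuous_intros wc Ec)
    fix x assume x: "x \<in> ?S"
    obtain x1 x2 where xx: "x = (x1, x2)" by (cases x)
    define \<rho> where "\<rho> = x \<bullet> x"
    have \<rho>: "0 < \<rho>" "x1\<^sup>2 + x2\<^sup>2 = \<rho>" using \<rho>0[OF x] by (simp_all add: \<rho>_def xx inner_prod_def power2_eq_square)
    \<comment> \<open>The \<theta>' term of \<alpha> is parallel to x, hence orthogonal to the
      turned vector; only the derivative along the circle survives.\<close>
    have zperp: "z x \<bullet> (- snd x, fst x) = - \<nu> * (1 + (\<zeta> x)\<^sup>2)"
    proof -
      have "\<alpha> x \<bullet> (- snd x, fst x) = (x1\<^sup>2 + x2\<^sup>2) / (norm x)\<^sup>2"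
        by (simp add: \<alpha>_def xx inner_diff_left inner_prod_def power2_eq_square add_divide_distrib left_diff_distrib)
      also have "\<dots> = 1" using \<rho> by (simp add: \<rho>_def power2_norm_eq_inner)
      finally show ?thesis by (simp add: z_def)
    qed
    have D: "fst (DX x (1, 0)) + snd (DX x (0, 1)) = 2 * A \<rho> + 2 * \<rho> * A' \<rho> - \<nu> * B \<rho> * (1 + (\<zeta> x)\<^sup>2)"
    proof -
      obtain z1 z2 where zz: "z x = (z1, z2)" by (cases "z x")
      have zp: "z2 * x1 - z1 * x2 = - \<nu> * (1 + (\<zeta> x)\<^sup>2)" using zperp unfolding zz by (simp add: xx inner_prod_def)
      have "fst (DX x (1, 0)) + snd (DX x (0, 1)) = 2 * A \<rho> + 2 * A' \<rho> * (x1\<^sup>2 + x2\<^sup>2) + B \<rho> * (z2 * x1 - z1 * x2)"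
        unfolding DX_def \<rho>_def[symmetric] zz by (simp add: xx inner_prod_def power2_eq_square algebra_simps)
      then show ?thesis unfolding zp \<rho>(2) by (simp add: algebra_simps)
    qed
    have N: "(norm (b x))\<^sup>2 = (\<nu> / \<rho> - E \<rho> * W \<rho> / (2 * \<tau>))\<^sup>2 * \<rho> + (\<nu> * \<zeta> x)\<^sup>2 / \<rho>"
    proof -
      have nm: "(norm (p *\<^sub>R x + q *\<^sub>R (- snd x, fst x)))\<^sup>2 = p\<^sup>2 * (x1\<^sup>2 + x2\<^sup>2) + q\<^sup>2 * (x1\<^sup>2 + x2\<^sup>2)" for p q
        unfolding norm_pair_sq by (simp add: xx power2_eq_square algebra_simps)
      show ?thesis unfolding b_def \<rho>_def[symmetric] nm \<rho>(2) using \<rho>(1) by (simp add: power2_eq_square)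
    qed
    define e w c where "e = E \<rho>" and "w = W \<rho>" and "c = \<zeta> x"
    \<comment> \<open>The terms in c^2 cancel by the Riccati equation. The remaining angular term -2
      \<nu>^2 w / \<rho> cancels the square of the radial \<nu> / r, which is the Hardy balance. The
      terms linear in \<nu> have coefficients 1, -2 and 1, the last from the exponent 1 + \<nu> in
      \<open>wt\<close>.\<close>
    have "2 * A \<rho> + 2 * \<rho> * A' \<rho> - \<nu> * B \<rho> * (1 + c\<^sup>2) + 2 * w * ((\<nu> / \<rho> - e * w / (2 * \<tau>))\<^sup>2 * \<rho> + (\<nu> * c)\<^sup>2 / \<rho>)
        + ((1 + \<nu>) * e * w\<^sup>2 / \<tau> - \<rho> * e * w\<^sup>2 / (4 * \<tau>\<^sup>2)) = 0"
      unfolding A_def A'_def B_def W'_def e_def[symmetric] w_def[symmetric] using \<rho>(1) \<tau>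
      by (simp add: field_simps power2_eq_square power3_eq_cube)
    then show "fst (DX x (1, 0)) + snd (DX x (0, 1)) + 2 * W (x \<bullet> x) * (norm (b x))\<^sup>2 + wt x \<le> 0"
      unfolding D N wt_def \<rho>_def[symmetric] e_def w_def c_def by simp
  qed (use cDX wc in auto)
  then show ?thesis unfolding wt_def dw_def \<nu>_def .
qed

subsection \<open>Smoothing and decay\<close>

text \<open>Let B be the set where f > M + k. A Vitali covering fills B up to a null set with
  disjoint balls inside an open U with |U - B| < e. Summing the ball bounds gives (M + k) |B| \<le>
  M (|B| + e) for every e > 0, so |B| = 0.\<close>

lemma AE_le_of_ball_integrals:
  fixes f :: "'a::euclidean_space \<Rightarrow> real"
  assumes f: "integrable lebesgue f" and f0: "\<And>x. 0 \<le> f x" and M: "0 \<le> M"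
    and avg: "\<And>y r. 0 < r \<Longrightarrow> (\<integral>x. indicator (ball y r) x * f x \<partial>lebesgue) \<le> M * measure lebesgue (ball y r)"
  shows "AE x in lebesgue. f x \<le> M"
proof -
  define N where "N = density lebesgue (\<lambda>x. ennreal (f x))"
  have fm: "f \<in> borel_measurable lebesgue" using f by (rule borel_measurable_integrable)
  have setsN [simp]: "sets N = sets lebesgue" by (simp add: N_def)
  have emN: "emeasure N A = (\<integral>\<^sup>+x. ennreal (f x) * indicator A x \<partial>lebesgue)" if "A \<in> sets lebesgue" for A
    unfolding N_def using fm that by (intro emeasure_density) auto
  have Nball: "emeasure N (ball y r) \<le> ennreal M * emeasure lebesgue (ball y r)" if r: "0 < r" for y r
  proof -
    have "integrable lebesgue (\<lambda>x. indicator (ball y r) x *\<^sub>R f x)" by (rule integrable_mult_indicator[OF _ f]) simp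
    then have i: "integrable lebesgue (\<lambda>x. indicator (ball y r) x * f x)" by simp
    have "emeasure N (ball y r) = (\<integral>\<^sup>+x. ennreal (indicator (ball y r) x * f x) \<partial>lebesgue)"
      by (subst emN) (auto intro!: nn_integral_cong simp: indicator_def)
    also have "\<dots> = ennreal (\<integral>x. indicator (ball y r) x * f x \<partial>lebesgue)"
      using i f0 by (intro nn_integral_eq_integral) auto
    also have "\<dots> \<le> ennreal (M * measure lebesgue (ball y r))" by (rule ennreal_leI[OF avg[OF r]])
    also have "\<dots> = ennreal M * emeasure lebesgue (ball y r)"
      using M by (simp add: ennreal_mult emeasure_eq_measure2 lmeasurable_ball)
    finally show ?thesis .
  qed
  have null: "emeasure lebesgue {x. M + k < f x} = 0" if k: "0 < k" for k
  proof -
    define B where "B = {x. M + k < f x}"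
    have Bm: "B \<in> sets lebesgue"
      using borel_measurable_less[of "\<lambda>_. M + k" lebesgue f] fm by (simp add: B_def)
    have NB: "ennreal (M + k) * emeasure lebesgue B \<le> emeasure N B"
    proof -
      have "ennreal (M + k) * emeasure lebesgue B = (\<integral>\<^sup>+x. ennreal (M + k) * indicator B x \<partial>lebesgue)"
        using Bm by (simp add: nn_integral_cmult_indicator)
      also have "\<dots> \<le> emeasure N B" unfolding emN[OF Bm]
        by (intro nn_integral_mono) (auto simp: B_def indicator_def intro!: ennreal_leI)
      finally show ?thesis .
    qed
    have "emeasure N B \<le> (\<integral>\<^sup>+x. ennreal (f x) \<partial>lebesgue)" unfolding emN[OF Bm]
      by (intro nn_integral_mono) (auto simp: indicator_def)
    also have "\<dots> < \<infinity>" using f f0 by (subst nn_integral_eq_integral) auto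
    \<comment> \<open>Finiteness of |B| comes from integrability of f and M + k > 0; it is needed to
      cancel M |B| later.\<close>
    finally have "emeasure lebesgue B \<noteq> \<infinity>"
      using NB k M by (auto simp: ennreal_mult_top top_unique)
    then have Bfin: "emeasure lebesgue B = ennreal (measure lebesgue B)" by (simp add: emeasure_eq_ennreal_measure)
    have lim: "(M + k) * measure lebesgue B \<le> M * (measure lebesgue B + e)" if e: "0 < e" for e
    proof -
      obtain U where U: "open U" "B \<subseteq> U" "U - B \<in> lmeasurable" "emeasure lebesgue (U - B) < ennreal e"
        by (rule sets_lebesgue_outer_open[OF Bm e], rule that)
      define K where "K = {p :: 'a \<times> real. 0 < snd p \<and> ball (fst p) (snd p) \<subseteq> U}"
      have cov: "\<exists>p. p \<in> K \<and> x \<in> ball (fst p) (snd p) \<and> snd p < d" if "x \<in> B" "0 < d" for x d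
      proof -
        obtain r where r: "0 < r" "ball x r \<subseteq> U" using U(1,2) \<open>x \<in> B\<close> open_contains_ball by blast
        have "ball x (min r (d / 2)) \<subseteq> U" using r(2) subset_ball[of "min r (d / 2)" r x] by auto
        then show ?thesis using r(1) \<open>0 < d\<close> by (intro exI[of _ "(x, min r (d / 2))"]) (auto simp: K_def)
      qed
      obtain C where C: "countable C" "C \<subseteq> K"
        "pairwise (\<lambda>i j. disjnt (ball (fst i) (snd i)) (ball (fst j) (snd j))) C"
        "negligible (B - (\<Union>i\<in>C. ball (fst i) (snd i)))"
        by (rule Vitali_covering_theorem_balls[of B K fst snd, OF cov], assumption, assumption, rule that)
      let ?b = "\<lambda>i. ball (fst i) (snd i)"
      have disj: "disjoint_family_on ?b C" using C(3) by (auto simp: disjoint_family_on_def pairwise_def disjnt_def)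
      define V where "V = (\<Union>i\<in>C. ?b i)"
      have Vo: "open V" unfolding V_def by blast
      have VU: "V \<subseteq> U" using C(2) by (auto simp: V_def K_def)
      have BV: "B - V \<in> null_sets lebesgue" using C(4) by (simp add: V_def negligible_iff_null_sets)
      have NV0: "emeasure N (B - V) = 0"
      proof -
        have "AE x in lebesgue. ennreal (f x) * indicator (B - V) x = 0"
          using AE_not_in[OF BV] by eventually_elim simp
        then have "(\<integral>\<^sup>+x. ennreal (f x) * indicator (B - V) x \<partial>lebesgue) = (\<integral>\<^sup>+x. 0 \<partial>(lebesgue :: 'a measure))"
          by (rule nn_integral_cong_AE)
        then show ?thesis using emN[OF null_setsD2[OF BV]] by simp
      qed
      have "emeasure N B \<le> emeasure N (V \<union> (B - V))"
        by (rule emeasure_mono) (use Bm Vo BV in \<open>auto simp: null_setsD2\<close>)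
      also have "\<dots> \<le> emeasure N V + emeasure N (B - V)"
        by (rule emeasure_subadditive) (use Vo BV in \<open>auto simp: null_setsD2\<close>)
      also have "\<dots> = emeasure N V" by (simp add: NV0)
      also have "\<dots> = (\<integral>\<^sup>+i. emeasure N (?b i) \<partial>count_space C)"
        unfolding V_def using C(1) disj by (subst emeasure_UN_countable) auto
      also have "\<dots> \<le> (\<integral>\<^sup>+i. ennreal M * emeasure lebesgue (?b i) \<partial>count_space C)"
        by (intro nn_integral_mono Nball) (use C(2) in \<open>auto simp: K_def\<close>)
      also have "\<dots> = ennreal M * (\<integral>\<^sup>+i. emeasure lebesgue (?b i) \<partial>count_space C)"
        by (intro nn_integral_cmult) auto
      also have "(\<integral>\<^sup>+i. emeasure lebesgue (?b i) \<partial>count_space C) = emeasure lebesgue V"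
        unfolding V_def using C(1) disj by (subst emeasure_UN_countable) auto
      also have "emeasure lebesgue V \<le> emeasure lebesgue (B \<union> (U - B))"
        by (rule emeasure_mono) (use VU Bm U in \<open>auto simp: fmeasurableD\<close>)
      also have "emeasure lebesgue (B \<union> (U - B)) \<le> emeasure lebesgue B + emeasure lebesgue (U - B)"
        by (rule emeasure_subadditive) (use Bm U in \<open>auto simp: fmeasurableD\<close>)
      also have "\<dots> \<le> ennreal (measure lebesgue B + e)"
        using U(4) e by (simp add: Bfin add_left_mono less_imp_le)
      finally have "emeasure N B \<le> ennreal M * ennreal (measure lebesgue B + e)"
        by (simp add: mult_left_mono)
      then have "ennreal ((M + k) * measure lebesgue B) \<le> ennreal (M * (measure lebesgue B + e))"
        using NB M k e by (simp add: Bfin ennreal_mult)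
      then show ?thesis using M e by (subst (asm) ennreal_le_iff) auto
    qed
    have *: "k * measure lebesgue B \<le> M * e" if "0 < e" for e
      using lim[OF that] by (simp add: distrib_left distrib_right)
    have "k * measure lebesgue B \<le> 0"
    proof (rule field_le_epsilon)
      fix e :: real assume "0 < e"
      then show "k * measure lebesgue B \<le> 0 + e"
        using *[of "e / (M + 1)"] M by (simp add: field_simps) (smt (verit) mult_left_mono mult_nonneg_nonneg)
    qed
    then have "measure lebesgue B = 0" using k by (simp add: mult_le_0_iff measure_le_0_iff)
    then show ?thesis using Bfin unfolding B_def by simp
  qed
  have "AE x in lebesgue. f x \<le> M + 1 / real (Suc n)" for n
  proof -
    have "{x. M + 1 / real (Suc n) < f x} \<in> null_sets lebesgue"
      using null[of "1 / real (Suc n)"] borel_measurable_less[of "\<lambda>_. M + 1 / real (Suc n)" lebesgue f] fm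
      by (intro null_setsI) auto
    from AE_not_in[OF this] show ?thesis by eventually_elim auto
  qed
  then have "AE x in lebesgue. \<forall>n. f x \<le> M + 1 / real (Suc n)" by (simp add: AE_all_countable)
  then show ?thesis
  proof eventually_elim
    case (elim x)
    have "(\<lambda>n. M + 1 / real (Suc n)) \<longlonglongrightarrow> M + 0"
      by (intro tendsto_intros LIMSEQ_inverse_real_of_nat[unfolded inverse_eq_divide])
    from LIMSEQ_le_const[OF this, of "f x"] elim show ?case by auto
  qed
qed

lemma mult_exp_minus_le: "z * exp (- z) \<le> (1::real)"
proof -
  have "z \<le> exp z" using exp_ge_add_one_self[of z] by linarith
  then show ?thesis by (simp add: exp_minus field_simps)
qed

text \<open>The weight is the heat kernel run backwards from time \<open>T + \<eta>\<close>; since \<open>u\<^sup>2\<close> is a subsolution of the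
  heat equation on the whole plane, its integral against the weight is nonincreasing.\<close>
lemma gaussian_average_bound:
  assumes S: "open S" and sol: "dirichlet_heat_solution S u0 u G"
    and \<epsilon>: "0 < \<epsilon>" "\<epsilon> \<le> T" and \<eta>: "0 < \<eta>"
  shows "(\<integral>x. 1 / \<eta> * exp (- (norm (x - y))\<^sup>2 / (4 * \<eta>)) * (u T x)\<^sup>2 \<partial>lebesgue_on S)
     \<le> sqnorm (lebesgue_on S) (u (T - \<epsilon>)) / \<epsilon>"
proof -
  let ?M = "lebesgue_on S"
  have Sm: "S \<in> sets lebesgue" using S by simp
  \<comment> \<open>\<sigma> t is the time left until T + \<eta>. The weight omits the factor 1 / (4
    pi) of the heat kernel.\<close>
  define \<sigma> where "\<sigma> t = T + \<eta> - t" for t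
  define w where "w t x = 1 / \<sigma> t * exp (- ((x - y) \<bullet> (x - y)) / (4 * \<sigma> t))" for t x
  define dw where "dw t x = (- w t x / (2 * \<sigma> t)) *\<^sub>R (x - y)" for t x
  define wt where "wt t x = w t x * (1 / \<sigma> t - ((x - y) \<bullet> (x - y)) / (4 * (\<sigma> t)\<^sup>2))" for t x
  have \<sigma>: "\<eta> \<le> \<sigma> t" "\<sigma> t \<le> \<eta> + \<epsilon>" "0 < \<sigma> t" if "t \<in> {T - \<epsilon>..T}" for t using that \<eta> by (auto simp: \<sigma>_def)
  have w0: "0 \<le> w t x" if "t \<in> {T - \<epsilon>..T}" for t x using \<sigma>(3)[OF that] by (simp add: w_def)
  have w1: "w t x \<le> 1 / \<eta>" if t: "t \<in> {T - \<epsilon>..T}" for t x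
  proof -
    have "w t x \<le> 1 / \<sigma> t * 1" unfolding w_def using \<sigma>[OF t] by (intro mult_left_mono) (auto simp: divide_nonpos_pos)
    also have "\<dots> \<le> 1 / \<eta>" using \<sigma>[OF t] \<eta> by (simp add: frac_le)
    finally show ?thesis .
  qed
  have wz: "w t x * ((x - y) \<bullet> (x - y)) \<le> 4" if t: "t \<in> {T - \<epsilon>..T}" for t x
  proof -
    have "w t x * ((x - y) \<bullet> (x - y)) = 4 * (((x - y) \<bullet> (x - y)) / (4 * \<sigma> t) * exp (- (((x - y) \<bullet> (x - y)) / (4 * \<sigma> t))))"
      using \<sigma>(3)[OF t] by (simp add: w_def)
    also have "\<dots> \<le> 4 * 1" by (intro mult_left_mono mult_exp_minus_le) auto
    finally show ?thesis by simp
  qed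
  have dsq: "((\<lambda>x. (x - y) \<bullet> (x - y)) has_derivative (\<lambda>h. 2 * ((x - y) \<bullet> h))) (at x)" for x :: "real \<times> real"
    by (auto intro!: derivative_eq_intros simp: inner_commute)
  have wd: "(w t has_derivative (\<lambda>h. dw t x \<bullet> h)) (at x)" if t: "t \<in> {T - \<epsilon>..T}" for t x
  proof -
    have alg: "- (1 / s * e) / (4 * s) * (2 * m) = - (1 / s * e) / (2 * s) * m" if "0 < s" for s e m :: real
      using that by (simp add: field_simps)
    have "((\<lambda>z. 1 / \<sigma> t * exp (- z / (4 * \<sigma> t))) has_real_derivative - (1 / \<sigma> t * exp (- ((x - y) \<bullet> (x - y)) / (4 * \<sigma>
      t))) / (4 * \<sigma> t)) (at ((x - y) \<bullet> (x - y)))"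
      using \<sigma>(3)[OF t] by (auto intro!: derivative_eq_intros simp: field_simps)
    from has_derivative_compose[OF dsq this[unfolded has_field_derivative_def]]
    show ?thesis unfolding w_def[abs_def]
      by (rule has_derivative_eq_rhs) (simp only: dw_def w_def inner_scaleR_left alg[OF \<sigma>(3)[OF t]])
  qed
  have wc: "continuous_on UNIV (w t)" if "t \<in> {T - \<epsilon>..T}" for t
    unfolding w_def[abs_def] using \<sigma>(3)[OF that] by (auto intro!: continuous_intros)
  have dwc: "continuous_on UNIV (dw t)" if "t \<in> {T - \<epsilon>..T}" for t
    unfolding dw_def[abs_def] using \<sigma>(3)[OF that] by (auto intro!: continuous_intros wc[OF that])
  have wtc: "continuous_on UNIV (wt t)" if "t \<in> {T - \<epsilon>..T}" for t
    unfolding wt_def[abs_def] using \<sigma>(3)[OF that] by (auto intro!: continuous_intros wc[OF that])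
  have wtd: "((\<lambda>s. w s x) has_real_derivative wt t x) (at t within {T - \<epsilon>..T})" if t: "t \<in> {T - \<epsilon>..T}" for t x
  proof -
    define q where "q = (x - y) \<bullet> (x - y)"
    have "((\<lambda>z. 1 / z * exp (- q / (4 * z))) has_real_derivative
        (1 / \<sigma> t * exp (- q / (4 * \<sigma> t))) * (q / (4 * (\<sigma> t)\<^sup>2) - 1 / \<sigma> t)) (at (\<sigma> t))"
      using \<sigma>(3)[OF t] by (auto intro!: derivative_eq_intros simp: field_simps power2_eq_square)
    moreover have "(\<sigma> has_real_derivative - 1) (at t within {T - \<epsilon>..T})"
      unfolding \<sigma>_def[abs_def] by (auto intro!: derivative_eq_intros)
    ultimately have "((\<lambda>s. 1 / \<sigma> s * exp (- q / (4 * \<sigma> s))) has_real_derivative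
        (1 / \<sigma> t * exp (- q / (4 * \<sigma> t))) * (q / (4 * (\<sigma> t)\<^sup>2) - 1 / \<sigma> t) * - 1) (at t within {T - \<epsilon>..T})"
      by (rule DERIV_chain2)
    then show ?thesis unfolding w_def wt_def q_def[symmetric] by (rule DERIV_cong) (simp add: algebra_simps)
  qed
  define C where "C = 1 / \<eta> + (1 / \<eta> + 4) / (2 * \<eta>) + (1 / \<eta>\<^sup>2 + 1 / \<eta>\<^sup>2)"
  have p: "0 \<le> 1 / \<eta>" "0 \<le> (1 / \<eta> + 4) / (2 * \<eta>)" "0 \<le> 1 / \<eta>\<^sup>2 + 1 / \<eta>\<^sup>2" using \<eta> by auto
  have wb: "\<bar>w t x\<bar> \<le> C" if "t \<in> {T - \<epsilon>..T}" for t x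
    using w0[OF that, of x] w1[OF that, of x] p unfolding C_def by linarith
  have dwb: "norm (dw t x) \<le> C" if t: "t \<in> {T - \<epsilon>..T}" for t x
  proof -
    have n: "norm (x - y) \<le> 1 + (x - y) \<bullet> (x - y)"
      using sum_squares_bound[of 1 "norm (x - y)"] norm_ge_zero[of "x - y"]
      unfolding power2_norm_eq_inner power_one by linarith
    have "w t x * norm (x - y) \<le> w t x * (1 + (x - y) \<bullet> (x - y))" by (rule mult_left_mono[OF n w0[OF t]])
    also have "\<dots> \<le> 1 / \<eta> + 4" using w1[OF t, of x] wz[OF t, of x] by (simp add: distrib_left)
    finally have m: "w t x * norm (x - y) \<le> 1 / \<eta> + 4" .
    have "norm (dw t x) = w t x * norm (x - y) / (2 * \<sigma> t)"
      using \<sigma>(3)[OF t] w0[OF t, of x] by (simp add: dw_def)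
    also have "\<dots> \<le> (1 / \<eta> + 4) / (2 * \<eta>)"
      using m \<sigma>[OF t] \<eta> w0[OF t, of x] by (intro frac_le) auto
    finally show ?thesis using p unfolding C_def by linarith
  qed
  have wtb: "\<bar>wt t x\<bar> \<le> C" if t: "t \<in> {T - \<epsilon>..T}" for t x
  proof -
    let ?q = "(x - y) \<bullet> (x - y)"
    have sq: "\<eta>\<^sup>2 \<le> (\<sigma> t)\<^sup>2" using \<sigma>[OF t] \<eta> by (intro power_mono) auto
    have 1: "0 \<le> w t x / \<sigma> t" "w t x / \<sigma> t \<le> 1 / \<eta>\<^sup>2"
    proof -
      show "0 \<le> w t x / \<sigma> t" using w0[OF t] \<sigma>(3)[OF t] by simp
      have "w t x / \<sigma> t \<le> (1 / \<eta>) / \<eta>" using w1[OF t] w0[OF t] \<sigma>[OF t] \<eta> by (intro frac_le) auto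
      then show "w t x / \<sigma> t \<le> 1 / \<eta>\<^sup>2" by (simp add: power2_eq_square)
    qed
    have 2: "0 \<le> w t x * ?q / (4 * (\<sigma> t)\<^sup>2)" "w t x * ?q / (4 * (\<sigma> t)\<^sup>2) \<le> 1 / \<eta>\<^sup>2"
    proof -
      show "0 \<le> w t x * ?q / (4 * (\<sigma> t)\<^sup>2)" using w0[OF t] by simp
      have "w t x * ?q / (4 * (\<sigma> t)\<^sup>2) \<le> 4 / (4 * \<eta>\<^sup>2)"
        using wz[OF t] w0[OF t] sq \<eta> by (intro frac_le) auto
      then show "w t x * ?q / (4 * (\<sigma> t)\<^sup>2) \<le> 1 / \<eta>\<^sup>2" by simp
    qed
    have "wt t x = w t x / \<sigma> t - w t x * ?q / (4 * (\<sigma> t)\<^sup>2)" by (simp add: wt_def right_diff_distrib)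
    then show ?thesis using 1 2 p unfolding C_def by linarith
  qed
  have test: "ip ?M (\<lambda>x. wt t x * \<phi> x) \<phi> \<le> 2 * ip ?M (\<lambda>x. w t x *\<^sub>R g x + \<phi> x *\<^sub>R dw t x) g"
    if t: "t \<in> {T - \<epsilon>..T}" and tf: "test_fun S \<phi> g" for t \<phi> g
  proof -
    define DX where "DX x h = (- w t x / (2 * \<sigma> t)) *\<^sub>R h + (- (dw t x \<bullet> h) / (2 * \<sigma> t)) *\<^sub>R (x - y)" for x h
    show ?thesis
    \<comment> \<open>With b = 0 the divergence condition is the backward heat equation for w, which
      holds with equality.\<close>
    proof (rule weight_test_of_vector_field[OF S tf, of _ "\<lambda>_. 0" "dw t" DX])
      show "((\<lambda>x. (2 * w t x) *\<^sub>R 0 + dw t x) has_derivative DX x) (at x)" for x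
      proof -
        have d: "((\<lambda>x. - w t x / (2 * \<sigma> t)) has_derivative (\<lambda>h. - (dw t x \<bullet> h) / (2 * \<sigma> t))) (at x)"
          unfolding divide_inverse by (intro has_derivative_mult_left has_derivative_minus wd[OF t])
        have "((\<lambda>x. x - y) has_derivative (\<lambda>h. h)) (at x)" by (auto intro!: derivative_eq_intros)
        from has_derivative_scaleR[OF d this] show ?thesis
          unfolding dw_def[abs_def] DX_def[abs_def] by simp
      qed
      show "continuous_on S (\<lambda>x. DX x (1, 0))" "continuous_on S (\<lambda>x. DX x (0, 1))"
        unfolding DX_def using \<sigma>(3)[OF t]
        by (auto intro!: continuous_intros continuous_on_subset[OF wc[OF t]] continuous_on_subset[OF dwc[OF t]])
      show "continuous_on UNIV (w t)" "continuous_on UNIV (dw t)" "continuous_on UNIV (wt t)" "0 \<le> w t x" for x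
        by (rule wc[OF t] dwc[OF t] wtc[OF t] w0[OF t])+
      fix x
      obtain z1 z2 where z: "x - y = (z1, z2)" by (cases "x - y")
      show "fst (DX x (1, 0)) + snd (DX x (0, 1)) + 2 * w t x * (norm (0 :: real \<times> real))\<^sup>2 + wt t x \<le> 0"
        unfolding DX_def dw_def wt_def z using \<sigma>(3)[OF t]
        by (simp add: inner_prod_def field_simps power2_eq_square)
    qed
  qed
  have mono: "ip ?M (\<lambda>x. w T x * u T x) (u T) \<le> ip ?M (\<lambda>x. w (T - \<epsilon>) x * u (T - \<epsilon>) x) (u (T - \<epsilon>))"
    by (rule weighted_energy_nonincreasing[OF Sm sol, of "T - \<epsilon>" T w dw wt C])
      (use \<epsilon> wd dwc wtd wtc wb dwb wtb test in auto)
  have a: "T - \<epsilon> \<in> {T - \<epsilon>..T}" using \<epsilon> by simp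
  have ul: "l2 ?M (u (T - \<epsilon>))" using \<epsilon> by (intro solution_l2[OF Sm sol]) simp
  have wl: "l2 ?M (\<lambda>x. w (T - \<epsilon>) x * u (T - \<epsilon>) x)"
    using l2_scaleR_bounded[OF ul continuous_measurable_lebesgue_on[OF wc[OF a]] wb[OF a]] by simp
  \<comment> \<open>At the initial time the weight is at most 1 / (\<eta> + \<epsilon>), hence at
    most 1 / \<epsilon> uniformly in the concentration parameter \<eta>.\<close>
  have "ip ?M (\<lambda>x. w (T - \<epsilon>) x * u (T - \<epsilon>) x) (u (T - \<epsilon>)) \<le> (\<integral>x. 1 / \<epsilon> * (u (T - \<epsilon>) x \<bullet> u (T - \<epsilon>) x) \<partial>?M)"
    unfolding ip_def
  proof (rule integral_mono)
    show "integrable ?M (\<lambda>x. (w (T - \<epsilon>) x * u (T - \<epsilon>) x) \<bullet> u (T - \<epsilon>) x)" by (rule l2_integrable_inner[OF wl ul])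
    show "integrable ?M (\<lambda>x. 1 / \<epsilon> * (u (T - \<epsilon>) x \<bullet> u (T - \<epsilon>) x))"
      by (intro integrable_mult_right l2_integrable_inner[OF ul ul])
    fix x
    have "w (T - \<epsilon>) x \<le> 1 / \<sigma> (T - \<epsilon>) * 1"
      unfolding w_def using \<sigma>[OF a] by (intro mult_left_mono) (auto simp: divide_nonpos_pos)
    also have "\<dots> \<le> 1 / \<epsilon>" using \<epsilon> \<eta> by (simp add: \<sigma>_def frac_le)
    finally have "w (T - \<epsilon>) x * (u (T - \<epsilon>) x * u (T - \<epsilon>) x) \<le> 1 / \<epsilon> * (u (T - \<epsilon>) x * u (T - \<epsilon>) x)"
      by (intro mult_right_mono) auto
    then show "(w (T - \<epsilon>) x * u (T - \<epsilon>) x) \<bullet> u (T - \<epsilon>) x \<le> 1 / \<epsilon> * (u (T - \<epsilon>) x \<bullet> u (T - \<epsilon>) x)"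
      by (simp add: mult.assoc)
  qed
  also have "\<dots> = sqnorm ?M (u (T - \<epsilon>)) / \<epsilon>" by (simp add: ip_def)
  finally have "ip ?M (\<lambda>x. w T x * u T x) (u T) \<le> sqnorm ?M (u (T - \<epsilon>)) / \<epsilon>" using mono by linarith
  moreover have "ip ?M (\<lambda>x. w T x * u T x) (u T) = (\<integral>x. 1 / \<eta> * exp (- (norm (x - y))\<^sup>2 / (4 * \<eta>)) * (u T x)\<^sup>2 \<partial>?M)"
    by (simp add: ip_def w_def \<sigma>_def power2_norm_eq_inner power2_eq_square[of "u T x" for x] mult.assoc)
  ultimately show ?thesis by simp
qed

text \<open>On a ball of radius r the Gaussian weight with \<eta> = r^2 is at least exp(-1/4) / r^2,
  and r^2 is the area of the ball divided by pi. This turns \<open>gaussian_average_bound\<close>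
  into a bound on ball averages of u^2, and supplies the constant.\<close>

lemma L2_Linfty_smoothing:
  assumes S: "open S" and sol: "dirichlet_heat_solution S u0 u G" and \<epsilon>: "0 < \<epsilon>" "\<epsilon> \<le> T"
  shows "AE x in lebesgue_on S. (u T x)\<^sup>2 \<le> exp (1 / 4) / (pi * \<epsilon>) * sqnorm (lebesgue_on S) (u (T - \<epsilon>))"
proof -
  let ?M = "lebesgue_on S"
  define I where "I = sqnorm ?M (u (T - \<epsilon>))"
  have I0: "0 \<le> I" unfolding I_def by (rule ip_self_nonneg)
  have Sm: "S \<in> sets lebesgue" using S by simp
  have ul: "l2 ?M (u T)" using \<epsilon> by (intro solution_l2[OF Sm sol]) simp
  define f where "f x = indicator S x * (u T x)\<^sup>2" for x
  have "integrable ?M (\<lambda>x. (u T x)\<^sup>2)" using ul by (simp add: l2_def)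
  then have fi: "integrable lebesgue f"
    unfolding f_def[abs_def] by (subst (asm) integrable_restrict_space) (use Sm in auto)
  have avg: "(\<integral>x. indicator (ball y r) x * f x \<partial>lebesgue) \<le> exp (1 / 4) / (pi * \<epsilon>) * I * measure lebesgue (ball y r)"
    if r: "0 < r" for y r
  proof -
    let ?w = "\<lambda>x. 1 / r\<^sup>2 * exp (- (norm (x - y))\<^sup>2 / (4 * r\<^sup>2))"
    have wl: "l2 ?M (\<lambda>x. ?w x *\<^sub>R u T x)"
    proof (rule l2_scaleR_bounded[OF ul])
      show "?w \<in> borel_measurable ?M" using r
        by (intro continuous_measurable_lebesgue_on continuous_intros) auto
      show "\<bar>?w x\<bar> \<le> 1 / r\<^sup>2" for x
        using r by (simp add: abs_mult divide_right_mono)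
    qed
    have wi: "integrable ?M (\<lambda>x. ?w x * (u T x)\<^sup>2)"
      using l2_integrable_inner[OF wl ul] by (simp add: power2_eq_square mult.assoc)
    have "(\<integral>x. indicator (ball y r) x * f x \<partial>lebesgue) = (\<integral>x. indicator (ball y r) x * (u T x)\<^sup>2 \<partial>?M)"
      using Sm by (subst integral_restrict_space) (auto simp: f_def mult_ac)
    also have "\<dots> \<le> (\<integral>x. (exp (1 / 4) * r\<^sup>2) * (?w x * (u T x)\<^sup>2) \<partial>?M)"
    proof (rule integral_mono')
      show "integrable ?M (\<lambda>x. (exp (1 / 4) * r\<^sup>2) * (?w x * (u T x)\<^sup>2))" by (rule integrable_mult_right[OF wi])
      fix x
      show "0 \<le> (exp (1 / 4) * r\<^sup>2) * (?w x * (u T x)\<^sup>2)" by simp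
      have "indicator (ball y r) x \<le> exp (1 / 4) * r\<^sup>2 * ?w x"
      proof (cases "x \<in> ball y r")
        case True
        then have "(norm (x - y))\<^sup>2 \<le> r\<^sup>2" by (intro power_mono) (auto simp: dist_norm norm_minus_commute)
        then have "0 \<le> 1 / 4 + - (norm (x - y))\<^sup>2 / (4 * r\<^sup>2)" using r by (simp add: field_simps)
        then have "1 \<le> exp (1 / 4) * exp (- (norm (x - y))\<^sup>2 / (4 * r\<^sup>2))" by (simp only: exp_add[symmetric] one_le_exp_iff)
        then show ?thesis using True r by simp
      qed simp
      then have "indicator (ball y r) x * (u T x)\<^sup>2 \<le> exp (1 / 4) * r\<^sup>2 * ?w x * (u T x)\<^sup>2" by (rule mult_right_mono) simp
      then show "indicator (ball y r) x * (u T x)\<^sup>2 \<le> (exp (1 / 4) * r\<^sup>2) * (?w x * (u T x)\<^sup>2)" by (simp only: mult.assoc)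
    qed
    also have "\<dots> = exp (1 / 4) * r\<^sup>2 * (\<integral>x. ?w x * (u T x)\<^sup>2 \<partial>?M)" by (rule integral_mult_right_zero)
    also have "\<dots> \<le> exp (1 / 4) * r\<^sup>2 * (I / \<epsilon>)"
      using gaussian_average_bound[OF S sol \<epsilon>, of "r\<^sup>2" y] r unfolding I_def by (intro mult_left_mono) auto
    also have "\<dots> = exp (1 / 4) / (pi * \<epsilon>) * I * measure lebesgue (ball y r)"
      using r content_ball[of r y] by (simp add: unit_ball_vol_2 field_simps power2_eq_square)
    finally show ?thesis .
  qed
  have "AE x in lebesgue. f x \<le> exp (1 / 4) / (pi * \<epsilon>) * I"
    by (rule AE_le_of_ball_integrals[OF fi _ _ avg]) (use I0 \<epsilon> in \<open>auto simp: f_def\<close>)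
  then show ?thesis unfolding I_def[symmetric]
    using Sm by (subst AE_restrict_space_iff) (auto simp: f_def elim!: eventually_mono)
qed

text \<open>The weight of \<open>wedge_weight_test\<close> is used with \<tau> = 1 + t and \<kappa>
  = k t. At time 0 it is at most exp(|x|^2 / 4), the weight in \<open>L2w_norm\<close>; at time T it
  is at least 1 / (k T + \<mu>), because E is at most k T. The bounds on the weight depend on \<mu>,
  so \<mu> tends to 0 only after the two energies have been compared.\<close>

lemma wedge_energy_decay:
  fixes \<theta> \<theta>' :: "real \<Rightarrow> real"
  assumes a: "0 < a" "a \<le> 1"
    and deriv: "\<And>r. 0 < r \<Longrightarrow> (\<theta> has_real_derivative \<theta>' r) (at r)"
    and cont: "continuous_on {0<..} \<theta>'"
    and u0: "in_L2w (curved_wedge a \<theta>) u0"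
    and sol: "dirichlet_heat_solution (curved_wedge a \<theta>) u0 u G" and T: "0 \<le> T"
  shows "sqnorm (lebesgue_on (curved_wedge a \<theta>)) (u T) \<le>
    (1 + T) powr (- (1 + 1 / (2 * a))) * (L2w_norm (curved_wedge a \<theta>) u0)\<^sup>2"
proof -
  define S where "S = curved_wedge a \<theta>"
  let ?M = "lebesgue_on S"
  define p where "p = 1 + 1 / (2 * a)"
  have p0: "1 < p" using a by (simp add: p_def)
  have "continuous_on {0<..} \<theta>"
    using deriv by (intro continuous_at_imp_continuous_on) (auto intro: DERIV_isCont)
  then have So: "open S" unfolding S_def by (rule open_curved_wedge[OF a])
  have Sm: "S \<in> sets lebesgue" using So by simp
  note sol' = sol[folded S_def]
  define A where "A = (\<integral>x. (u0 x)\<^sup>2 * exp ((norm x)\<^sup>2 / 4) \<partial>?M)"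
  have Ai: "integrable ?M (\<lambda>x. (u0 x)\<^sup>2 * exp ((norm x)\<^sup>2 / 4))" using u0 by (simp add: in_L2w_def S_def)
  have A0: "0 \<le> A" unfolding A_def by (intro integral_nonneg_AE) auto
  have nA: "(L2w_norm S u0)\<^sup>2 = A" using A0 by (simp add: L2w_norm_def A_def)
  have uT: "l2 ?M (u T)" by (rule solution_l2[OF Sm sol' T])
  define k where "k t = (1 + t) powr (- p)" for t :: real
  have bound: "sqnorm ?M (u T) \<le> (k T + \<mu>) * A" if \<mu>: "0 < \<mu>" for \<mu>
  proof -
    define E where "E t \<rho> = k t * exp (- \<rho> / (4 * (1 + t)))" for t \<rho>
    define W where "W t \<rho> = 1 / (E t \<rho> + \<mu>)" for t \<rho>
    define w where "w t x = W t (x \<bullet> x)" for t and x :: "real \<times> real"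
    define dw where "dw t x = ((W t (x \<bullet> x))\<^sup>2 * E t (x \<bullet> x) / (2 * (1 + t))) *\<^sub>R x" for t and x :: "real \<times> real"
    define wt where "wt t x = p * E t (x \<bullet> x) * (W t (x \<bullet> x))\<^sup>2 / (1 + t) - (x \<bullet> x) * E t (x \<bullet> x) * (W t (x \<bullet> x))\<^sup>2 / (4
      * (1 + t)\<^sup>2)"
      for t and x :: "real \<times> real"
    have k0: "0 < k t" "k t \<le> 1" if "0 \<le> t" for t
    proof -
      show "0 < k t" using that by (simp add: k_def)
      have "(1 + t) powr (- p) \<le> (1 + t) powr 0" using that p0 by (intro powr_mono) auto
      then show "k t \<le> 1" using that by (simp add: k_def)
    qed
    have E0: "0 < E t \<rho>" if "0 \<le> t" for t \<rho> using k0[OF that] by (simp add: E_def)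
    have E1: "E t \<rho> \<le> 1" if "0 \<le> t" "0 \<le> \<rho>" for t \<rho>
      unfolding E_def using k0[OF that(1)] that by (intro mult_le_one) (auto simp: divide_nonpos_pos)
    \<comment> \<open>z exp(-z) \<le> 1 absorbs the factors |x|^2 that differentiation of E
      produces.\<close>
    have Ez: "E t \<rho> * \<rho> / (4 * (1 + t)) \<le> 1" if "0 \<le> t" "0 \<le> \<rho>" for t \<rho>
    proof -
      define z where "z = \<rho> / (4 * (1 + t))"
      have "0 \<le> z * exp (- z)" using that by (simp add: z_def)
      then have "k t * (z * exp (- z)) \<le> 1 * 1" using k0[OF that(1)] mult_exp_minus_le[of z] by (intro mult_mono[of "k
        t" 1 "z * exp (- z)" 1]) auto
      then show ?thesis by (simp add: E_def z_def mult_ac)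
    qed
    have W0: "0 < W t \<rho>" "W t \<rho> \<le> 1 / \<mu>" if "0 \<le> t" for t \<rho>
      using E0[OF that, of \<rho>] \<mu> by (auto simp: W_def frac_le)
    have W2: "(W t \<rho>)\<^sup>2 \<le> 1 / \<mu>\<^sup>2" if "0 \<le> t" for t \<rho>
      using power_mono[OF W0(2)[OF that, of \<rho>], of 2] W0(1)[OF that, of \<rho>] by (simp add: power_divide)
    \<comment> \<open>The three summands bound w, its time derivative and its gradient, in this
      order.\<close>
    define C where "C = 1 / \<mu> + (p / \<mu>\<^sup>2 + 1 / \<mu>\<^sup>2) + 3 / \<mu>\<^sup>2"
    have q: "0 \<le> 1 / \<mu>" "0 \<le> p / \<mu>\<^sup>2" "0 \<le> 1 / \<mu>\<^sup>2" "0 \<le> 3 / \<mu>\<^sup>2" using \<mu> p0 by auto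
    have Ec: "continuous_on UNIV (\<lambda>x::real \<times> real. E t (x \<bullet> x))" if "0 \<le> t" for t
      unfolding E_def using that by (auto intro!: continuous_intros)
    have wc: "continuous_on UNIV (\<lambda>x::real \<times> real. W t (x \<bullet> x))" if "0 \<le> t" for t
    proof -
      have "E t (x \<bullet> x) + \<mu> \<noteq> 0" for x :: "real \<times> real" using E0[OF that, of "x \<bullet> x"] \<mu> by linarith
      then show ?thesis unfolding W_def by (intro continuous_intros Ec[OF that]) auto
    qed
    have wd: "(w t has_derivative (\<lambda>h. dw t x \<bullet> h)) (at x)" if t: "t \<in> {0..T}" for t x
    proof -
      have t0: "0 \<le> t" using t by simp
      have nz: "E t \<rho> + \<mu> \<noteq> 0" for \<rho> using E0[OF t0, of \<rho>] \<mu> by linarith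
      have "((\<lambda>\<rho>. K * exp (- \<rho> / m)) has_real_derivative - (K * exp (- \<rho> / m)) / m) (at \<rho>)" if "0 < m" for K m \<rho> :: real
        using that by (auto intro!: derivative_eq_intros)
      from this[of "4 * (1 + t)" "k t"] have "(E t has_real_derivative - E t \<rho> / (4 * (1 + t))) (at \<rho>)" for \<rho>
        unfolding E_def[abs_def] using t0 by simp
      then have "((\<lambda>\<rho>. 1 / (E t \<rho> + \<mu>)) has_real_derivative
          (0 * (E t \<rho> + \<mu>) - 1 * (- E t \<rho> / (4 * (1 + t)) + 0)) / ((E t \<rho> + \<mu>) * (E t \<rho> + \<mu>))) (at \<rho>)" for \<rho>
        by (intro DERIV_divide DERIV_add DERIV_const nz)
      then have dW: "(W t has_real_derivative (W t \<rho>)\<^sup>2 * E t \<rho> / (4 * (1 + t))) (at \<rho>)" for \<rho>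
        unfolding W_def[abs_def] by (rule DERIV_cong) (simp add: power2_eq_square)
      have dq: "((\<lambda>x. x \<bullet> x) has_derivative (\<lambda>h. 2 * (x \<bullet> h))) (at x)"
        by (auto intro!: derivative_eq_intros simp: inner_commute)
      have "((\<lambda>x. W t (x \<bullet> x)) has_derivative (\<lambda>h. (W t (x \<bullet> x))\<^sup>2 * E t (x \<bullet> x) / (4 * (1 + t)) * (2 * (x \<bullet> h)))) (at x)"
        by (rule has_derivative_compose[OF dq dW[unfolded has_field_derivative_def]])
      then show ?thesis unfolding w_def[abs_def]
        by (rule has_derivative_eq_rhs) (use t0 in \<open>simp add: dw_def fun_eq_iff field_simps\<close>)
    qed
    have wtd: "((\<lambda>s. w s x) has_real_derivative wt t x) (at t within {0..T})" if t: "t \<in> {0..T}" for t x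
    proof -
      have t0: "0 \<le> t" using t by simp
      define \<rho> where "\<rho> = x \<bullet> x"
      have nz: "E t \<rho> + \<mu> \<noteq> 0" using E0[OF t0, of \<rho>] \<mu> by linarith
      have dk: "(k has_real_derivative - p * k t / (1 + t)) (at t)"
        unfolding k_def[abs_def] using t0
        by (auto intro!: derivative_eq_intros simp: powr_diff field_simps)
      have dz: "((\<lambda>z. exp (- \<rho> / (4 * z))) has_real_derivative exp (- \<rho> / (4 * z)) * (\<rho> / (4 * z\<^sup>2))) (at z)" if "0 < z"
        for z
        using that by (auto intro!: derivative_eq_intros simp: field_simps power2_eq_square)
      have "((\<lambda>z. exp (- \<rho> / (4 * z))) has_real_derivative exp (- \<rho> / (4 * (1 + t))) * (\<rho> / (4 * (1 + t)\<^sup>2))) (at (1 + t))"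
        by (rule dz) (use t0 in simp)
      moreover have "((\<lambda>s. 1 + s) has_real_derivative 1) (at t)" by (auto intro!: derivative_eq_intros)
      ultimately have "((\<lambda>s. exp (- \<rho> / (4 * (1 + s)))) has_real_derivative exp (- \<rho> / (4 * (1 + t))) * (\<rho> / (4 * (1 +
        t)\<^sup>2)) * 1) (at t)"
        by (rule DERIV_chain2)
      then have de: "((\<lambda>s. exp (- \<rho> / (4 * (1 + s)))) has_real_derivative exp (- \<rho> / (4 * (1 + t))) * (\<rho> / (4 * (1 +
        t)\<^sup>2))) (at t)"
        by simp
      define D where "D = - p * E t \<rho> / (1 + t) + \<rho> * E t \<rho> / (4 * (1 + t)\<^sup>2)"
      have dE: "((\<lambda>s. E s \<rho>) has_real_derivative D) (at t)"
        unfolding E_def by (rule DERIV_cong[OF DERIV_mult[OF dk de]]) (simp add: D_def E_def mult_ac)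
      have "((\<lambda>s. 1 / (E s \<rho> + \<mu>)) has_real_derivative (0 * (E t \<rho> + \<mu>) - 1 * (D + 0)) / ((E t \<rho> + \<mu>) * (E t \<rho> + \<mu>))) (at t)"
        by (intro DERIV_divide DERIV_add DERIV_const nz dE)
      then have "((\<lambda>s. W s \<rho>) has_real_derivative wt t x) (at t)"
        unfolding W_def
        by (rule DERIV_cong) (simp add: wt_def W_def \<rho>_def[symmetric] D_def power2_eq_square diff_divide_distrib, simp
          add: mult_ac)
      then show ?thesis unfolding w_def \<rho>_def by (rule has_field_derivative_at_within)
    qed
    have wb: "\<bar>w t x\<bar> \<le> C" if t: "t \<in> {0..T}" for t x
    proof -
      have "0 < W t (x \<bullet> x)" "W t (x \<bullet> x) \<le> 1 / \<mu>" using W0[of t "x \<bullet> x"] t by auto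
      then show ?thesis using q unfolding C_def w_def by linarith
    qed
    have dwb: "norm (dw t x) \<le> C" if t: "t \<in> {0..T}" for t x
    proof -
      have t0: "0 \<le> t" using t by simp
      let ?E = "E t (x \<bullet> x)"
      \<comment> \<open>The gradient of E grows linearly in |x|; this reduces it to
        \<open>E1\<close> and \<open>Ez\<close>, whence the constant 3 = 1 + 2.\<close>
      have n: "norm x \<le> 1 + x \<bullet> x"
        using sum_squares_bound[of 1 "norm x"] norm_ge_zero[of x]
        unfolding power2_norm_eq_inner power_one by linarith
      have "?E * norm x / (2 * (1 + t)) \<le> ?E * (1 + x \<bullet> x) / (2 * (1 + t))"
        using n E0[OF t0, of "x \<bullet> x"] t0 by (intro divide_right_mono mult_left_mono) auto
      also have "\<dots> = ?E / (2 * (1 + t)) + 2 * (?E * (x \<bullet> x) / (4 * (1 + t)))"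
      proof -
        have alg: "e * (1 + q) / (2 * m) = e / (2 * m) + 2 * (e * q / (4 * m))" if "0 < m" for e q m :: real
          using that by (simp add: field_simps)
        show ?thesis by (rule alg) (use t0 in simp)
      qed
      also have "\<dots> \<le> 1 + 2 * 1"
      proof (intro add_mono mult_left_mono Ez[OF t0])
        have "?E / (2 * (1 + t)) \<le> 1 / 1" using E1[OF t0, of "x \<bullet> x"] E0[OF t0, of "x \<bullet> x"] t0 by (intro frac_le) auto
        then show "?E / (2 * (1 + t)) \<le> 1" by simp
      qed auto
      finally have e: "?E * norm x / (2 * (1 + t)) \<le> 3" by simp
      have "norm (dw t x) = (W t (x \<bullet> x))\<^sup>2 * (?E * norm x / (2 * (1 + t)))"
        using t0 E0[OF t0, of "x \<bullet> x"] by (simp add: dw_def abs_mult)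
      also have "\<dots> \<le> 1 / \<mu>\<^sup>2 * 3" using e W2[OF t0, of "x \<bullet> x"] E0[OF t0, of "x \<bullet> x"] t0 by (intro mult_mono) auto
      finally show ?thesis using q unfolding C_def by linarith
    qed
    have wtb: "\<bar>wt t x\<bar> \<le> C" if t: "t \<in> {0..T}" for t x
    proof -
      have t0: "0 \<le> t" using t by simp
      let ?E = "E t (x \<bullet> x)" and ?V = "(W t (x \<bullet> x))\<^sup>2"
      have e: "0 \<le> ?E / (1 + t)" "?E / (1 + t) \<le> 1"
        using E0[OF t0, of "x \<bullet> x"] E1[OF t0, of "x \<bullet> x"] t0 by (auto simp: pos_divide_le_eq)
      have v: "0 \<le> ?V" "?V \<le> 1 / \<mu>\<^sup>2" using W2[OF t0, of "x \<bullet> x"] by auto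
      have 1: "0 \<le> p * (?E / (1 + t) * ?V)" "p * (?E / (1 + t) * ?V) \<le> p * (1 * (1 / \<mu>\<^sup>2))"
        by (intro mult_nonneg_nonneg mult_left_mono mult_mono e v; use p0 in linarith)+
      have z: "0 \<le> ?E * (x \<bullet> x) / (4 * (1 + t)) / (1 + t)" "?E * (x \<bullet> x) / (4 * (1 + t)) / (1 + t) \<le> 1"
      proof -
        have y: "0 \<le> ?E * (x \<bullet> x) / (4 * (1 + t))" using E0[OF t0, of "x \<bullet> x"] t0 by simp
        then show "0 \<le> ?E * (x \<bullet> x) / (4 * (1 + t)) / (1 + t)" by (rule divide_nonneg_nonneg) (use t0 in simp)
        have "?E * (x \<bullet> x) / (4 * (1 + t)) / (1 + t) \<le> 1 / 1"
          by (rule frac_le[OF _ Ez[OF t0]]) (use t0 in auto)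
        then show "?E * (x \<bullet> x) / (4 * (1 + t)) / (1 + t) \<le> 1" by simp
      qed
      have 2: "0 \<le> ?E * (x \<bullet> x) / (4 * (1 + t)) / (1 + t) * ?V" "?E * (x \<bullet> x) / (4 * (1 + t)) / (1 + t) * ?V \<le> 1 * (1 / \<mu>\<^sup>2)"
        by (intro mult_nonneg_nonneg mult_mono z v; linarith)+
      have "wt t x = p * (?E / (1 + t) * ?V) - ?E * (x \<bullet> x) / (4 * (1 + t)) / (1 + t) * ?V"
        by (simp add: wt_def power2_eq_square[of "1 + t"] mult_ac)
      moreover have "p * (1 * (1 / \<mu>\<^sup>2)) = p / \<mu>\<^sup>2" by simp
      ultimately show ?thesis using 1 2 q unfolding C_def by linarith
    qed
    have test: "ip ?M (\<lambda>x. wt t x * \<phi> x) \<phi> \<le> 2 * ip ?M (\<lambda>x. w t x *\<^sub>R g x + \<phi> x *\<^sub>R dw t x) g"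
      if t: "t \<in> {0..T}" and tf: "test_fun S \<phi> g" for t \<phi> g
      using wedge_weight_test[OF a deriv cont _ \<mu> _ tf[unfolded S_def], of "1 + t" "k t"] t k0(1)[of t]
      unfolding wt_def w_def dw_def W_def E_def S_def p_def by simp
    have dwc: "continuous_on UNIV (dw t)" and wtc: "continuous_on UNIV (wt t)" if t: "t \<in> {0..T}" for t
      unfolding dw_def[abs_def] wt_def[abs_def] using t by (auto intro!: continuous_intros wc Ec)
    have mono: "ip ?M (\<lambda>x. w T x * u T x) (u T) \<le> ip ?M (\<lambda>x. w 0 x * u 0 x) (u 0)"
      by (rule weighted_energy_nonincreasing[OF Sm sol', of 0 T w dw wt C])
        (use T wd dwc wtd wtc wb dwb wtb test in auto)
    have "ip ?M (\<lambda>x. w 0 x * u 0 x) (u 0) \<le> A"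
      unfolding A_def ip_def
    proof (rule integral_mono'[OF Ai])
      fix x assume "x \<in> space ?M"
      then have "u 0 x = u0 x" using sol' by (simp add: dirichlet_heat_solution_def)
      moreover have "w 0 x \<le> exp ((norm x)\<^sup>2 / 4)"
      proof -
        have "w 0 x \<le> 1 / exp (- (x \<bullet> x) / 4)" unfolding w_def W_def E_def k_def using \<mu> by (intro frac_le) auto
        also have "\<dots> = exp ((norm x)\<^sup>2 / 4)" by (simp add: exp_minus power2_norm_eq_inner field_simps)
        finally show ?thesis .
      qed
      ultimately show "(w 0 x * u 0 x) \<bullet> u 0 x \<le> (u0 x)\<^sup>2 * exp ((norm x)\<^sup>2 / 4)"
        using mult_right_mono[of "w 0 x" "exp ((norm x)\<^sup>2 / 4)" "(u0 x)\<^sup>2"] by (simp add: power2_eq_square mult_ac)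
    qed simp
    moreover have "1 / (k T + \<mu>) * sqnorm ?M (u T) \<le> ip ?M (\<lambda>x. w T x * u T x) (u T)"
    proof -
      have TT: "T \<in> {0..T}" using T by simp
      have cwT: "continuous_on UNIV (w T)" unfolding w_def[abs_def] by (rule wc[OF T])
      have wl: "l2 ?M (\<lambda>x. w T x * u T x)"
        using l2_scaleR_bounded[OF uT continuous_measurable_lebesgue_on[OF cwT] wb[OF TT]] by simp
      have "(\<integral>x. 1 / (k T + \<mu>) * (u T x \<bullet> u T x) \<partial>?M) \<le> (\<integral>x. (w T x * u T x) \<bullet> u T x \<partial>?M)"
      proof (rule integral_mono)
        show "integrable ?M (\<lambda>x. 1 / (k T + \<mu>) * (u T x \<bullet> u T x))" by (intro integrable_mult_right
          l2_integrable_inner[OF uT uT])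
        show "integrable ?M (\<lambda>x. (w T x * u T x) \<bullet> u T x)" by (rule l2_integrable_inner[OF wl uT])
        fix x :: "real \<times> real"
        have "E T (x \<bullet> x) \<le> k T * 1" unfolding E_def using k0[OF T] T by (intro mult_left_mono) (auto simp:
          divide_nonpos_pos)
        then have "1 / (k T + \<mu>) \<le> w T x" unfolding w_def W_def using E0[OF T, of "x \<bullet> x"] \<mu> by (intro frac_le) auto
        from mult_right_mono[OF this, of "u T x * u T x"]
        show "1 / (k T + \<mu>) * (u T x \<bullet> u T x) \<le> (w T x * u T x) \<bullet> u T x" by (simp add: mult.assoc)
      qed
      then show ?thesis by (simp add: ip_def)
    qed
    ultimately have "1 / (k T + \<mu>) * sqnorm ?M (u T) \<le> A" using mono by linarith
    then show ?thesis using k0(1)[OF T] \<mu> by (simp add: pos_divide_le_eq mult.commute)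
  qed
  have "sqnorm ?M (u T) \<le> k T * A"
  proof (rule field_le_epsilon)
    fix e :: real assume e: "0 < e"
    \<comment> \<open>With \<mu> = e / (A + 1) the error \<mu> A is below e, also when A =
      0.\<close>
    have "sqnorm ?M (u T) \<le> (k T + e / (A + 1)) * A" using bound[of "e / (A + 1)"] e A0 by simp
    also have "\<dots> = k T * A + e * (A / (A + 1))" by (simp add: distrib_right)
    also have "e * (A / (A + 1)) \<le> e * 1" using e A0 by (intro mult_left_mono) auto
    finally show "sqnorm ?M (u T) \<le> k T * A + e" by simp
  qed
  then show ?thesis unfolding S_def[symmetric] nA by (simp add: k_def p_def)
qed

theorem theorem2p7:
  fixes a R :: real and \<theta> \<theta>' :: "real \<Rightarrow> real"
  assumes a: "0 < a" "a \<le> 1"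
    and deriv: "\<And>r. 0 < r \<Longrightarrow> (\<theta> has_real_derivative \<theta>' r) (at r)"
    and cont: "continuous_on {0<..} \<theta>'"
    and bdd: "\<exists>M. \<forall>r>0. \<bar>r * \<theta>' r\<bar> \<le> M"
    and R: "0 < R" "\<And>r. r \<ge> R \<Longrightarrow> \<theta>' r = 0"
  shows "\<forall>\<epsilon>>0. \<forall>\<delta>>0. \<exists>C. \<forall>u0 u G.
           in_L2w (curved_wedge a \<theta>) u0 \<longrightarrow>
           dirichlet_heat_solution (curved_wedge a \<theta>) u0 u G \<longrightarrow>
           (\<forall>t\<ge>\<epsilon>. AE x in lebesgue_on (curved_wedge a \<theta>).
              \<bar>u t x\<bar> \<le> C * (1 + t - \<epsilon>) powr (- 1/2 - 1/(4*a) + \<delta>)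
                             * L2w_norm (curved_wedge a \<theta>) u0)"
proof (intro allI impI)
  fix \<epsilon> \<delta> :: real assume \<epsilon>: "0 < \<epsilon>" and \<delta>: "0 < \<delta>"
  let ?S = "curved_wedge a \<theta>"
  define c where "c = exp (1 / 4) / (pi * \<epsilon>)"
  have c: "0 < c" using \<epsilon> by (simp add: c_def)
  have So: "open ?S"
    using deriv by (intro open_curved_wedge[OF a] continuous_at_imp_continuous_on) (auto intro: DERIV_isCont)
  show "\<exists>C. \<forall>u0 u G. in_L2w ?S u0 \<longrightarrow> dirichlet_heat_solution ?S u0 u G \<longrightarrow>
           (\<forall>t\<ge>\<epsilon>. AE x in lebesgue_on ?S.
              \<bar>u t x\<bar> \<le> C * (1 + t - \<epsilon>) powr (- 1/2 - 1/(4*a) + \<delta>) * L2w_norm ?S u0)"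
  proof (intro exI[of _ "sqrt c"] allI impI)
    fix u0 u G t
    assume u0: "in_L2w ?S u0" and sol: "dirichlet_heat_solution ?S u0 u G" and t: "\<epsilon> \<le> t"
    let ?L = "L2w_norm ?S u0"
    have L0: "0 \<le> ?L" unfolding L2w_norm_def by (intro real_sqrt_ge_zero integral_nonneg_AE) auto
    define s where "s = 1 + t - \<epsilon>"
    have s: "1 \<le> s" using t by (simp add: s_def)
    \<comment> \<open>The time is split: decay acts up to t - \<epsilon>, where 1 + (t - \<epsilon>)
      is the base of the power, and the last \<epsilon> is spent on smoothing.\<close>
    have decay: "sqnorm (lebesgue_on ?S) (u (t - \<epsilon>)) \<le> s powr (- (1 + 1 / (2 * a))) * ?L\<^sup>2"
      using wedge_energy_decay[OF a deriv cont u0 sol, of "t - \<epsilon>"] t by (simp add: s_def algebra_simps)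
    have "AE x in lebesgue_on ?S. (u t x)\<^sup>2 \<le> c * sqnorm (lebesgue_on ?S) (u (t - \<epsilon>))"
      unfolding c_def by (rule L2_Linfty_smoothing[OF So sol \<epsilon> t])
    then show "AE x in lebesgue_on ?S. \<bar>u t x\<bar> \<le> sqrt c * (1 + t - \<epsilon>) powr (- 1/2 - 1/(4*a) + \<delta>) * ?L"
    proof eventually_elim
      case (elim x)
      \<comment> \<open>Decay was obtained for the squared norm; the square root halves the exponent
        1 + 1 / (2a).\<close>
      have half: "s powr (- (1 + 1 / (2 * a))) = (s powr (- 1/2 - 1/(4*a)))\<^sup>2"
      proof -
        have e: "- (1 + 1 / (2 * a)) = (- 1/2 - 1/(4*a)) + (- 1/2 - 1/(4*a))" using a by (simp add: field_simps)
        show ?thesis unfolding e powr_add power2_eq_square ..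
      qed
      have "(u t x)\<^sup>2 \<le> c * (s powr (- (1 + 1 / (2 * a))) * ?L\<^sup>2)"
        using elim mult_left_mono[OF decay, of c] c by linarith
      also have "\<dots> = (sqrt c * s powr (- 1/2 - 1/(4*a)) * ?L)\<^sup>2"
        unfolding half using c by (simp add: power_mult_distrib)
      finally have "\<bar>u t x\<bar>\<^sup>2 \<le> (sqrt c * s powr (- 1/2 - 1/(4*a)) * ?L)\<^sup>2" by simp
      then have "\<bar>u t x\<bar> \<le> sqrt c * s powr (- 1/2 - 1/(4*a)) * ?L"
        by (rule power2_le_imp_le) (use c L0 in simp)
      \<comment> \<open>The base s is at least 1, so adding \<delta> to the exponent can only
        enlarge the bound.\<close>
      also have "\<dots> \<le> sqrt c * s powr (- 1/2 - 1/(4*a) + \<delta>) * ?L"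
        using s \<delta> c L0 by (intro mult_right_mono mult_left_mono powr_mono) auto
      finally show ?case by (simp add: s_def)
    qed
  qed
qed

end
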